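(* Let $n\ge 1$. For each $n\times n$ totally nonnegative real matrix $A$ we have \[ \mathrm{per}(A)=\frac{\mathrm{Imm}_{\chi^{n}}(A)}{\chi^{n}(e)}\geq \frac{\mathrm{Imm}_{\chi^{n-1,1}}(A)}{\chi^{n-1,1}(e)}\geq \frac{\mathrm{Imm}_{\chi^{n-2,1,1}}(A)}{\chi^{n-2,1,1}(e)}\geq \cdots \geq \frac{\mathrm{Imm}_{\chi^{1,\dots,1}}(A)}{\chi^{1,\dots,1}(e)}=\det(A). \] Equivalently, for $k=2,\dots,n$ the polynomial \[ \frac{\mathrm{Imm}_{\chi^{k1^{n-k}}}(x)}{\chi^{k1^{n-k}}(e)}-\frac{\mathrm{Imm}_{\chi^{(k-1)1^{n-k+1}}}(x)}{\chi^{(k-1)1^{n-k+1}}(e)} =\frac{\mathrm{Imm}_{\chi^{k1^{n-k}}}(x)}{\binom{n-1}{k-1}}-\frac{\mathrm{Imm}_{\chi^{(k-1)1^{n-k+1}}}(x)}{\binom{n-1}{k-2}} \] is a totally nonnegative polynomial.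
   Context: A real $n\times n$ matrix is totally nonnegative if all its minors are nonnegative. For $\lambda\vdash n$, $\chi^\lambda$ denotes the irreducible character of the symmetric group $\mathfrak S_n$ indexed by $\lambda$, and $e$ is the identity of $\mathfrak S_n$. For a function $\theta:\mathfrak S_n\to\mathbb R$ and an $n\times n$ matrix $x=(x_{i,j})$ (of variables or numbers), the $\theta$-immanant is $\mathrm{Imm}_\theta(x)=\sum_{w\in\mathfrak S_n}\theta(w)\,x_{1,w(1)}\cdots x_{n,w(n)}$. The hook partition $k1^{n-k}$ is $(k,1,\dots,1)$ with $n-k$ ones. A polynomial $f$ in the $n^2$ variables $x_{i,j}$ is called totally nonnegative if $f(A)\ge 0$ for every $n\times n$ totally nonnegative matrix $A$. *)

theory Defs
  imports
    "Jordan_Normal_Form.Determinant"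
    "Jordan_Normal_Form.DL_Submatrix"
    "HOL-Library.Function_Algebras"
    "HOL-Library.Poly_Mapping"
begin

text \<open>
  Indices are shifted by one: matrix indices and the letters permuted by the symmetric group
  \<open>S\<^sub>n\<close> are \<open>0, \<dots>, n - 1\<close>, and \<open>S\<^sub>n\<close> is \<open>{w. w permutes {0..<n}}\<close> with composition of
  functions as product.
\<close>

subsection \<open>Totally nonnegative matrices, permanents and immanants\<close>

definition totally_nonnegative :: "real mat \<Rightarrow> bool" where
  "totally_nonnegative A \<longleftrightarrow>
     (\<forall>I J. I \<subseteq> {0..<dim_row A} \<longrightarrow> J \<subseteq> {0..<dim_col A} \<longrightarrow> card I = card J \<longrightarrow>
        0 \<le> det (submatrix A I J))"

definition permanent :: "'a::comm_ring_1 mat \<Rightarrow> 'a" where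
  "permanent A = (\<Sum>w | w permutes {0..<dim_row A}. \<Prod>i = 0..<dim_row A. A $$ (i, w i))"

text \<open>Entries may be numbers or, with \<open>'a\<close> a polynomial ring, variables.\<close>

definition immanant :: "((nat \<Rightarrow> nat) \<Rightarrow> 'a) \<Rightarrow> 'a::comm_ring_1 mat \<Rightarrow> 'a" where
  "immanant \<theta> A =
     (\<Sum>w | w permutes {0..<dim_row A}. \<theta> w * (\<Prod>i = 0..<dim_row A. A $$ (i, w i)))"


subsection \<open>Irreducible characters of the symmetric group\<close>

text \<open>
  The real irreducible module indexed by a partition \<open>\<lambda>\<close> of \<open>n\<close> (a weakly decreasing list of
  positive parts) is the Specht module, constructed as the left ideal \<open>\<real>[S\<^sub>n] c\<^sub>\<lambda>\<close> generated by
  the Young symmetrizer \<open>c\<^sub>\<lambda> = a\<^sub>\<lambda> b\<^sub>\<lambda>\<close>, where \<open>a\<^sub>\<lambda>\<close> is the sum over the row group and \<open>b\<^sub>\<lambda>\<close> the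
  signed sum over the column group of a tableau of shape \<open>\<lambda>\<close>. It is absolutely irreducible, so
  its character is the usual complex irreducible character. In this convention \<open>[n]\<close> gives the
  trivial and \<open>[1, \<dots>, 1]\<close> the sign character.

  Elements of \<open>\<real>[S\<^sub>n]\<close> are functions that vanish outside \<open>S\<^sub>n\<close>.
\<close>

definition fscale :: "real \<Rightarrow> ('a \<Rightarrow> real) \<Rightarrow> 'a \<Rightarrow> real" where
  "fscale c f = (\<lambda>x. c * f x)"

interpretation fun_vs: vector_space "fscale :: real \<Rightarrow> ('a \<Rightarrow> real) \<Rightarrow> 'a \<Rightarrow> real"
  by unfold_locales (auto simp: fscale_def fun_eq_iff algebra_simps)

text \<open>
  The trace of \<open>f\<close> on a finite-dimensional \<open>f\<close>-invariant subspace \<open>V\<close> on which \<open>f\<close> is linear: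
  the sum of the diagonal entries of its matrix in some basis of \<open>V\<close>.
\<close>

definition trace_on :: "('a \<Rightarrow> real) set \<Rightarrow> (('a \<Rightarrow> real) \<Rightarrow> ('a \<Rightarrow> real)) \<Rightarrow> real" where
  "trace_on V f =
     (let B = (SOME B. fun_vs.independent B \<and> fun_vs.span B = V)
      in \<Sum>b\<in>B. fun_vs.representation B (f b) b)"

definition group_algebra :: "nat \<Rightarrow> ((nat \<Rightarrow> nat) \<Rightarrow> real) set" where
  "group_algebra n = {f. \<forall>w. \<not> w permutes {0..<n} \<longrightarrow> f w = 0}"

definition ga_basis :: "(nat \<Rightarrow> nat) \<Rightarrow> (nat \<Rightarrow> nat) \<Rightarrow> real" where
  "ga_basis w = (\<lambda>u. if u = w then 1 else 0)"

definition ga_mult ::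
    "nat \<Rightarrow> ((nat \<Rightarrow> nat) \<Rightarrow> real) \<Rightarrow> ((nat \<Rightarrow> nat) \<Rightarrow> real) \<Rightarrow> (nat \<Rightarrow> nat) \<Rightarrow> real" where
  "ga_mult n f g =
     (\<lambda>w. if w permutes {0..<n} then \<Sum>u | u permutes {0..<n}. f u * g (inv_into UNIV u \<circ> w) else 0)"

text \<open>
  Row and column of the letter \<open>x\<close> in the tableau of shape \<open>\<lambda>\<close> that is filled with
  \<open>0, 1, 2, \<dots>\<close> row by row from left to right; only used for \<open>x < sum_list \<lambda>\<close>.
\<close>

fun tableau_row :: "nat list \<Rightarrow> nat \<Rightarrow> nat" where
  "tableau_row [] x = 0"
| "tableau_row (l # ls) x = (if x < l then 0 else Suc (tableau_row ls (x - l)))"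

fun tableau_col :: "nat list \<Rightarrow> nat \<Rightarrow> nat" where
  "tableau_col [] x = 0"
| "tableau_col (l # ls) x = (if x < l then x else tableau_col ls (x - l))"

definition row_group :: "nat list \<Rightarrow> (nat \<Rightarrow> nat) set" where
  "row_group sh = {p. p permutes {0..<sum_list sh} \<and>
     (\<forall>x<sum_list sh. tableau_row sh (p x) = tableau_row sh x)}"

definition column_group :: "nat list \<Rightarrow> (nat \<Rightarrow> nat) set" where
  "column_group sh = {q. q permutes {0..<sum_list sh} \<and>
     (\<forall>x<sum_list sh. tableau_col sh (q x) = tableau_col sh x)}"

definition young_symmetrizer :: "nat list \<Rightarrow> (nat \<Rightarrow> nat) \<Rightarrow> real" where
  "young_symmetrizer sh = ga_mult (sum_list sh)
     (\<lambda>p. if p \<in> row_group sh then 1 else 0)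
     (\<lambda>q. if q \<in> column_group sh then of_int (sign q) else 0)"

definition specht_module :: "nat list \<Rightarrow> ((nat \<Rightarrow> nat) \<Rightarrow> real) set" where
  "specht_module sh =
     (\<lambda>f. ga_mult (sum_list sh) f (young_symmetrizer sh)) ` group_algebra (sum_list sh)"

definition irr_char :: "nat list \<Rightarrow> (nat \<Rightarrow> nat) \<Rightarrow> real" where
  "irr_char sh w = trace_on (specht_module sh) (ga_mult (sum_list sh) (ga_basis w))"

definition hook :: "nat \<Rightarrow> nat \<Rightarrow> nat list" where
  "hook n k = k # replicate (n - k) 1"


subsection \<open>Polynomials in the entries of a matrix\<close>

text \<open>Real polynomials in variables \<open>x\<^sub>i\<^sub>j\<close>, as finitely supported functions on monomials.\<close>

type_synonym matrix_poly = "((nat \<times> nat) \<Rightarrow>\<^sub>0 nat) \<Rightarrow>\<^sub>0 real"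

definition pconst :: "real \<Rightarrow> matrix_poly" where
  "pconst c = Poly_Mapping.single 0 c"

definition pvar :: "nat \<times> nat \<Rightarrow> matrix_poly" where
  "pvar v = Poly_Mapping.single (Poly_Mapping.single v 1) 1"

definition pvars :: "matrix_poly \<Rightarrow> (nat \<times> nat) set" where
  "pvars f = (\<Union>m\<in>Poly_Mapping.keys f. Poly_Mapping.keys m)"

definition peval :: "matrix_poly \<Rightarrow> real mat \<Rightarrow> real" where
  "peval f A = (\<Sum>m\<in>Poly_Mapping.keys f. Poly_Mapping.lookup f m *
     (\<Prod>v\<in>Poly_Mapping.keys m. (A $$ v) ^ Poly_Mapping.lookup m v))"

definition generic_matrix :: "nat \<Rightarrow> matrix_poly mat" where
  "generic_matrix n = mat n n pvar"

definition immanant_poly :: "nat \<Rightarrow> ((nat \<Rightarrow> nat) \<Rightarrow> real) \<Rightarrow> matrix_poly" where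
  "immanant_poly n \<theta> = immanant (\<lambda>w. pconst (\<theta> w)) (generic_matrix n)"

definition totally_nonnegative_poly :: "nat \<Rightarrow> matrix_poly \<Rightarrow> bool" where
  "totally_nonnegative_poly n f \<longleftrightarrow>
     pvars f \<subseteq> {0..<n} \<times> {0..<n} \<and>
     (\<forall>A \<in> carrier_mat n n. totally_nonnegative A \<longrightarrow> 0 \<le> peval f A)"

end

theory Submission imports Defs
begin

text \<open>
  The hook character \<open>\<chi>\<close> of shape \<open>(n - m, 1, \<dots>, 1)\<close> is the character of the \<open>m\<close>-th exterior power
  of the reflection representation, that is, \<open>\<chi> w\<close> is the alternating sum
  \<open>E\<^sub>m - E\<^sub>m\<^sub>-\<^sub>1 + \<dots>\<close> of the sums \<open>E\<^sub>i\<close> of principal \<open>i\<close>-minors of the permutation matrix of \<open>w\<close>.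
  A totally nonnegative matrix is a limit of products of nonnegative bidiagonal and diagonal matrices
  (Neville elimination). Multiplying by such a factor changes the element
  \<open>\<Sum>\<^sub>w a\<^sub>1\<^sub>,\<^sub>w\<^sub>(\<^sub>1\<^sub>) \<dots> a\<^sub>n\<^sub>,\<^sub>w\<^sub>(\<^sub>n\<^sub>) w\<close> of the group algebra (Stembridge) by factors \<open>\<Sum>\<^sub>u u\<close>, where \<open>u\<close>
  permutes an interval \<open>J\<close>; on exterior powers such a sum acts, up to the scalar \<open>|J|!\<close>, as the exterior power of the matrix that
  averages over \<open>J\<close>. This reduces the claim to an inequality between the alternating sums of a product
  \<open>B\<close> of averaging matrices, taken in place of the permutation matrix. Such a \<open>B\<close> is stochastic
  and totally nonnegative, and its alternating sums are the sums \<open>e\<^sub>m\<close> of principal \<open>m\<close>-minors of the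
  matrix \<open>C\<close> that \<open>B\<close> induces on differences of consecutive coordinates. Now \<open>C\<close> is totally
  nonnegative with diagonal entries at most \<open>1\<close>, hence Fischer's inequality makes \<open>e\<^sub>m\<close>, divided by the
  number of minors, decrease in \<open>m\<close>.
\<close>

subsection \<open>Determinants of matrices given as functions\<close>

text \<open>A bidiagonal factor changes one column of \<open>A\<close> and destroys the form of an
  ordinary immanant, so an induction over factors needs a stronger statement. Positivity is carried
  for all weakly increasing words of columns and all totally nonnegative stochastic \<open>B\<close>
  at once. A word is symmetric in the positions of a repeated letter, and this is what permits
  averaging. Expanding a changed column also produces words that are not increasing; after averaging
  they have the same value as increasing ones, because the two columns involved are neighbours. At
  the identity matrix a single permutation survives, and only the inequality for \<open>B\<close>
  itself is left.

  Limits enter because elimination needs a positive pivot in the corner.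

  The binomial coefficients have two sources. As degrees of characters they come from the hook
  lengths, whose product is n (k-1)! (n-k)!; as normalization of the alternating sums they count the
  principal (n-k)-minors of the matrix induced on the n-1 differences. The inequality depends on the
  agreement of the two.\<close>

definition fdet :: "nat \<Rightarrow> (nat \<Rightarrow> nat \<Rightarrow> real) \<Rightarrow> real" where
  "fdet k M = det (mat k k (\<lambda>(i, j). M i j))"

lemma fdet_rows:
  "fdet k M = (\<Sum>p | p permutes {..<k}. of_int (sign p) * (\<Prod>i<k. M i (p i)))"
proof -
  have "fdet k M = (\<Sum>p | p permutes {0..<k}. of_int (sign p) *
      (\<Prod>i = 0..<k. mat k k (\<lambda>(i, j). M i j) $$ (i, p i)))"
    unfolding fdet_def by (subst det_def') auto
  also have "\<dots> = (\<Sum>p | p permutes {0..<k}. of_int (sign p) * (\<Prod>i = 0..<k. M i (p i)))"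
    by (intro sum.cong refl arg_cong2[of _ _ _ _ "(*)"] prod.cong)
      (auto dest: permutes_in_image)
  finally show ?thesis
    by (simp add: lessThan_atLeast0)
qed

lemma fdet_transpose: "fdet k (\<lambda>i j. M j i) = fdet k M"
proof -
  have "transpose_mat (mat k k (\<lambda>(i, j). M i j)) = mat k k (\<lambda>(i, j). M j i)"
    by auto
  then show ?thesis
    unfolding fdet_def by (metis det_transpose mat_carrier)
qed

lemma fdet_cols:
  "fdet k M = (\<Sum>p | p permutes {..<k}. of_int (sign p) * (\<Prod>j<k. M (p j) j))"
  using fdet_rows[of k "\<lambda>i j. M j i"] by (simp only: fdet_transpose[of k M])

lemma fdet_cong: "(\<And>i j. i < k \<Longrightarrow> j < k \<Longrightarrow> M i j = M' i j) \<Longrightarrow> fdet k M = fdet k M'"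
  unfolding fdet_def by (intro arg_cong[of _ _ det] cong_mat) auto

lemma fdet_0 [simp]: "fdet 0 M = 1"
  by (simp add: fdet_def)

lemma fdet_col_sum:
  assumes q: "q < k"
  shows "fdet k (\<lambda>i j. if j = q then \<Sum>y\<in>Y. a y * g y i else M i j) =
    (\<Sum>y\<in>Y. a y * fdet k (\<lambda>i j. if j = q then g y i else M i j))"
proof -
  have split: "(\<Prod>j<k. if j = q then h j else N j) = h q * (\<Prod>j\<in>{..<k} - {q}. N j)"
    for h N :: "nat \<Rightarrow> real"
    using q by (subst prod.remove[of _ q]) auto
  show ?thesis
    unfolding fdet_cols split sum_distrib_left sum_distrib_right
    by (subst sum.swap) (simp add: algebra_simps)
qed

lemma fdet_row_sum:
  assumes q: "q < k"
  shows "fdet k (\<lambda>i j. if i = q then \<Sum>y\<in>Y. a y * g y j else M i j) =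
    (\<Sum>y\<in>Y. a y * fdet k (\<lambda>i j. if i = q then g y j else M i j))"
  using fdet_col_sum[OF q, where M = "\<lambda>i j. M j i" and Y = Y and a = a and g = g]
  by (simp only: fdet_transpose[of k "\<lambda>i j. if i = q then f j else M i j" for f])

lemma fdet_col_add:
  assumes "q < k"
  shows "fdet k (\<lambda>i j. if j = q then f i + t * g i else M i j) =
    fdet k (\<lambda>i j. if j = q then f i else M i j) + t * fdet k (\<lambda>i j. if j = q then g i else M i j)"
  \<comment> \<open>The two summands are indexed by the booleans.\<close>
  using fdet_col_sum[OF assms, where Y = "{True, False}" and a = "\<lambda>b. if b then 1 else t"
      and g = "\<lambda>b. if b then f else g" and M = M]
  by (simp cong: if_cong)

lemma fdet_row_add:
  assumes "q < k"
  shows "fdet k (\<lambda>i j. if i = q then f j + t * g j else M i j) =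
    fdet k (\<lambda>i j. if i = q then f j else M i j) + t * fdet k (\<lambda>i j. if i = q then g j else M i j)"
  using fdet_row_sum[OF assms, where Y = "{True, False}" and a = "\<lambda>b. if b then 1 else t"
      and g = "\<lambda>b. if b then f else g" and M = M]
  by (simp cong: if_cong)

lemma fdet_eq_rows:
  assumes "a < k" "b < k" "a \<noteq> b" "\<And>j. j < k \<Longrightarrow> M a j = M b j"
  shows "fdet k M = 0"
  unfolding fdet_def
  by (rule det_identical_rows[of _ k a b]) (use assms in \<open>auto simp: row_def intro!: eq_vecI\<close>)

lemma fdet_eq_cols:
  assumes "a < k" "b < k" "a \<noteq> b" "\<And>i. i < k \<Longrightarrow> M i a = M i b"
  shows "fdet k M = 0"
  by (subst fdet_transpose[symmetric], rule fdet_eq_rows[of a k b]) (use assms in auto)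

lemma fdet_zero_row:
  assumes "a < k" "\<And>j. j < k \<Longrightarrow> M a j = 0"
  shows "fdet k M = 0"
  unfolding fdet_rows
proof (intro sum.neutral ballI)
  fix p assume "p \<in> {p. p permutes {..<k}}"
  then have "p a < k"
    using assms(1) permutes_in_image by fastforce
  then show "of_int (sign p) * (\<Prod>i<k. M i (p i)) = 0"
    using assms by (auto intro!: prod_zero)
qed

lemma fdet_zero_col:
  assumes "a < k" "\<And>i. i < k \<Longrightarrow> M i a = 0"
  shows "fdet k M = 0"
  by (subst fdet_transpose[symmetric], rule fdet_zero_row[of a k]) (use assms in auto)

lemma fdet_add_rows:
  assumes "finite S" "q \<notin> S" "q < k" "S \<subseteq> {..<k}"
  shows "fdet k (\<lambda>i j. if i \<in> S then M i j + t i * M q j else M i j) = fdet k M"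
  using assms
proof (induction S rule: finite_induct)
  case (insert s S)
  let ?N = "\<lambda>i j. if i \<in> S then M i j + t i * M q j else M i j"
  have "fdet k (\<lambda>i j. if i \<in> insert s S then M i j + t i * M q j else M i j) =
      fdet k (\<lambda>i j. if i = s then M s j + t s * M q j else ?N i j)"
    by (intro fdet_cong) auto
  also have "\<dots> = fdet k (\<lambda>i j. if i = s then M s j else ?N i j) +
      t s * fdet k (\<lambda>i j. if i = s then M q j else ?N i j)"
    using insert.prems by (intro fdet_row_add) auto
  also have "fdet k (\<lambda>i j. if i = s then M q j else ?N i j) = 0"
    by (rule fdet_eq_rows[of s _ q]) (use insert.prems in auto)
  also have "fdet k (\<lambda>i j. if i = s then M s j else ?N i j) = fdet k ?N"
    by (intro fdet_cong) (use insert.hyps in auto)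
  finally show ?case
    using insert by simp
qed simp

lemma fdet_col_0:
  "fdet (Suc k) M = (\<Sum>i<Suc k. (-1) ^ i * M i 0 * fdet k (\<lambda>a b. M (insert_index i a) (Suc b)))"
proof -
  have "fdet (Suc k) M = (\<Sum>i<Suc k. mat (Suc k) (Suc k) (\<lambda>(i, j). M i j) $$ (i, 0) *
      cofactor (mat (Suc k) (Suc k) (\<lambda>(i, j). M i j)) i 0)"
    unfolding fdet_def by (rule laplace_expansion_column) auto
  also have "\<dots> = (\<Sum>i<Suc k. M i 0 * ((-1) ^ i * fdet k (\<lambda>a b. M (insert_index i a) (Suc b))))"
    unfolding cofactor_def fdet_def mat_delete_def
    by (intro sum.cong arg_cong2[of _ _ _ _ "(*)"] arg_cong[of _ _ det] cong_mat refl)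
      (auto simp: insert_index_def)
  finally show ?thesis
    by (simp add: algebra_simps)
qed

lemma fdet_col_0_single:
  assumes "\<And>i. 0 < i \<Longrightarrow> i < Suc k \<Longrightarrow> M i 0 = 0"
  shows "fdet (Suc k) M = M 0 0 * fdet k (\<lambda>a b. M (Suc a) (Suc b))"
  unfolding fdet_col_0
  by (subst sum.remove[of _ 0])
    (auto simp: insert_index_def assms intro!: sum.neutral)

lemma fdet_permute_rows:
  assumes p: "p permutes {..<k}"
  shows "fdet k (\<lambda>i j. M (p i) j) = of_int (sign p) * fdet k M"
proof -
  have "mat k k (\<lambda>(i, j). mat k k (\<lambda>(i, j). M i j) $$ (p i, j)) = mat k k (\<lambda>(i, j). M (p i) j)"
    using permutes_in_image[OF p] by (intro cong_mat) auto
  then show ?thesis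
    using det_permute_rows[of "mat k k (\<lambda>(i, j). M i j)" k p] p
    by (simp add: fdet_def lessThan_atLeast0)
qed

lemma fdet_permute_cols:
  assumes p: "p permutes {..<k}"
  shows "fdet k (\<lambda>i j. M i (p j)) = of_int (sign p) * fdet k M"
  using fdet_permute_rows[OF p, of "\<lambda>i j. M j i"]
  by (simp add: fdet_transpose[of k M] fdet_transpose[of k "\<lambda>i j. M i (p j)"])

lemma fdet_conj_permute:
  assumes p: "p permutes {..<k}"
  shows "fdet k (\<lambda>i j. M (p i) (p j)) = fdet k M"
  by (simp add: fdet_permute_rows[OF p, of "\<lambda>i j. M i (p j)"] fdet_permute_cols[OF p]
      flip: mult.assoc of_int_mult)

text \<open>Conjugation by a permutation multiplies by its sign twice. The reversal lets a largest
  index be handled like a smallest one.\<close>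

lemma fdet_rev: "fdet k (\<lambda>i j. M (k - Suc i) (k - Suc j)) = fdet k M"
proof -
  let ?p = "\<lambda>i. if i < k then k - Suc i else i"
  have "bij_betw ?p {..<k} {..<k}"
    by (rule bij_betw_byWitness[where f' = ?p]) auto
  then have "?p permutes {..<k}"
    by (rule bij_imp_permutes) auto
  from fdet_conj_permute[OF this, of M] have "fdet k (\<lambda>i j. M (?p i) (?p j)) = fdet k M" .
  moreover have "fdet k (\<lambda>i j. M (?p i) (?p j)) = fdet k (\<lambda>i j. M (k - Suc i) (k - Suc j))"
    by (rule fdet_cong) simp
  ultimately show ?thesis by simp
qed

text \<open>The cycle that brings row \<open>q\<close> to the front consists of \<open>q\<close>
  adjacent transpositions; the induction splits off one of them.\<close>

lemma fdet_front_row: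
  assumes "q < k"
  shows "fdet k (\<lambda>i j. M (if i = 0 then q else if i \<le> q then i - 1 else i) j) = (-1) ^ q * fdet k M"
  using assms
proof (induction q arbitrary: M)
  case 0
  have "fdet k (\<lambda>i j. M (if i = 0 then 0 else if i \<le> 0 then i - 1 else i) j) = fdet k M"
    by (rule fdet_cong) auto
  then show ?case by simp
next
  case (Suc q)
  let ?s = "transpose q (Suc q)"
  have "fdet k (\<lambda>i j. M (if i = 0 then Suc q else if i \<le> Suc q then i - 1 else i) j) =
      fdet k (\<lambda>i j. M (?s (if i = 0 then q else if i \<le> q then i - 1 else i)) j)"
    by (rule fdet_cong) (auto simp: transpose_def)
  also have "\<dots> = (-1) ^ q * fdet k (\<lambda>i j. M (?s i) j)"
    using Suc.prems by (intro Suc.IH[of "\<lambda>i j. M (?s i) j"]) auto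
  also have "fdet k (\<lambda>i j. M (?s i) j) = - fdet k M"
    using Suc.prems by (subst fdet_permute_rows) (auto intro: permutes_swap_id simp: sign_swap_id)
  finally show ?case by simp
qed

subsection \<open>Total nonnegativity and Fischer's inequality\<close>

text \<open>
  Repeated indices give zero minors. Allowing them makes the condition stable under weakly
  monotone reindexing of rows and columns.
\<close>

definition TN :: "nat set \<Rightarrow> nat set \<Rightarrow> (nat \<Rightarrow> nat \<Rightarrow> real) \<Rightarrow> bool" where
  "TN I J A \<longleftrightarrow> (\<forall>k r c. mono_on {..<k} r \<longrightarrow> mono_on {..<k} c \<longrightarrow>
     r ` {..<k} \<subseteq> I \<longrightarrow> c ` {..<k} \<subseteq> J \<longrightarrow> 0 \<le> fdet k (\<lambda>i j. A (r i) (c j)))"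

lemma TN_D:
  assumes "TN I J A" "mono_on {..<k} r" "mono_on {..<k} c" "r ` {..<k} \<subseteq> I" "c ` {..<k} \<subseteq> J"
  shows "0 \<le> fdet k (\<lambda>i j. A (r i) (c j))"
  using assms unfolding TN_def by blast

lemma strict_mono_on_if_inj:
  fixes f :: "'a::linorder \<Rightarrow> 'b::order"
  assumes "mono_on S f" "inj_on f S"
  shows "strict_mono_on S f"
  using assms by (intro strict_mono_onI) (metis inj_on_eq_iff less_imp_le mono_onD order.not_eq_order_implies_strict order_less_irrefl)

lemma TN_I:
  assumes "\<And>k r c. strict_mono_on {..<k} r \<Longrightarrow> strict_mono_on {..<k} c \<Longrightarrow>
     r ` {..<k} \<subseteq> I \<Longrightarrow> c ` {..<k} \<subseteq> J \<Longrightarrow> 0 \<le> fdet k (\<lambda>i j. A (r i) (c j))"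
  shows "TN I J A"
  unfolding TN_def
proof (intro allI impI)
  fix k and r c :: "nat \<Rightarrow> nat"
  assume *: "mono_on {..<k} r" "mono_on {..<k} c" "r ` {..<k} \<subseteq> I" "c ` {..<k} \<subseteq> J"
  consider "inj_on r {..<k}" "inj_on c {..<k}" | "\<not> inj_on r {..<k}" | "\<not> inj_on c {..<k}"
    by blast
  then show "0 \<le> fdet k (\<lambda>i j. A (r i) (c j))"
  proof cases
    case 1
    then show ?thesis
      using * strict_mono_on_if_inj by (intro assms)
  next
    case 2
    then obtain a b where "a < k" "b < k" "a \<noteq> b" "r a = r b"
      by (auto simp: inj_on_def)
    then show ?thesis
      using fdet_eq_rows[of a k b "\<lambda>i j. A (r i) (c j)"] by simp
  next
    case 3
    then obtain a b where "a < k" "b < k" "a \<noteq> b" "c a = c b"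
      by (auto simp: inj_on_def)
    then show ?thesis
      using fdet_eq_cols[of a k b "\<lambda>i j. A (r i) (c j)"] by simp
  qed
qed

lemma TN_transpose: "TN I J A \<Longrightarrow> TN J I (\<lambda>i j. A j i)"
  unfolding TN_def using fdet_transpose[of k "\<lambda>i j. A (r i) (c j)" for k r c]
  by metis

lemma TN_mono: "TN I J A \<Longrightarrow> I' \<subseteq> I \<Longrightarrow> J' \<subseteq> J \<Longrightarrow> TN I' J' A"
  unfolding TN_def by (meson order_trans)

lemma TN_cong:
  assumes "\<And>i j. i \<in> I \<Longrightarrow> j \<in> J \<Longrightarrow> A i j = B i j"
  shows "TN I J A \<longleftrightarrow> TN I J B"
proof -
  have "fdet k (\<lambda>i j. A (r i) (c j)) = fdet k (\<lambda>i j. B (r i) (c j))"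
    if "r ` {..<k} \<subseteq> I" "c ` {..<k} \<subseteq> J" for k r c
    using that by (intro fdet_cong assms) auto
  then show ?thesis
    unfolding TN_def by metis
qed

lemma TN_reindex:
  assumes "TN I J A" "mono_on I' f" "mono_on J' g" "f ` I' \<subseteq> I" "g ` J' \<subseteq> J"
  shows "TN I' J' (\<lambda>i j. A (f i) (g j))"
  unfolding TN_def
proof (intro allI impI)
  fix k and r c :: "nat \<Rightarrow> nat"
  assume *: "mono_on {..<k} r" "mono_on {..<k} c" "r ` {..<k} \<subseteq> I'" "c ` {..<k} \<subseteq> J'"
  have "mono_on {..<k} (f \<circ> r)" "mono_on {..<k} (g \<circ> c)"
    using * assms(2,3) by (auto simp: mono_on_def image_subset_iff)
  moreover have "(f \<circ> r) ` {..<k} \<subseteq> I" "(g \<circ> c) ` {..<k} \<subseteq> J"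
    using * assms(4,5) by (fastforce simp: image_subset_iff)+
  ultimately show "0 \<le> fdet k (\<lambda>i j. A (f (r i)) (g (c j)))"
    using TN_D[OF assms(1), of k "f \<circ> r" "g \<circ> c"] by simp
qed

lemma fdet_1 [simp]: "fdet (Suc 0) M = M 0 0"
  using fdet_col_0_single[of 0 M] by simp

lemma fdet_2: "fdet 2 M = M 0 0 * M 1 1 - M 1 0 * M 0 1"
  using fdet_col_0[of 1 M] by (simp add: insert_index_def numeral_2_eq_2)

lemma TN_nonneg: "TN I J A \<Longrightarrow> i \<in> I \<Longrightarrow> j \<in> J \<Longrightarrow> 0 \<le> A i j"
  using TN_D[of I J A "Suc 0" "\<lambda>_. i" "\<lambda>_. j"] by (auto simp: mono_on_def)

lemma TN_minor2:
  assumes "TN I J A" "i \<le> i'" "j \<le> j'" "i \<in> I" "i' \<in> I" "j \<in> J" "j' \<in> J"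
  shows "A i' j * A i j' \<le> A i j * A i' j'"
proof -
  have "0 \<le> fdet 2 (\<lambda>a b. A (if a = 0 then i else i') (if b = 0 then j else j'))"
    by (rule TN_D[OF assms(1)]) (use assms in \<open>auto simp: mono_on_def\<close>)
  then show ?thesis by (simp add: fdet_2)
qed

section \<open>Schur complements at an extreme index\<close>

definition schur :: "nat \<Rightarrow> (nat \<Rightarrow> nat \<Rightarrow> real) \<Rightarrow> nat \<Rightarrow> nat \<Rightarrow> real" where
  "schur m A = (\<lambda>i j. A i j - A i m * A m j / A m m)"

text \<open>Bordering a minor by row and column \<open>m\<close> and clearing the first column with
  the pivot \<open>A m m\<close> leaves the minor of the Schur complement.\<close>

lemma schur_fdet:
  assumes "A m m \<noteq> 0"
  shows "A m m * fdet k (\<lambda>i j. schur m A (r i) (c j)) =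
    fdet (Suc k) (\<lambda>i j. A (case i of 0 \<Rightarrow> m | Suc i \<Rightarrow> r i) (case j of 0 \<Rightarrow> m | Suc j \<Rightarrow> c j))"
proof -
  let ?M = "\<lambda>i j. A (case i of 0 \<Rightarrow> m | Suc i \<Rightarrow> r i) (case j of 0 \<Rightarrow> m | Suc j \<Rightarrow> c j)"
  let ?t = "\<lambda>i. - ?M i 0 / A m m"
  have "fdet (Suc k) ?M = fdet (Suc k) (\<lambda>i j. if i \<in> {1..<Suc k} then ?M i j + ?t i * ?M 0 j else ?M i j)"
    by (rule fdet_add_rows[symmetric]) auto
  also have "\<dots> = A m m * fdet k (\<lambda>a b. schur m A (r a) (c b))"
  proof (subst fdet_col_0_single)
    show "(if 0 \<in> {1..<Suc k} then ?M 0 0 + ?t 0 * ?M 0 0 else ?M 0 0) *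
        fdet k (\<lambda>a b. if Suc a \<in> {1..<Suc k} then ?M (Suc a) (Suc b) + ?t (Suc a) * ?M 0 (Suc b)
          else ?M (Suc a) (Suc b)) = A m m * fdet k (\<lambda>a b. schur m A (r a) (c b))"
      using assms by (auto simp: schur_def field_simps intro!: fdet_cong)
  qed (use assms in auto)
  finally show ?thesis by simp
qed

text \<open>At an extreme index \<open>m\<close>, words bordered by \<open>m\<close> can be kept
  monotone, so that bordered minors of \<open>A\<close> fall under \<open>TN\<close> again.\<close>

definition corner :: "nat \<Rightarrow> nat set \<Rightarrow> bool" where
  "corner m I \<longleftrightarrow> m \<in> I \<and> ((\<forall>i\<in>I. m \<le> i) \<or> (\<forall>i\<in>I. i \<le> m))"

lemma TN_schur:
  assumes "TN I I A" "corner m I" "A m m > 0"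
  shows "TN (I - {m}) (I - {m}) (schur m A)"
  unfolding TN_def
proof (intro allI impI)
  fix k and r c :: "nat \<Rightarrow> nat"
  assume rc: "mono_on {..<k} r" "mono_on {..<k} c" "r ` {..<k} \<subseteq> I - {m}" "c ` {..<k} \<subseteq> I - {m}"
  have m: "m \<in> I" using assms(2) by (simp add: corner_def)
  let ?e = "\<lambda>r i. case i of 0 \<Rightarrow> m | Suc i \<Rightarrow> r i"
  have "0 \<le> A m m * fdet k (\<lambda>i j. schur m A (r i) (c j))"
  proof (cases "\<forall>i\<in>I. m \<le> i")
    case True
    have "A m m * fdet k (\<lambda>i j. schur m A (r i) (c j)) = fdet (Suc k) (\<lambda>i j. A (?e r i) (?e c j))"
      using assms(3) by (intro schur_fdet) simp
    also have "0 \<le> \<dots>"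
    proof (rule TN_D[OF assms(1)])
      show "mono_on {..<Suc k} (?e r)" "mono_on {..<Suc k} (?e c)"
        using rc True by (fastforce simp: mono_on_def image_subset_iff split: nat.splits)+
      show "?e r ` {..<Suc k} \<subseteq> I" "?e c ` {..<Suc k} \<subseteq> I"
        using rc m by (fastforce simp: image_subset_iff split: nat.splits)+
    qed
    finally show ?thesis .
  next
    case False
    then have le: "\<forall>i\<in>I. i \<le> m" using assms(2) unfolding corner_def by blast
    let ?f = "\<lambda>r i. if i < k then r i else m"
    let ?v = "\<lambda>r i. r (k - Suc i)"
    \<comment> \<open>Now \<open>m\<close> has to come last. The reversed words are bordered in
      front, and reversing the bordered minor gives the monotone words \<open>?f r\<close> and
      \<open>?f c\<close>.\<close>
    have "A m m * fdet k (\<lambda>i j. schur m A (r i) (c j)) = A m m * fdet k (\<lambda>i j. schur m A (?v r i) (?v c j))"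
      using fdet_rev[of k "\<lambda>i j. schur m A (r i) (c j)"] by simp
    also have "\<dots> = fdet (Suc k) (\<lambda>i j. A (?e (?v r) i) (?e (?v c) j))"
      using assms(3) by (intro schur_fdet) simp
    also have "\<dots> = fdet (Suc k) (\<lambda>i j. A (?f r (Suc k - Suc i)) (?f c (Suc k - Suc j)))"
      by (intro fdet_cong) (auto split: nat.splits)
    also have "\<dots> = fdet (Suc k) (\<lambda>i j. A (?f r i) (?f c j))"
      by (rule fdet_rev)
    also have "0 \<le> \<dots>"
      by (rule TN_D[OF assms(1)])
        (use rc le m in \<open>auto simp: mono_on_def image_subset_iff\<close>)
    finally show ?thesis .
  qed
  with assms(3) show "0 \<le> fdet k (\<lambda>i j. schur m A (r i) (c j))"
    by (simp add: zero_le_mult_iff)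
qed

text \<open>The 2 x 2 minors through an extreme index give \<open>A i m * A m j\<close> \<le>
  \<open>A m m * A i j\<close>, which is 0 here. All these products vanish, so the row or the column
  is zero.\<close>

lemma TN_corner_zero:
  assumes "TN I I A" "corner m I" "A m m = 0"
  shows "(\<forall>j\<in>I. A m j = 0) \<or> (\<forall>i\<in>I. A i m = 0)"
proof -
  have m: "m \<in> I" using assms(2) by (simp add: corner_def)
  have "A m j * A i m = 0" if ij: "i \<in> I" "j \<in> I" for i j
  proof -
    have "A i m * A m j \<le> A m m * A i j"
      using TN_minor2[OF assms(1), of m i m j] TN_minor2[OF assms(1), of i m j m] assms(2) m ij
      by (auto simp: corner_def mult.commute)
    then have "A i m * A m j \<le> 0"
      using assms(3) by simp
    moreover have "0 \<le> A i m * A m j"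
      using TN_nonneg[OF assms(1)] ij m by (intro mult_nonneg_nonneg) auto
    ultimately have "A i m * A m j = 0" by linarith
    then show ?thesis by auto
  qed
  then show ?thesis by auto
qed

text \<open>The complement of \<open>I\<close> is padded with the identity: all principal minors
  then have the same size \<open>n\<close>, and no enumeration of \<open>I\<close> enters.\<close>

definition pminor :: "nat \<Rightarrow> (nat \<Rightarrow> nat \<Rightarrow> real) \<Rightarrow> nat set \<Rightarrow> real" where
  "pminor n A I = fdet n (\<lambda>i j. if i \<in> I \<and> j \<in> I then A i j else if i = j then 1 else 0)"

text \<open>Only permutations fixing \<open>m\<close> contribute to the Leibniz expansion, and these
  do not see the other entries of row \<open>m\<close>, which may thus become a unit row.\<close>

lemma fdet_diag_col:
  assumes "m < k" "\<And>i. i < k \<Longrightarrow> i \<noteq> m \<Longrightarrow> M i m = 0"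
  shows "fdet k M = M m m * fdet k (\<lambda>i j. if i = m then if j = m then 1 else 0 else M i j)"
  unfolding fdet_cols sum_distrib_left
proof (intro sum.cong refl)
  fix p assume "p \<in> {p. p permutes {..<k}}"
  then have p: "p permutes {..<k}" by simp
  show "of_int (sign p) * (\<Prod>j<k. M (p j) j) = M m m * (of_int (sign p) *
      (\<Prod>j<k. if p j = m then if j = m then 1 else 0 else M (p j) j))"
  proof (cases "p m = m")
    case True
    have "p j \<noteq> m" if "j \<noteq> m" for j
      using permutes_inj[OF p] True that by (metis injD)
    then have "(\<Prod>j\<in>{..<k} - {m}. if p j = m then if j = m then 1 else 0 else M (p j) j) =
        (\<Prod>j\<in>{..<k} - {m}. M (p j) j)"
      by (intro prod.cong) auto
    with True show ?thesis
      using assms(1) by (simp add: prod.remove[of "{..<k}" m])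
  next
    case False
    have "p m < k" using permutes_in_image[OF p] assms(1) by fastforce
    then have 1: "(\<Prod>j<k. M (p j) j) = 0"
      using assms False by (intro prod_zero) auto
    obtain j where j: "p j = m" "j < k"
      using p assms(1) by (metis lessThan_iff permutes_inverses(1) permutes_in_image)
    then have "j \<noteq> m" using False by auto
    with j have "(\<Prod>j<k. if p j = m then if j = m then 1 else 0 else M (p j) j) = 0"
      by (intro prod_zero) auto
    with 1 show ?thesis by (simp only: mult_zero_right)
  qed
qed

text \<open>Row operations with pivot row \<open>m\<close> clear column \<open>m\<close> within
  \<open>I\<close>; making row \<open>m\<close> a unit row then moves \<open>m\<close> into the
  padding.\<close>

lemma pminor_schur:
  assumes "m \<in> I" "I \<subseteq> {..<n}" "A m m \<noteq> 0"
  shows "pminor n A I = A m m * pminor n (schur m A) (I - {m})"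
proof -
  let ?M = "\<lambda>i j. if i \<in> I \<and> j \<in> I then A i j else if i = j then 1 else 0"
  let ?t = "\<lambda>i. - A i m / A m m"
  let ?N = "\<lambda>i j. if i \<in> I - {m} then ?M i j + ?t i * ?M m j else ?M i j"
  have "pminor n A I = fdet n ?N"
    unfolding pminor_def using assms by (intro fdet_add_rows[symmetric]) (auto intro: finite_subset)
  also have "\<dots> = ?N m m * fdet n (\<lambda>i j. if i = m then if j = m then 1 else 0 else ?N i j)"
    using assms by (intro fdet_diag_col) auto
  also have "fdet n (\<lambda>i j. if i = m then if j = m then 1 else 0 else ?N i j) =
      pminor n (schur m A) (I - {m})"
    unfolding pminor_def
  proof (intro fdet_cong)
    fix i j
    show "(if i = m then if j = m then 1 else 0 else ?N i j) =
        (if i \<in> I - {m} \<and> j \<in> I - {m} then schur m A i j else if i = j then 1 else 0)"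
      using assms by (cases "i = m"; cases "j = m"; cases "i \<in> I"; cases "j \<in> I")
        (simp_all add: schur_def)
  qed
  finally show ?thesis using assms by simp
qed

lemma pminor_empty [simp]: "pminor n A {} = 1"
proof -
  have "mat n n (\<lambda>(i, j). if i = j then 1 else (0::real)) = 1\<^sub>m n" by auto
  then show ?thesis
    by (simp add: pminor_def fdet_def)
qed

lemma pminor_corner_zero:
  assumes "TN I I A" "corner m I" "A m m = 0" "I \<subseteq> {..<n}"
  shows "pminor n A I = 0"
proof -
  have m: "m \<in> I" "m < n" using assms(2,4) by (auto simp: corner_def)
  from TN_corner_zero[OF assms(1-3)] show ?thesis
  proof
    assume "\<forall>j\<in>I. A m j = 0"
    then show ?thesis
      unfolding pminor_def using m by (intro fdet_zero_row[of m]) auto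
  next
    assume "\<forall>i\<in>I. A i m = 0"
    then show ?thesis
      unfolding pminor_def using m by (intro fdet_zero_col[of m]) auto
  qed
qed

lemma corner_Min: "finite I \<Longrightarrow> I \<noteq> {} \<Longrightarrow> corner (Min I) I"
  by (simp add: corner_def)

lemma corner_Max: "finite I \<Longrightarrow> I \<noteq> {} \<Longrightarrow> corner (Max I) I"
  by (simp add: corner_def)

text \<open>\<open>TN\<close> speaks about monotone words, not about padded minors. Peeling off the
  smallest index by Schur complements avoids a translation between the two.\<close>

lemma pminor_nonneg:
  assumes "TN I I A" "I \<subseteq> {..<n}"
  shows "0 \<le> pminor n A I"
  using assms
proof (induction "card I" arbitrary: I A)
  case 0
  then have "I = {}" by (simp add: finite_subset[of I "{..<n}"])
  then show ?case by simp
next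
  case (Suc k)
  have fin: "finite I" using Suc.prems(2) by (rule finite_subset) simp
  define m where "m = Min I"
  have m: "corner m I" "m \<in> I"
    using Suc.hyps(2) corner_Min[OF fin] unfolding m_def corner_def by fastforce+
  show ?case
  proof (cases "A m m = 0")
    case True
    then show ?thesis using pminor_corner_zero[OF Suc.prems(1) m(1) _ Suc.prems(2)] by simp
  next
    case False
    then have pos: "A m m > 0" using TN_nonneg[OF Suc.prems(1) m(2) m(2)] by simp
    have "0 \<le> pminor n (schur m A) (I - {m})"
      using Suc.hyps(2) Suc.prems(2) m(2) fin
      by (intro Suc.hyps(1) TN_schur[OF Suc.prems(1) m(1) pos]) auto
    then show ?thesis
      using pminor_schur[where A = A, OF m(2) Suc.prems(2) False] pos by simp
  qed
qed

text \<open>Unless \<open>I\<close> is a singleton, it has an extreme index \<open>m\<close> other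
  than \<open>i\<close>. Passing to the Schur complement at \<open>m\<close> takes the factor
  \<open>A m m\<close> out of both minors, keeps total nonnegativity and can only lower the entry at
  \<open>i\<close>, so induction applies.\<close>

theorem pminor_fischer:
  assumes "TN I I A" "I \<subseteq> {..<n}" "i \<in> I"
  shows "pminor n A I \<le> A i i * pminor n A (I - {i})"
  using assms
proof (induction "card I" arbitrary: I A)
  case 0
  then have "I = {}" by (simp add: finite_subset[of I "{..<n}"])
  then show ?case using 0 by simp
next
  case (Suc k)
  have fin: "finite I" using Suc.prems(2) by (rule finite_subset) simp
  show ?case
  proof (cases "I = {i}")
    case True
    have "corner i I" using True by (simp add: corner_def)
    then show ?thesis
      using pminor_corner_zero[OF Suc.prems(1) _ _ Suc.prems(2)]
        pminor_schur[of i I n A] Suc.prems True by (cases "A i i = 0") auto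
  next
    case False
    have "\<exists>m. corner m I \<and> m \<noteq> i"
    proof (cases "Min I = i")
      case True
      then have "Max I \<noteq> i"
        using False fin Suc.prems(3)
        by (metis Max_ge Min_le antisym insertI1 singletonD subsetI subset_antisym empty_subsetI insert_subset)
      then show ?thesis using corner_Max[OF fin] Suc.prems(3) by blast
    next
      case False
      then show ?thesis using corner_Min[OF fin] Suc.prems(3) by blast
    qed
    then obtain m where m: "corner m I" "m \<noteq> i" "m \<in> I" by (auto simp: corner_def)
    have nn: "0 \<le> A i i * pminor n A (I - {i})"
      using TN_nonneg[OF Suc.prems(1,3,3)] Suc.prems
      by (intro mult_nonneg_nonneg pminor_nonneg TN_mono[OF Suc.prems(1)]) auto
    show ?thesis
    proof (cases "A m m = 0")
      case True
      then show ?thesis using pminor_corner_zero[OF Suc.prems(1) m(1) _ Suc.prems(2)] nn by simp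
    next
      case nz: False
      then have pos: "A m m > 0" using TN_nonneg[OF Suc.prems(1) m(3) m(3)] by simp
      let ?S = "schur m A"
      have TS: "TN (I - {m}) (I - {m}) ?S" by (rule TN_schur[OF Suc.prems(1) m(1) pos])
      have "pminor n ?S (I - {m}) \<le> ?S i i * pminor n ?S (I - {m} - {i})"
        using Suc.hyps(2) Suc.prems m fin by (intro Suc.hyps(1) TS) auto
      also have "\<dots> \<le> A i i * pminor n ?S (I - {m} - {i})"
      proof (rule mult_right_mono)
        show "?S i i \<le> A i i"
          using TN_nonneg[OF Suc.prems(1)] m(3) Suc.prems(3) pos by (simp add: schur_def)
        show "0 \<le> pminor n ?S (I - {m} - {i})"
          using Suc.prems(2) by (intro pminor_nonneg TN_mono[OF TS]) auto
      qed
      also have "I - {m} - {i} = I - {i} - {m}" by auto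
      finally have "pminor n A I \<le> A m m * (A i i * pminor n ?S (I - {i} - {m}))"
        using pminor_schur[where A = A, OF m(3) Suc.prems(2) nz] pos by simp
      also have "\<dots> = A i i * pminor n A (I - {i})"
        using pminor_schur[where I = "I - {i}" and n = n and A = A, OF _ _ nz] m Suc.prems(2) Diff_subset[of I "{i}"]
        by (simp add: subset_trans)
      finally show ?thesis .
    qed
  qed
qed

subsection \<open>Neville elimination\<close>

text \<open>Cramer's rule, with the coefficients read off the adjugate.\<close>

lemma fdet_row_combination:
  assumes "fdet k X \<noteq> 0"
  obtains a where "\<And>j. j < k \<Longrightarrow> y j = (\<Sum>l<k. a l * X l j)"
proof -
  define XM where "XM = mat k k (\<lambda>(i, j). X i j)"
  define B where "B = adj_mat XM"
  have XM: "XM \<in> carrier_mat k k" by (simp add: XM_def)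
  have B: "B \<in> carrier_mat k k" "B * XM = det XM \<cdot>\<^sub>m 1\<^sub>m k"
    using adj_mat[OF XM] by (simp_all add: B_def)
  have nz: "det XM \<noteq> 0" using assms by (simp add: fdet_def XM_def)
  have BX: "(\<Sum>l<k. B $$ (i, l) * X l j) = (if i = j then det XM else 0)" if "i < k" "j < k" for i j
  proof -
    have "(B * XM) $$ (i, j) = (\<Sum>l<k. B $$ (i, l) * X l j)"
      using that B(1) XM by (auto simp: scalar_prod_def XM_def lessThan_atLeast0)
    then show ?thesis using that by (cases "i = j") (auto simp: B(2))
  qed
  show thesis
  proof (rule that[of "\<lambda>l. (\<Sum>i<k. y i * B $$ (i, l)) / det XM"])
    fix j assume j: "j < k"
    have "(\<Sum>l<k. (\<Sum>i<k. y i * B $$ (i, l)) / det XM * X l j) =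
        (\<Sum>l<k. \<Sum>i<k. y i * (B $$ (i, l) * X l j)) / det XM"
      by (simp add: sum_distrib_left sum_distrib_right sum_divide_distrib algebra_simps)
    also have "\<dots> = (\<Sum>i<k. y i * (\<Sum>l<k. B $$ (i, l) * X l j)) / det XM"
      by (subst sum.swap) (simp add: sum_distrib_left)
    also have "\<dots> = (\<Sum>i<k. if i = j then y i * det XM else 0) / det XM"
      using j by (intro arg_cong2[of _ _ _ _ "(/)"] sum.cong refl) (simp add: BX)
    also have "\<dots> = y j"
      using j nz by (simp add: sum.delta)
    finally show "y j = (\<Sum>l<k. (\<Sum>i<k. y i * B $$ (i, l)) / det XM * X l j)" by simp
  qed
qed

text \<open>The rows of \<open>X\<close> span, so \<open>y\<close> is a combination of them with
  coefficients \<open>a\<close>. By alternation, a minor containing \<open>y\<close> keeps only the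
  coefficients of rows missing from it, here \<open>a (Suc q)\<close> and \<open>a 0\<close>. The
  terms with \<open>a (Suc q)\<close> cancel in the difference, and the right-hand side is the
  remaining term with \<open>a 0\<close>.\<close>

lemma fdet_pluecker:
  assumes N: "fdet (Suc k) X \<noteq> 0" and q: "q < k"
  shows "fdet (Suc k) (\<lambda>i j. if i = Suc q then y j else X i j) * fdet k (\<lambda>i j. X (Suc i) (Suc j)) -
      fdet (Suc k) X * fdet k (\<lambda>i j. if i = q then y (Suc j) else X (Suc i) (Suc j)) =
    fdet (Suc k) (\<lambda>i j. if i < Suc q then X (Suc i) j else if i = Suc q then y j else X i j) *
      fdet k (\<lambda>i j. X (if i < Suc q then i else Suc i) (Suc j))"
    (is "?M * ?N' - ?N * ?M' = ?P * ?T")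
proof -
  obtain a where a: "\<And>j. j < Suc k \<Longrightarrow> y j = (\<Sum>l<Suc k. a l * X l j)"
    using fdet_row_combination[OF N] by metis
  have "?M = fdet (Suc k) (\<lambda>i j. if i = Suc q then \<Sum>l<Suc k. a l * X l j else X i j)"
    by (intro fdet_cong) (simp add: a)
  also have "\<dots> = (\<Sum>l<Suc k. a l * fdet (Suc k) (\<lambda>i j. if i = Suc q then X l j else X i j))"
    using q by (intro fdet_row_sum) simp
  also have "\<dots> = (\<Sum>l<Suc k. if l = Suc q then a (Suc q) * ?N else 0)"
  proof (intro sum.cong refl)
    fix l assume l: "l \<in> {..<Suc k}"
    show "a l * fdet (Suc k) (\<lambda>i j. if i = Suc q then X l j else X i j) =
        (if l = Suc q then a (Suc q) * ?N else 0)"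
    proof (cases "l = Suc q")
      case True
      then show ?thesis by (auto intro!: fdet_cong)
    next
      case False
      then have "fdet (Suc k) (\<lambda>i j. if i = Suc q then X l j else X i j) = 0"
        using q l by (intro fdet_eq_rows[of l _ "Suc q"]) auto
      with False show ?thesis by simp
    qed
  qed
  finally have M: "?M = a (Suc q) * ?N" using q by simp
  \<comment> \<open>The trailing minor with row \<open>Suc q\<close> of \<open>X\<close> replaced by
    row 0.\<close>
  define Z where "Z = fdet k (\<lambda>i j. if i = q then X 0 (Suc j) else X (Suc i) (Suc j))"
  have "?M' = fdet k (\<lambda>i j. if i = q then \<Sum>l<Suc k. a l * X l (Suc j) else X (Suc i) (Suc j))"
    by (intro fdet_cong) (simp add: a)
  also have "\<dots> = (\<Sum>l<Suc k. a l * fdet k (\<lambda>i j. if i = q then X l (Suc j) else X (Suc i) (Suc j)))"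
    using fdet_row_sum[OF q, where g = "\<lambda>l j. X l (Suc j)" and M = "\<lambda>i j. X (Suc i) (Suc j)"] .
  also have "\<dots> = (\<Sum>l<Suc k. (if l = Suc q then a (Suc q) * ?N' else 0) + (if l = 0 then a 0 * Z else 0))"
  proof (intro sum.cong refl)
    fix l assume l: "l \<in> {..<Suc k}"
    show "a l * fdet k (\<lambda>i j. if i = q then X l (Suc j) else X (Suc i) (Suc j)) =
        (if l = Suc q then a (Suc q) * ?N' else 0) + (if l = 0 then a 0 * Z else 0)"
    proof (cases "l = Suc q \<or> l = 0")
      case True
      then show ?thesis by (auto simp: Z_def intro!: fdet_cong)
    next
      case False
      then have "fdet k (\<lambda>i j. if i = q then X l (Suc j) else X (Suc i) (Suc j)) = 0"
        using q l by (intro fdet_eq_rows[of "l - 1" _ q]) auto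
      with False show ?thesis by simp
    qed
  qed
  also have "\<dots> = a (Suc q) * ?N' + a 0 * Z"
    using q by (subst sum.distrib) simp
  finally have M': "?M' = a (Suc q) * ?N' + a 0 * Z" .
  have "?T = fdet k (\<lambda>i j. (\<lambda>i j. if i = q then X 0 (Suc j) else X (Suc i) (Suc j))
      (if i = 0 then q else if i \<le> q then i - 1 else i) j)"
    by (intro fdet_cong) auto
  also have "\<dots> = (-1) ^ q * Z"
    unfolding Z_def using q by (rule fdet_front_row)
  finally have T: "?T = (-1) ^ q * Z" .
  \<comment> \<open>The rows of \<open>X\<close> with row 0 moved down to position
    \<open>Suc q\<close>, hence \<open>?N\<close> up to the sign of a cycle.\<close>
  define W where "W = fdet (Suc k) (\<lambda>i j. if i < Suc q then X (Suc i) j else if i = Suc q then X 0 j else X i j)"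
  have "?P = fdet (Suc k) (\<lambda>i j. if i = Suc q then \<Sum>l<Suc k. a l * X l j
      else if i < Suc q then X (Suc i) j else X i j)"
    by (intro fdet_cong) (simp add: a)
  also have "\<dots> = (\<Sum>l<Suc k. a l * fdet (Suc k) (\<lambda>i j. if i = Suc q then X l j
      else if i < Suc q then X (Suc i) j else X i j))"
    using q by (intro fdet_row_sum) simp
  also have "\<dots> = (\<Sum>l<Suc k. if l = 0 then a 0 * W else 0)"
  proof (intro sum.cong refl)
    fix l assume l: "l \<in> {..<Suc k}"
    let ?F = "fdet (Suc k) (\<lambda>i j. if i = Suc q then X l j else if i < Suc q then X (Suc i) j else X i j)"
    show "a l * ?F = (if l = 0 then a 0 * W else 0)"
    proof (cases "l = 0")
      case True
      have "?F = W" unfolding W_def True by (intro fdet_cong) auto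
      with True show ?thesis by simp
    next
      case False
      have "?F = 0"
        using q l False
        by (intro fdet_eq_rows[of "if l \<le> Suc q then l - 1 else l" _ "Suc q"]) auto
      with False show ?thesis by simp
    qed
  qed
  finally have P: "?P = a 0 * W" by simp
  have "?N = fdet (Suc k) (\<lambda>i j. (\<lambda>i j. if i < Suc q then X (Suc i) j else if i = Suc q then X 0 j else X i j)
      (if i = 0 then Suc q else if i \<le> Suc q then i - 1 else i) j)"
    by (intro fdet_cong) auto
  also have "\<dots> = (-1) ^ Suc q * W"
    unfolding W_def using q by (intro fdet_front_row) simp
  finally have NW: "?N = (-1) ^ Suc q * W" .
  show ?thesis
    unfolding M M' P T NW by (simp add: algebra_simps)
qed

text \<open>Fischer's inequality bounds the whole minor by its first entry times the trailing minor,
  which therefore cannot be zero.\<close>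

lemma TN_trailing_minor_pos:
  assumes "TN I J A" "mono_on {..<Suc k} r" "mono_on {..<Suc k} c" "r ` {..<Suc k} \<subseteq> I" "c ` {..<Suc k} \<subseteq> J"
    and pos: "0 < fdet (Suc k) (\<lambda>i j. A (r i) (c j))"
  shows "0 < fdet k (\<lambda>i j. A (r (Suc i)) (c (Suc j)))"
proof -
  let ?X = "\<lambda>i j. A (r i) (c j)"
  have TX: "TN {..<Suc k} {..<Suc k} ?X"
    by (rule TN_reindex[OF assms(1)]) (use assms in auto)
  have 1: "pminor (Suc k) ?X {..<Suc k} = fdet (Suc k) ?X"
    unfolding pminor_def by (intro fdet_cong) auto
  have 2: "pminor (Suc k) ?X ({..<Suc k} - {0}) = fdet k (\<lambda>i j. ?X (Suc i) (Suc j))"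
    unfolding pminor_def by (subst fdet_col_0_single) (auto intro!: fdet_cong)
  have "fdet (Suc k) ?X \<le> ?X 0 0 * fdet k (\<lambda>i j. ?X (Suc i) (Suc j))"
    using pminor_fischer[OF TX, of "Suc k" 0] 1 2 by simp
  then have "fdet k (\<lambda>i j. ?X (Suc i) (Suc j)) \<noteq> 0"
    using pos by (metis mult_zero_right not_less)
  moreover have "0 \<le> fdet k (\<lambda>i j. ?X (Suc i) (Suc j))"
    using pminor_nonneg[OF TN_mono[OF TX, of "{..<Suc k} - {0}" "{..<Suc k} - {0}"], of "Suc k"] 2 by auto
  ultimately show ?thesis
    by linarith
qed

text \<open>
  Induction on the position \<open>q\<close> of the row \<open>y\<close>: a Pluecker relation compares the minors with those
  obtained by deleting the first row and column, and Fischer's inequality shows that the minor one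
  has to divide by is positive. For \<open>q = 0\<close> one borders the minor with row \<open>x\<close> and column \<open>j0\<close>.
\<close>

lemma TN_neville_minor:
  assumes TN: "TN I J A" and xy: "x \<in> I" "y \<in> I" "x < y" "\<And>s. s \<in> I \<Longrightarrow> s \<le> x \<or> y \<le> s"
    and j0: "j0 \<in> J" "\<And>j. j \<in> J \<Longrightarrow> j0 \<le> j"
    and z: "\<And>s. s \<in> I \<Longrightarrow> y < s \<Longrightarrow> A s j0 = 0"
    and r: "strict_mono_on {..<k} r" "r ` {..<k} \<subseteq> I" "q < k" "r q = y" "x \<notin> r ` {..<k}"
    and c: "strict_mono_on {..<k} c" "c ` {..<k} \<subseteq> J"
  shows "A y j0 * fdet k (\<lambda>i j. A ((r(q := x)) i) (c j)) \<le> A x j0 * fdet k (\<lambda>i j. A (r i) (c j))"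
  using r c
proof (induction q arbitrary: k r c)
  case 0
  let ?R = "\<lambda>i. case i of 0 \<Rightarrow> x | Suc i \<Rightarrow> r i" and ?C = "\<lambda>j. case j of 0 \<Rightarrow> j0 | Suc j \<Rightarrow> c j"
  have rI: "r i \<in> I" if "i < k" for i using 0 that by auto
  have cJ: "c i \<in> J" if "i < k" for i using 0 that by auto
  have rx: "x < r i" if "i < k" for i
    using 0(3,4) xy(3) that strict_mono_onD[OF 0(1), of 0 i] by (cases "i = 0") auto
  have ry: "y < r i" if "i < k" "0 < i" for i
    using 0(3,4) that strict_mono_onD[OF 0(1), of 0 i] by auto
  obtain k' where k: "k = Suc k'" using 0(3) by (cases k) auto
  have mr: "mono_on {..<k} r" and mc: "mono_on {..<k} c"
    using 0 by (auto intro: strict_mono_on_imp_mono_on)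
  have "0 \<le> fdet (Suc k) (\<lambda>i j. A (?R i) (?C j))"
  proof (rule TN_D[OF TN])
    show "mono_on {..<Suc k} ?R"
      using mr rx by (auto simp: mono_on_def less_imp_le split: nat.splits)
    show "mono_on {..<Suc k} ?C"
      using mc cJ j0(2) by (auto simp: mono_on_def split: nat.splits)
    show "?R ` {..<Suc k} \<subseteq> I" "?C ` {..<Suc k} \<subseteq> J"
      using rI cJ xy j0 by (auto split: nat.splits)
  qed
  also have "\<dots> = (\<Sum>i<Suc k. (-1) ^ i * A (?R i) j0 * fdet k (\<lambda>a b. A (?R (insert_index i a)) (c b)))"
    by (subst fdet_col_0) simp
  \<comment> \<open>All rows after \<open>y\<close> vanish in column \<open>j0\<close>, so the
    Laplace expansion keeps only the terms of \<open>x\<close> and \<open>y\<close>.\<close>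
  also have "\<dots> = (\<Sum>i\<in>{0, 1}. (-1) ^ i * A (?R i) j0 * fdet k (\<lambda>a b. A (?R (insert_index i a)) (c b)))"
  proof (rule sum.mono_neutral_right)
    show "\<forall>i\<in>{..<Suc k} - {0, 1}. (-1) ^ i * A (?R i) j0 * fdet k (\<lambda>a b. A (?R (insert_index i a)) (c b)) = 0"
    proof
      fix i assume "i \<in> {..<Suc k} - {0, 1}"
      then obtain i' where "i = Suc i'" "0 < i'" "i' < k" by (cases i) auto
      then show "(-1) ^ i * A (?R i) j0 * fdet k (\<lambda>a b. A (?R (insert_index i a)) (c b)) = 0"
        using z[OF rI ry] by simp
    qed
  qed (use k in auto)
  also have "\<dots> = A x j0 * fdet k (\<lambda>a b. A (?R (insert_index 0 a)) (c b)) -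
      A y j0 * fdet k (\<lambda>a b. A (?R (insert_index 1 a)) (c b))"
    using 0(4) by simp
  also have "fdet k (\<lambda>a b. A (?R (insert_index 0 a)) (c b)) = fdet k (\<lambda>a b. A (r a) (c b))"
    by (simp add: insert_index_def)
  also have "fdet k (\<lambda>a b. A (?R (insert_index 1 a)) (c b)) = fdet k (\<lambda>a b. A ((r(0 := x)) a) (c b))"
    by (intro fdet_cong) (auto simp: insert_index_def split: nat.splits)
  finally show ?case by simp
next
  case (Suc q)
  obtain k' where k: "k = Suc k'" using Suc.prems(3) by (cases k) auto
  let ?rx = "r(Suc q := x)"
  have rI: "r i \<in> I" if "i < k" for i using Suc.prems that by auto
  have rlt: "r i < r j" if "i < j" "j < k" for i j
    using Suc.prems(1) that by (auto simp: strict_mono_on_def)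
  have mr: "mono_on {..<k} r" and mc: "mono_on {..<k} c"
    using Suc.prems by (auto intro: strict_mono_on_imp_mono_on)
  have below: "r i < x" if "i < Suc q" for i
  proof -
    have "r i < y" using rlt[OF that] Suc.prems by auto
    then have "r i \<le> x" using xy(4)[of "r i"] rI[of i] that Suc.prems(3) by auto
    moreover have "r i \<noteq> x" using Suc.prems(3,5) that by auto
    ultimately show ?thesis by simp
  qed
  have above: "y < r i" if "Suc q < i" "i < k" for i
    using rlt[OF that] Suc.prems by auto
  have mrx: "mono_on {..<k} ?rx"
  proof (rule mono_onI)
    fix a b assume ab: "a \<in> {..<k}" "b \<in> {..<k}" "a \<le> b"
    have "r a \<le> r b" using mr ab by (rule mono_onD)
    moreover have "x \<le> r b" if "a = Suc q" "b \<noteq> Suc q"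
      using above[of b] that ab xy(3) by simp
    moreover have "r a \<le> x" if "a \<noteq> Suc q" "b = Suc q"
      using below[of a] that ab by simp
    ultimately show "?rx a \<le> ?rx b" by simp
  qed
  have rxI: "?rx ` {..<k} \<subseteq> I" using rI xy by auto
  let ?N = "fdet k (\<lambda>i j. A (?rx i) (c j))"
  let ?M = "fdet k (\<lambda>i j. A (r i) (c j))"
  let ?N' = "fdet k' (\<lambda>i j. A (?rx (Suc i)) (c (Suc j)))"
  let ?M' = "fdet k' (\<lambda>i j. A (r (Suc i)) (c (Suc j)))"
  have N0: "0 \<le> ?N" and M0: "0 \<le> ?M"
    using TN_D[OF TN mrx mc rxI] TN_D[OF TN mr mc] Suc.prems by auto
  show ?case
  proof (cases "?N = 0")
    case True
    then show ?thesis
      using M0 TN_nonneg[OF TN xy(1) j0(1)] by simp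
  next
    case False
    then have Npos: "0 < ?N" using N0 by simp
    have N'pos: "0 < ?N'"
      using TN_trailing_minor_pos[OF TN, of k' ?rx c] mrx mc rxI Suc.prems Npos
      unfolding k by blast
    \<comment> \<open>Dropping the first row and column lowers the position of \<open>y\<close> from
      \<open>Suc q\<close> to \<open>q\<close>.\<close>
    have IH: "A y j0 * fdet k' (\<lambda>i j. A (((\<lambda>i. r (Suc i))(q := x)) i) (c (Suc j))) \<le> A x j0 * ?M'"
      using Suc.prems unfolding k
      by (intro Suc.IH) (auto simp: strict_mono_on_def)
    have "((\<lambda>i. r (Suc i))(q := x)) = (\<lambda>i. ?rx (Suc i))" by auto
    then have IH: "A y j0 * ?N' \<le> A x j0 * ?M'" using IH by (simp del: fun_upd_apply)
    let ?P = "fdet (Suc k') (\<lambda>i j. if i < Suc q then A (?rx (Suc i)) (c j)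
        else if i = Suc q then A y (c j) else A (?rx i) (c j))"
    let ?T = "fdet k' (\<lambda>i j. A (?rx (if i < Suc q then i else Suc i)) (c (Suc j)))"
    have "fdet (Suc k') (\<lambda>i j. if i = Suc q then A y (c j) else A (?rx i) (c j)) * ?N' -
        fdet (Suc k') (\<lambda>i j. A (?rx i) (c j)) *
        fdet k' (\<lambda>i j. if i = q then A y (c (Suc j)) else A (?rx (Suc i)) (c (Suc j))) = ?P * ?T"
      using False Suc.prems(3) unfolding k
      by (intro fdet_pluecker[where X = "\<lambda>i j. A (?rx i) (c j)" and y = "\<lambda>j. A y (c j)"]) auto
    moreover have "fdet (Suc k') (\<lambda>i j. if i = Suc q then A y (c j) else A (?rx i) (c j)) = ?M"
      unfolding k using Suc.prems(4) by (intro fdet_cong) auto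
    moreover have "fdet k' (\<lambda>i j. if i = q then A y (c (Suc j)) else A (?rx (Suc i)) (c (Suc j))) = ?M'"
      using Suc.prems(4) by (intro fdet_cong) auto
    ultimately have pl: "?M * ?N' - ?N * ?M' = ?P * ?T" unfolding k by simp
    \<comment> \<open>\<open>?P\<close> drops the row \<open>r 0\<close> and contains
      \<open>x\<close> followed by \<open>y\<close>; \<open>?T\<close> drops \<open>x\<close> and
      the first column. Both are minors along weakly increasing words, so the Pluecker difference is
      nonnegative.\<close>
    have "?P = fdet (Suc k') (\<lambda>i j. A (if i < Suc q then ?rx (Suc i) else r i) (c j))"
      using Suc.prems(4) by (intro fdet_cong) auto
    also have "0 \<le> \<dots>"
    proof (rule TN_D[OF TN])
      show "mono_on {..<Suc k'} (\<lambda>i. if i < Suc q then ?rx (Suc i) else r i)"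
        unfolding mono_on_def
      proof (intro allI impI)
        fix a b assume ab: "a \<in> {..<Suc k'} \<and> b \<in> {..<Suc k'} \<and> a \<le> b"
        have "?rx (Suc a) \<le> ?rx (Suc b)" if "b < Suc q"
          using mono_onD[OF mrx, of "Suc a" "Suc b"] ab that Suc.prems(3) by (simp del: fun_upd_apply)
        moreover have "?rx (Suc a) \<le> r b" if "a < Suc q" "\<not> b < Suc q"
        proof -
          have "?rx (Suc a) \<le> y"
            using below[of "Suc a"] xy(3) that by (cases "a = q") auto
          also have "y \<le> r b"
            using above[of b] that ab Suc.prems(4) k by (cases "b = Suc q") auto
          finally show ?thesis .
        qed
        moreover have "r a \<le> r b"
          using mr ab k by (auto simp: mono_on_def)
        ultimately show "(if a < Suc q then ?rx (Suc a) else r a) \<le> (if b < Suc q then ?rx (Suc b) else r b)"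
          using ab by auto
      qed
      show "(\<lambda>i. if i < Suc q then ?rx (Suc i) else r i) ` {..<Suc k'} \<subseteq> I"
        using rI xy(1) Suc.prems(3) k by auto
    qed (use mc Suc.prems k in auto)
    finally have P0: "0 \<le> ?P" .
    have T0: "0 \<le> ?T"
    proof (rule TN_D[OF TN])
      show "mono_on {..<k'} (\<lambda>i. ?rx (if i < Suc q then i else Suc i))"
        using mrx k by (auto simp: mono_on_def simp del: fun_upd_apply)
      show "(\<lambda>i. ?rx (if i < Suc q then i else Suc i)) ` {..<k'} \<subseteq> I"
        using rxI k by (auto simp del: fun_upd_apply simp: image_subset_iff)
    qed (use mc Suc.prems k in \<open>auto simp: mono_on_def image_subset_iff\<close>)
    have "?N * ?M' \<le> ?M * ?N'" using pl mult_nonneg_nonneg[OF P0 T0] by linarith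
    then have "A x j0 * (?N * ?M') \<le> A x j0 * (?M * ?N')"
      using TN_nonneg[OF TN xy(1) j0(1)] by (rule mult_left_mono)
    moreover have "?N * (A y j0 * ?N') \<le> ?N * (A x j0 * ?M')"
      using IH N0 by (rule mult_left_mono)
    ultimately have "(A y j0 * ?N) * ?N' \<le> (A x j0 * ?M) * ?N'"
      by (simp add: algebra_simps del: fun_upd_apply)
    then show ?thesis using N'pos by (simp del: fun_upd_apply)
  qed
qed

text \<open>By linearity in row \<open>y\<close>, a minor of the new matrix that contains this row
  is a difference of minors of \<open>A\<close>, and \<open>TN_neville_minor\<close> compares
  exactly these. If row \<open>x\<close> is present as well, the subtracted minor has two equal
  rows.\<close>

lemma TN_neville:
  assumes TN: "TN I J A" and xy: "x \<in> I" "y \<in> I" "x < y" "\<And>s. s \<in> I \<Longrightarrow> s \<le> x \<or> y \<le> s"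
    and j0: "j0 \<in> J" "\<And>j. j \<in> J \<Longrightarrow> j0 \<le> j"
    and z: "\<And>s. s \<in> I \<Longrightarrow> y < s \<Longrightarrow> A s j0 = 0"
    and pos: "0 < A x j0"
  shows "TN I J (\<lambda>i j. if i = y then A y j - A y j0 / A x j0 * A x j else A i j)" (is "TN I J ?A")
proof (rule TN_I)
  fix k and r c :: "nat \<Rightarrow> nat"
  assume r: "strict_mono_on {..<k} r" "r ` {..<k} \<subseteq> I" and c: "strict_mono_on {..<k} c" "c ` {..<k} \<subseteq> J"
  have mr: "mono_on {..<k} r" "mono_on {..<k} c" 
    by (rule strict_mono_on_imp_mono_on[OF r(1)], rule strict_mono_on_imp_mono_on[OF c(1)])
  have nn: "0 \<le> fdet k (\<lambda>i j. A (r i) (c j))" by (rule TN_D[OF TN mr r(2) c(2)])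
  show "0 \<le> fdet k (\<lambda>i j. ?A (r i) (c j))"
  proof (cases "y \<in> r ` {..<k}")
    case False
    then have "fdet k (\<lambda>i j. ?A (r i) (c j)) = fdet k (\<lambda>i j. A (r i) (c j))"
      by (intro fdet_cong) auto
    with nn show ?thesis by simp
  next
    case True
    then obtain q where q: "q < k" "r q = y" by auto
    have inj: "r i = y \<longleftrightarrow> i = q" if "i < k" for i
      using r(1) q that by (metis lessThan_iff strict_mono_on_eqD)
    let ?t = "A y j0 / A x j0"
    have "fdet k (\<lambda>i j. ?A (r i) (c j)) = fdet k (\<lambda>i j. if i = q then A y (c j) + (- ?t) * A x (c j) else A (r i) (c j))"
      by (intro fdet_cong) (simp add: inj)
    also have "\<dots> = fdet k (\<lambda>i j. if i = q then A y (c j) else A (r i) (c j)) +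
        (- ?t) * fdet k (\<lambda>i j. if i = q then A x (c j) else A (r i) (c j))"
      by (rule fdet_row_add[OF q(1)])
    also have "fdet k (\<lambda>i j. if i = q then A y (c j) else A (r i) (c j)) = fdet k (\<lambda>i j. A (r i) (c j))"
      using q by (intro fdet_cong) auto
    also have "fdet k (\<lambda>i j. if i = q then A x (c j) else A (r i) (c j)) = fdet k (\<lambda>i j. A ((r(q := x)) i) (c j))"
      by (intro fdet_cong) auto
    finally have eq: "fdet k (\<lambda>i j. ?A (r i) (c j)) =
      fdet k (\<lambda>i j. A (r i) (c j)) - ?t * fdet k (\<lambda>i j. A ((r(q := x)) i) (c j))" by simp
    show ?thesis
    proof (cases "x \<in> r ` {..<k}")
      case True
      then obtain p where p: "p < k" "r p = x" by auto
      then have "p \<noteq> q" using q xy(3) by auto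
      then have "fdet k (\<lambda>i j. A ((r(q := x)) i) (c j)) = 0"
        using p q by (intro fdet_eq_rows[of p _ q]) auto
      with nn show ?thesis unfolding eq by (simp only: mult_zero_right diff_zero)
    next
      case False
      have "A y j0 * fdet k (\<lambda>i j. A ((r(q := x)) i) (c j)) \<le> A x j0 * fdet k (\<lambda>i j. A (r i) (c j))"
        by (rule TN_neville_minor[OF TN xy j0 z r q False c])
      then have "?t * fdet k (\<lambda>i j. A ((r(q := x)) i) (c j)) \<le> fdet k (\<lambda>i j. A (r i) (c j))"
        using pos by (simp add: field_simps del: fun_upd_apply)
      then show ?thesis using eq by linarith
    qed
  qed
qed

subsection \<open>Sums of principal minors of stochastic matrices\<close>

definition esum :: "nat \<Rightarrow> (nat \<Rightarrow> nat \<Rightarrow> real) \<Rightarrow> nat \<Rightarrow> real" where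
  "esum n X m = (\<Sum>I | I \<subseteq> {..<n} \<and> card I = m. pminor n X I)"

definition alt_esum :: "nat \<Rightarrow> (nat \<Rightarrow> nat \<Rightarrow> real) \<Rightarrow> nat \<Rightarrow> real" where
  "alt_esum n X m = (\<Sum>i\<le>m. (-1) ^ (m - i) * esum n X i)"

text \<open>A permutation that fixes every point outside \<open>I\<close> maps \<open>I\<close> to
  itself, so padding the columns alone gives the same determinant. This form is linear in each
  column of \<open>X\<close> with index in \<open>I\<close>.\<close>

lemma pminor_cols:
  assumes "I \<subseteq> {..<n}"
  shows "pminor n X I = fdet n (\<lambda>i j. if j \<in> I then X i j else if i = j then 1 else 0)"
  unfolding pminor_def fdet_cols
proof (intro sum.cong refl arg_cong2[of _ _ _ _ "(*)"])
  fix p assume "p \<in> {p. p permutes {..<n}}"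
  then have p: "p permutes {..<n}" by simp
  show "(\<Prod>j<n. if p j \<in> I \<and> j \<in> I then X (p j) j else if p j = j then 1 else 0) =
      (\<Prod>j<n. if j \<in> I then X (p j) j else if p j = j then 1 else 0)"
  proof (cases "\<forall>j<n. j \<notin> I \<longrightarrow> p j = j")
    case True
    have "p j \<in> I" if "j \<in> I" for j
    proof (rule ccontr)
      assume *: "p j \<notin> I"
      have "p j < n" using assms that permutes_in_image[OF p, of j] by auto
      with True * have "p (p j) = p j" by blast
      then have "p j = j" using permutes_inj[OF p] by (meson injD)
      with that * show False by simp
    qed
    then show ?thesis by (intro prod.cong) auto
  next
    case False
    then obtain j where "j < n" "j \<notin> I" "p j \<noteq> j" by blast
    then show ?thesis
      by (subst (1 2) prod_zero) (auto intro!: bexI[of _ j])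
  qed
qed

text \<open>Splitting each column into its identity part and its \<open>X\<close> part sorts the
  determinant by the set \<open>I\<close> of columns taken from \<open>X\<close>.\<close>

lemma fdet_char_poly:
  "fdet n (\<lambda>i j. (if i = j then 1 else 0) + t * X i j) = (\<Sum>m\<le>n. esum n X m * t ^ m)"
proof -
  let ?d = "\<lambda>i j :: nat. if i = j then 1 else 0 :: real"
  have "fdet n (\<lambda>i j. t * X i j + ?d i j) =
      (\<Sum>p | p permutes {..<n}. \<Sum>I\<in>Pow {..<n}. of_int (sign p) *
        ((\<Prod>j\<in>I. t * X (p j) j) * (\<Prod>j\<in>{..<n} - I. ?d (p j) j)))"
    unfolding fdet_cols by (simp add: prod_add sum_distrib_left)
  also have "\<dots> = (\<Sum>I\<in>Pow {..<n}. \<Sum>p | p permutes {..<n}. of_int (sign p) *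
        ((\<Prod>j\<in>I. t * X (p j) j) * (\<Prod>j\<in>{..<n} - I. ?d (p j) j)))"
    by (rule sum.swap)
  also have "\<dots> = (\<Sum>I\<in>Pow {..<n}. pminor n X I * t ^ card I)"
  proof (intro sum.cong refl)
    fix I assume "I \<in> Pow {..<n}"
    then have I: "I \<subseteq> {..<n}" "finite I" by (auto intro: finite_subset)
    have split: "(\<Prod>j<n. if j \<in> I then f j else g j) = (\<Prod>j\<in>I. f j) * (\<Prod>j\<in>{..<n} - I. g j)"
      for f g :: "nat \<Rightarrow> real"
      using I by (subst prod.If_cases) (auto simp: Int_absorb1 Diff_eq)
    show "(\<Sum>p | p permutes {..<n}. of_int (sign p) *
        ((\<Prod>j\<in>I. t * X (p j) j) * (\<Prod>j\<in>{..<n} - I. ?d (p j) j))) = pminor n X I * t ^ card I"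
      unfolding pminor_cols[OF I(1)] fdet_cols split sum_distrib_right
      by (intro sum.cong refl) (simp add: prod.distrib algebra_simps)
  qed
  also have "\<dots> = (\<Sum>m\<le>n. \<Sum>I\<in>{I \<in> Pow {..<n}. card I = m}. pminor n X I * t ^ card I)"
    by (rule sum.group[symmetric]) (auto simp: card_mono[of "{..<n}", simplified])
  also have "\<dots> = (\<Sum>m\<le>n. esum n X m * t ^ m)"
    unfolding esum_def sum_distrib_right by (intro sum.cong) auto
  finally show ?thesis by (simp add: add.commute)
qed

lemma esum_0 [simp]: "esum n X 0 = 1"
proof -
  have "{I. I \<subseteq> {..<n} \<and> card I = 0} = {{}}"
    by (auto dest: finite_subset)
  then show ?thesis by (simp add: esum_def)
qed

lemma esum_eq_0: "n < m \<Longrightarrow> esum n X m = 0"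
proof -
  assume "n < m"
  moreover have "card I \<le> n" if "I \<subseteq> {..<n}" for I
    using card_mono[OF _ that] by simp
  ultimately have "{I. I \<subseteq> {..<n} \<and> card I = m} = {}"
    by (auto simp: not_le[symmetric])
  then show ?thesis by (simp only: esum_def sum.empty)
qed

lemma alt_esum_0 [simp]: "alt_esum n X 0 = 1"
  by (simp add: alt_esum_def)

lemma alt_esum_Suc: "alt_esum n X (Suc m) = esum n X (Suc m) - alt_esum n X m"
proof -
  have "(\<Sum>i\<le>m. (-1) ^ (Suc m - i) * esum n X i) = - (\<Sum>i\<le>m. (-1) ^ (m - i) * esum n X i)"
    unfolding sum_negf[symmetric] by (intro sum.cong refl) (simp add: Suc_diff_le)
  then show ?thesis by (simp add: alt_esum_def)
qed

text \<open>Double counting of pairs \<open>(I, i)\<close> with \<open>i\<close> in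
  \<open>I\<close>: Fischer's inequality and \<open>A i i\<close> \<le> 1 bound the minor on
  \<open>I\<close> by the one on \<open>I - {i}\<close>, and each \<open>m\<close>-set arises from
  \<open>n - m\<close> pairs.\<close>

lemma esum_Suc_le:
  assumes TN: "TN {..<n} {..<n} A" and d: "\<And>i. i < n \<Longrightarrow> A i i \<le> 1"
  shows "real (Suc m) * esum n A (Suc m) \<le> real (n - m) * esum n A m"
proof -
  let ?S = "\<lambda>m. {I. I \<subseteq> {..<n} \<and> card I = m}"
  have fin: "finite (?S m)" for m by (rule finite_subset[of _ "Pow {..<n}"]) auto
  have finI: "finite I" if "I \<in> ?S m" for I m using that by (auto intro: finite_subset)
  have "real (Suc m) * esum n A (Suc m) = (\<Sum>I\<in>?S (Suc m). \<Sum>i\<in>I. pminor n A I)"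
    unfolding esum_def sum_distrib_left by (intro sum.cong) auto
  also have "\<dots> \<le> (\<Sum>I\<in>?S (Suc m). \<Sum>i\<in>I. pminor n A (I - {i}))"
  proof (intro sum_mono)
    fix I i assume I: "I \<in> ?S (Suc m)" "i \<in> I"
    have T: "TN I I A" using I by (intro TN_mono[OF TN]) auto
    have "pminor n A I \<le> A i i * pminor n A (I - {i})"
      using I by (intro pminor_fischer T) auto
    also have "\<dots> \<le> 1 * pminor n A (I - {i})"
      using I d[of i] by (intro mult_right_mono pminor_nonneg TN_mono[OF T]) auto
    finally show "pminor n A I \<le> pminor n A (I - {i})" by simp
  qed
  also have "\<dots> = (\<Sum>(I, i)\<in>Sigma (?S (Suc m)) (\<lambda>I. I). pminor n A (I - {i}))"
    by (rule sum.Sigma[OF fin]) (use finI in blast)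
  also have "\<dots> = (\<Sum>(K, i)\<in>Sigma (?S m) (\<lambda>K. {..<n} - K). pminor n A K)"
  proof (rule sum.reindex_bij_witness[where i = "\<lambda>(K, i). (insert i K, i)" and j = "\<lambda>(I, i). (I - {i}, i)"])
    fix b assume "b \<in> Sigma (?S m) (\<lambda>K. {..<n} - K)"
    then obtain K i where "b = (K, i)" "K \<in> ?S m" "i < n" "i \<notin> K" by auto
    then show "(case b of (K, i) \<Rightarrow> (insert i K, i)) \<in> Sigma (?S (Suc m)) (\<lambda>I. I)"
      using finI[of K m] by simp
  next
    fix a assume "a \<in> Sigma (?S (Suc m)) (\<lambda>I. I)"
    then obtain I i where "a = (I, i)" "I \<in> ?S (Suc m)" "i \<in> I" by auto
    then show "(case a of (I, i) \<Rightarrow> (I - {i}, i)) \<in> Sigma (?S m) (\<lambda>K. {..<n} - K)"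
      using finI[of I "Suc m"] by auto
  qed (auto simp: insert_absorb)
  also have "\<dots> = (\<Sum>K\<in>?S m. \<Sum>i\<in>{..<n} - K. pminor n A K)"
    by (rule sum.Sigma[symmetric, OF fin]) simp
  also have "\<dots> = real (n - m) * esum n A m"
    unfolding esum_def sum_distrib_left using finI by (intro sum.cong) (auto simp: card_Diff_subset)
  finally show ?thesis .
qed

lemma Suc_times_choose_Suc: "Suc m * (n choose Suc m) = (n - m) * (n choose m)"
  by (simp only: binomial_absorption binomial_absorb_comp)

lemma normalized_esum_antimono:
  assumes TN: "TN {..<n} {..<n} A" and d: "\<And>i. i < n \<Longrightarrow> A i i \<le> 1" and m: "m < n"
  shows "esum n A (Suc m) / real (n choose Suc m) \<le> esum n A m / real (n choose m)"
proof -
  have c: "real (Suc m) * real (n choose Suc m) = real (n - m) * real (n choose m)"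
    using Suc_times_choose_Suc[of m n] by (metis of_nat_mult)
  have pos: "0 < real (n choose m)" "0 < real (n choose Suc m)" "0 < real (n - m)"
    using m by (simp_all add: Suc_leI)
  have "real (Suc m) * (esum n A (Suc m) * real (n choose m)) \<le> real (n - m) * esum n A m * real (n choose m)"
    using mult_right_mono[OF esum_Suc_le[OF TN d], of "real (n choose m)" m] pos by (simp add: algebra_simps)
  also have "\<dots> = esum n A m * (real (n - m) * real (n choose m))"
    by simp
  also have "\<dots> = real (Suc m) * (esum n A m * real (n choose Suc m))"
    unfolding c[symmetric] by simp
  finally have "esum n A (Suc m) * real (n choose m) \<le> esum n A m * real (n choose Suc m)"
    by (simp add: mult_le_cancel_left del: of_nat_Suc)
  then show ?thesis using pos by (simp add: field_simps)
qed

section \<open>Stochastic matrices and their action on differences of coordinates\<close>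

definition TN_stochastic :: "nat \<Rightarrow> (nat \<Rightarrow> nat \<Rightarrow> real) \<Rightarrow> bool" where
  "TN_stochastic n B \<longleftrightarrow> TN {..<n} {..<n} B \<and> (\<forall>i<n. (\<Sum>j<n. B i j) = 1)"

text \<open>A minor using column \<open>q\<close> splits into the old minor and \<open>t\<close>
  times the minor with \<open>q\<close> replaced by \<open>Suc q\<close>, whose word is still weakly
  increasing.\<close>

lemma TN_add_next_col:
  assumes TN: "TN I {..<n} A" and "Suc q < n" "0 \<le> t"
  shows "TN I {..<n} (\<lambda>i j. if j = q then A i q + t * A i (Suc q) else A i j)" (is "TN _ _ ?A")
proof (rule TN_I)
  fix k and r c :: "nat \<Rightarrow> nat"
  assume r: "strict_mono_on {..<k} r" "r ` {..<k} \<subseteq> I" and c: "strict_mono_on {..<k} c" "c ` {..<k} \<subseteq> {..<n}"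
  note mr = strict_mono_on_imp_mono_on[OF r(1)] and mc = strict_mono_on_imp_mono_on[OF c(1)]
  have nn: "0 \<le> fdet k (\<lambda>i j. A (r i) (c j))" by (rule TN_D[OF TN mr mc r(2) c(2)])
  show "0 \<le> fdet k (\<lambda>i j. ?A (r i) (c j))"
  proof (cases "q \<in> c ` {..<k}")
    case False
    then have "fdet k (\<lambda>i j. ?A (r i) (c j)) = fdet k (\<lambda>i j. A (r i) (c j))"
      by (intro fdet_cong) auto
    with nn show ?thesis by simp
  next
    case True
    then obtain p where p: "p < k" "c p = q" by auto
    have inj: "c i = q \<longleftrightarrow> i = p" if "i < k" for i
      using c(1) p that by (metis lessThan_iff strict_mono_on_eqD)
    let ?c = "c(p := Suc q)"
    have "fdet k (\<lambda>i j. ?A (r i) (c j)) = fdet k (\<lambda>i j. if j = p then A (r i) q + t * A (r i) (Suc q) else A (r i) (c j))"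
      by (intro fdet_cong) (simp add: inj)
    also have "\<dots> = fdet k (\<lambda>i j. if j = p then A (r i) q else A (r i) (c j)) +
        t * fdet k (\<lambda>i j. if j = p then A (r i) (Suc q) else A (r i) (c j))"
      by (rule fdet_col_add[OF p(1)])
    also have "fdet k (\<lambda>i j. if j = p then A (r i) q else A (r i) (c j)) = fdet k (\<lambda>i j. A (r i) (c j))"
      using p by (intro fdet_cong) auto
    also have "fdet k (\<lambda>i j. if j = p then A (r i) (Suc q) else A (r i) (c j)) = fdet k (\<lambda>i j. A (r i) (?c j))"
      by (intro fdet_cong) auto
    finally have eq: "fdet k (\<lambda>i j. ?A (r i) (c j)) =
      fdet k (\<lambda>i j. A (r i) (c j)) + t * fdet k (\<lambda>i j. A (r i) (?c j))" .
    have "mono_on {..<k} ?c"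
    proof (rule mono_onI)
      fix a b assume ab: "a \<in> {..<k}" "b \<in> {..<k}" "a \<le> b"
      have "c a \<le> c b" using mc ab by (rule mono_onD)
      moreover have "Suc q \<le> c b" if "a = p" "b \<noteq> p"
        using strict_mono_onD[OF c(1), of p b] that ab p by auto
      moreover have "c a \<le> Suc q" if "b = p"
        using \<open>c a \<le> c b\<close> that p by auto
      ultimately show "?c a \<le> ?c b" by simp
    qed
    moreover have "?c ` {..<k} \<subseteq> {..<n}"
      using c(2) assms(2) by auto
    ultimately have "0 \<le> fdet k (\<lambda>i j. A (r i) (?c j))"
      using TN_D[OF TN mr _ r(2)] by blast
    then have "0 \<le> t * fdet k (\<lambda>i j. A (r i) (?c j))"
      using assms(3) by (rule mult_nonneg_nonneg[rotated])
    with nn show ?thesis unfolding eq by linarith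
  qed
qed

text \<open>The columns are finished from right to left: adding the completed column
  \<open>j + 1\<close> to column \<open>j\<close> turns it into a tail sum. In the proof
  \<open>d\<close> counts the completed columns.\<close>

lemma TN_tail_sums:
  assumes TN: "TN I {..<n} A"
  shows "TN I {..<n} (\<lambda>i j. \<Sum>l = j..<n. A i l)"
proof -
  have "TN I {..<n} (\<lambda>i j. if n - d \<le> j then \<Sum>l = j..<n. A i l else A i j)" if "d \<le> n" for d
    using that
  proof (induction d)
    case 0
    have "TN I {..<n} (\<lambda>i j. if n - 0 \<le> j then \<Sum>l = j..<n. A i l else A i j) \<longleftrightarrow> TN I {..<n} A"
      by (rule TN_cong) auto
    then show ?case using TN by blast
  next
    case (Suc d)
    let ?F = "\<lambda>d i j. if n - d \<le> j then \<Sum>l = j..<n. A i l else A i j"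
    let ?q = "n - Suc d"
    have IH: "TN I {..<n} (?F d)" using Suc by simp
    have tail: "(\<Sum>l = j..<n. A i l) = A i j + (\<Sum>l = Suc j..<n. A i l)" if "j < n" for i j
      using that by (rule sum.atLeast_Suc_lessThan)
    have le: "n - Suc d \<le> j \<longleftrightarrow> j = ?q \<or> n - d \<le> j" "\<not> n - d \<le> ?q" "Suc ?q = n - d" for j
      using Suc.prems by auto
    show ?case
    proof (cases "d = 0")
      case True
      have "TN I {..<n} (?F (Suc d)) \<longleftrightarrow> TN I {..<n} (?F d)"
        using True by (intro TN_cong) (auto simp: tail)
      then show ?thesis using IH by blast
    next
      case False
      have "TN I {..<n} (\<lambda>i j. if j = ?q then ?F d i ?q + 1 * ?F d i (Suc ?q) else ?F d i j)"
        using False Suc.prems by (intro TN_add_next_col[OF IH]) auto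
      moreover have "TN I {..<n} (\<lambda>i j. if j = ?q then ?F d i ?q + 1 * ?F d i (Suc ?q) else ?F d i j) \<longleftrightarrow>
          TN I {..<n} (?F (Suc d))"
        using Suc.prems by (intro TN_cong) (auto simp: le tail)
      ultimately show ?thesis by blast
    qed
  qed
  from this[of n] show ?thesis by simp
qed

text \<open>Neville steps with pivots in column 0 have multiplier 1, since that column is constant.
  They run from the bottom row upwards, so that the rows below the current one are already zero
  there.\<close>

lemma TN_row_differences:
  assumes TN: "TN {..<n} {..<m} F" and "0 < m" and one: "\<And>i. i < n \<Longrightarrow> F i 0 = 1"
  shows "TN {..<n} {..<m} (\<lambda>i j. if i = 0 then F 0 j else F i j - F (i - 1) j)"
proof -
  let ?G = "\<lambda>d i j. if i \<noteq> 0 \<and> n - d \<le> i then F i j - F (i - 1) j else F i j"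
  have "TN {..<n} {..<m} (?G d)" if "d \<le> n" for d
    using that
  proof (induction d)
    case 0
    have "TN {..<n} {..<m} (?G 0) \<longleftrightarrow> TN {..<n} {..<m} F"
      by (rule TN_cong) auto
    then show ?case using TN by blast
  next
    case (Suc d)
    let ?y = "n - Suc d"
    have IH: "TN {..<n} {..<m} (?G d)" using Suc by simp
    have le: "n - Suc d \<le> j \<longleftrightarrow> j = ?y \<or> n - d \<le> j" "\<not> n - d \<le> ?y" for j
      using Suc.prems by auto
    show ?case
    proof (cases "?y = 0")
      case True
      then have "?G (Suc d) = ?G d" by (intro ext) (use Suc.prems in auto)
      then show ?thesis using IH by simp
    next
      case False
      have "TN {..<n} {..<m} (\<lambda>i j. if i = ?y then ?G d ?y j - ?G d ?y 0 / ?G d (?y - 1) 0 * ?G d (?y - 1) j else ?G d i j)"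
      proof (rule TN_neville[OF IH])
        show "?G d s 0 = 0" if "s \<in> {..<n}" "?y < s" for s
          using that Suc.prems one by auto
      qed (use False Suc.prems assms(2) one in auto)
      moreover have "TN {..<n} {..<m} (\<lambda>i j. if i = ?y then ?G d ?y j - ?G d ?y 0 / ?G d (?y - 1) 0 * ?G d (?y - 1) j else ?G d i j)
          \<longleftrightarrow> TN {..<n} {..<m} (?G (Suc d))"
        using False Suc.prems one by (intro TN_cong) (auto simp: le)
      ultimately show ?thesis by blast
    qed
  qed
  from this[of n] have "TN {..<n} {..<m} (\<lambda>i j. if i \<noteq> 0 then F i j - F (i - 1) j else F i j)" by simp
  moreover have "(\<lambda>i j. if i \<noteq> 0 then F i j - F (i - 1) j else F i j) = (\<lambda>i j. if i = 0 then F 0 j else F i j - F (i - 1) j)"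
    by (intro ext) auto
  ultimately show ?thesis by simp
qed

lemma fdet_mult: "fdet n (\<lambda>i j. \<Sum>l<n. X i l * Y l j) = fdet n X * fdet n Y"
proof -
  have "mat n n (\<lambda>(i, j). X i j) * mat n n (\<lambda>(i, j). Y i j) = mat n n (\<lambda>(i, j). \<Sum>l<n. X i l * Y l j)"
    by (rule eq_matI) (auto simp: scalar_prod_def lessThan_atLeast0)
  then show ?thesis
    unfolding fdet_def using det_mult[of "mat n n (\<lambda>(i, j). X i j)" n "mat n n (\<lambda>(i, j). Y i j)"] by simp
qed

lemma fdet_lower_ones: "fdet n (\<lambda>i j. if j \<le> i then 1 else 0) = 1"
proof -
  have "fdet n (\<lambda>i j. if j \<le> i then 1 else 0) =
      prod_list (diag_mat (mat n n (\<lambda>(i, j). if j \<le> i then 1 else (0::real))))"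
    unfolding fdet_def by (rule det_lower_triangular[of n]) auto
  also have "diag_mat (mat n n (\<lambda>(i, j). if j \<le> i then 1 else (0::real))) = replicate n 1"
    by (auto simp: diag_mat_def intro: nth_equalityI)
  finally show ?thesis by simp
qed

text \<open>
  If the row sums of \<open>B\<close> are equal, this is the action of \<open>B\<close> on the differences
  \<open>x (Suc i) - x i\<close> of the coordinates of a vector \<open>x\<close>.
\<close>

definition deflation :: "nat \<Rightarrow> (nat \<Rightarrow> nat \<Rightarrow> real) \<Rightarrow> nat \<Rightarrow> nat \<Rightarrow> real" where
  "deflation n B = (\<lambda>i j. (\<Sum>l = Suc j..<n. B (Suc i) l) - (\<Sum>l = Suc j..<n. B i l))"

text \<open>The tail sum from column 0 is the row sum 1, which provides the constant column required
  for taking row differences. Removing row 0 and column 0 of the result leaves the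
  deflation.\<close>

lemma deflation_TN:
  assumes "TN_stochastic (Suc n) B"
  shows "TN {..<n} {..<n} (deflation (Suc n) B)"
proof -
  let ?F = "\<lambda>i j. \<Sum>l = j..<Suc n. B i l"
  have "TN {..<Suc n} {..<Suc n} (\<lambda>i j. if i = 0 then ?F 0 j else ?F i j - ?F (i - 1) j)"
    using assms unfolding TN_stochastic_def
    by (intro TN_row_differences TN_tail_sums) (auto simp: lessThan_atLeast0)
  then have "TN {..<n} {..<n} (\<lambda>i j. if Suc i = 0 then ?F 0 (Suc j) else ?F (Suc i) (Suc j) - ?F (Suc i - 1) (Suc j))"
    by (rule TN_reindex) (auto simp: mono_on_def)
  then show ?thesis by (simp add: deflation_def)
qed

lemma deflation_diag:
  assumes "TN_stochastic (Suc n) B" "i < n"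
  shows "deflation (Suc n) B i i \<le> 1"
proof -
  have nn: "0 \<le> B a b" if "a < Suc n" "b < Suc n" for a b
    using assms(1) that TN_nonneg unfolding TN_stochastic_def by blast
  have "deflation (Suc n) B i i \<le> (\<Sum>l = Suc i..<Suc n. B (Suc i) l)"
    using assms(2) nn sum_nonneg[of "{Suc i..<Suc n}" "B i"] unfolding deflation_def by fastforce
  also have "\<dots> \<le> (\<Sum>l<Suc n. B (Suc i) l)"
    using assms(2) nn by (intro sum_mono2) auto
  also have "\<dots> = 1" using assms unfolding TN_stochastic_def by blast
  finally show ?thesis .
qed

text \<open>For the lower triangular matrix \<open>?L\<close> of ones, \<open>B\<close> times
  \<open>?L\<close> equals \<open>?L\<close> times \<open>?G\<close>, so \<open>B\<close> and
  \<open>?G\<close> have the same characteristic polynomial. The first column of \<open>?G\<close>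
  is a unit vector because the row sums are 1, and the block without row 0 and column 0 is the
  deflation.\<close>

lemma deflation_char_poly:
  assumes rows: "\<And>i. i < Suc n \<Longrightarrow> (\<Sum>j<Suc n. B i j) = 1"
  shows "fdet (Suc n) (\<lambda>i j. (if i = j then 1 else 0) + t * B i j) =
    (1 + t) * fdet n (\<lambda>i j. (if i = j then 1 else 0) + t * deflation (Suc n) B i j)"
proof -
  let ?d = "\<lambda>i j :: nat. if i = j then 1 else 0 :: real"
  let ?L = "\<lambda>i j :: nat. if j \<le> i then 1 else 0 :: real"
  let ?F = "\<lambda>i j. \<Sum>l = j..<Suc n. B i l"
  let ?G = "\<lambda>i j. if i = 0 then ?F 0 j else ?F i j - ?F (i - 1) j"
  have d1: "(\<Sum>l<Suc n. ?d i l * X l) = X i" "(\<Sum>l<Suc n. X l * ?d l i) = X i" if "i < Suc n"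
    for i and X :: "nat \<Rightarrow> real"
  proof -
    have "(\<Sum>l<Suc n. ?d i l * X l) = (\<Sum>l<Suc n. if l = i then X i else 0)"
      by (intro sum.cong) auto
    then show "(\<Sum>l<Suc n. ?d i l * X l) = X i" using that by (simp only: sum.delta) simp
    have "(\<Sum>l<Suc n. X l * ?d l i) = (\<Sum>l<Suc n. if l = i then X i else 0)"
      by (intro sum.cong) auto
    then show "(\<Sum>l<Suc n. X l * ?d l i) = X i" using that by (simp only: sum.delta) simp
  qed
  have BL: "(\<Sum>l<Suc n. B i l * ?L l j) = ?F i j" for i j
  proof -
    have "(\<Sum>l<Suc n. B i l * ?L l j) = (\<Sum>l<Suc n. if l \<in> {j..} then B i l else 0)"
      by (intro sum.cong) auto
    also have "\<dots> = (\<Sum>l\<in>{..<Suc n} \<inter> {j..}. B i l)"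
      by (rule sum.inter_restrict[symmetric]) simp
    also have "{..<Suc n} \<inter> {j..} = {j..<Suc n}" by auto
    finally show ?thesis .
  qed
  have tele: "(\<Sum>l\<le>i. ?G l j) = ?F i j" for i j
    by (induction i) auto
  have LG: "(\<Sum>l<Suc n. ?L i l * ?G l j) = ?F i j" if "i < Suc n" for i j
  proof -
    have "(\<Sum>l<Suc n. ?L i l * ?G l j) = (\<Sum>l<Suc n. if l \<in> {..i} then ?G l j else 0)"
      by (intro sum.cong) auto
    also have "\<dots> = (\<Sum>l\<in>{..<Suc n} \<inter> {..i}. ?G l j)"
      by (rule sum.inter_restrict[symmetric]) simp
    also have "{..<Suc n} \<inter> {..i} = {..i}" using that by auto
    finally show ?thesis using tele by simp
  qed
  have "fdet (Suc n) (\<lambda>i j. ?d i j + t * B i j) * fdet (Suc n) ?L =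
      fdet (Suc n) (\<lambda>i j. \<Sum>l<Suc n. (?d i l + t * B i l) * ?L l j)"
    by (rule fdet_mult[symmetric])
  also have "\<dots> = fdet (Suc n) (\<lambda>i j. \<Sum>l<Suc n. ?L i l * (?d l j + t * ?G l j))"
  proof (rule fdet_cong)
    fix i j assume ij: "i < Suc n" "j < Suc n"
    have "(\<Sum>l<Suc n. (?d i l + t * B i l) * ?L l j) =
        (\<Sum>l<Suc n. ?d i l * ?L l j) + t * (\<Sum>l<Suc n. B i l * ?L l j)"
      unfolding sum_distrib_left sum.distrib[symmetric] by (intro sum.cong) (auto simp: algebra_simps)
    also have "\<dots> = ?L i j + t * ?F i j" unfolding d1(1)[OF ij(1)] BL ..
    also have "\<dots> = (\<Sum>l<Suc n. ?L i l * ?d l j) + t * (\<Sum>l<Suc n. ?L i l * ?G l j)"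
      unfolding d1(2)[OF ij(2)] LG[OF ij(1)] ..
    also have "\<dots> = (\<Sum>l<Suc n. ?L i l * (?d l j + t * ?G l j))"
      unfolding sum_distrib_left sum.distrib[symmetric] by (intro sum.cong) (auto simp: algebra_simps)
    finally show "(\<Sum>l<Suc n. (?d i l + t * B i l) * ?L l j) = (\<Sum>l<Suc n. ?L i l * (?d l j + t * ?G l j))" .
  qed
  also have "\<dots> = fdet (Suc n) ?L * fdet (Suc n) (\<lambda>i j. ?d i j + t * ?G i j)"
    by (rule fdet_mult)
  finally have "fdet (Suc n) (\<lambda>i j. ?d i j + t * B i j) = fdet (Suc n) (\<lambda>i j. ?d i j + t * ?G i j)"
    by (simp only: fdet_lower_ones mult_1_right mult_1)
  also have "\<dots> = (?d 0 0 + t * ?G 0 0) * fdet n (\<lambda>i j. ?d (Suc i) (Suc j) + t * ?G (Suc i) (Suc j))"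
  proof (rule fdet_col_0_single)
    fix i assume i: "0 < i" "i < Suc n"
    have "?F i 0 = 1" "?F (i - 1) 0 = 1" using rows[of i] rows[of "i - 1"] i
      by (simp_all only: lessThan_atLeast0)
    then show "?d i 0 + t * ?G i 0 = 0" using i by simp
  qed
  also have "?G 0 0 = 1" using rows[of 0] by (simp add: lessThan_atLeast0)
  finally show ?thesis by (simp add: deflation_def)
qed

text \<open>Because of the factor \<open>1 + t\<close>, the coefficient of \<open>B\<close> at
  \<open>m\<close> is the sum of the coefficients of the deflation at \<open>m\<close> and
  \<open>m - 1\<close>; the alternating sum telescopes.\<close>

lemma alt_esum_deflation:
  assumes rows: "\<And>i. i < Suc n \<Longrightarrow> (\<Sum>j<Suc n. B i j) = 1" and "m \<le> Suc n"
  shows "alt_esum (Suc n) B m = esum n (deflation (Suc n) B) m"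
proof -
  let ?C = "deflation (Suc n) B"
  let ?c = "\<lambda>m. esum n ?C m + (if m = 0 then 0 else esum n ?C (m - 1))"
  have "(\<Sum>m\<le>Suc n. esum (Suc n) B m * t ^ m) = (\<Sum>m\<le>Suc n. ?c m * t ^ m)" for t
  proof -
    have "(\<Sum>m\<le>Suc n. esum (Suc n) B m * t ^ m) = (1 + t) * (\<Sum>m\<le>n. esum n ?C m * t ^ m)"
      using deflation_char_poly[where t = t, OF rows] by (simp only: fdet_char_poly)
    also have "\<dots> = (\<Sum>m\<le>Suc n. esum n ?C m * t ^ m) + (\<Sum>m\<le>n. esum n ?C m * t ^ Suc m)"
      by (simp add: esum_eq_0 algebra_simps sum_distrib_left sum.distrib)
    also have "(\<Sum>m\<le>n. esum n ?C m * t ^ Suc m) = (\<Sum>m\<le>Suc n. (if m = 0 then 0 else esum n ?C (m - 1)) * t ^ m)"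
      unfolding sum.atMost_Suc_shift by simp
    finally show ?thesis by (simp add: sum.distrib algebra_simps)
  qed
  then have c: "esum (Suc n) B m = ?c m" if "m \<le> Suc n" for m
    using polyfun_eq_coeffs[of "esum (Suc n) B" "Suc n" ?c] that by blast
  show ?thesis
    using assms(2)
  proof (induction m)
    case (Suc m)
    then show ?case using c[of "Suc m"] by (simp add: alt_esum_Suc)
  qed simp
qed

theorem normalized_alt_esum_antimono:
  assumes B: "TN_stochastic (Suc n) B" and m: "m < n"
  shows "alt_esum (Suc n) B (Suc m) / real (n choose Suc m) \<le> alt_esum (Suc n) B m / real (n choose m)"
proof -
  have rows: "(\<Sum>j<Suc n. B i j) = 1" if "i < Suc n" for i
    using B that unfolding TN_stochastic_def by blast
  show ?thesis
    using normalized_esum_antimono[OF deflation_TN[OF B] deflation_diag[OF B] m] m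
    by (simp only: alt_esum_deflation[OF rows])
qed

subsection \<open>Immanants of words\<close>

text \<open>The weights stay arbitrary: the combination wanted in the end is a difference of two
  normalized alternating sums, and the argument for words is the same for all weights.\<close>

definition minor_comb :: "nat \<Rightarrow> (nat \<Rightarrow> real) \<Rightarrow> (nat \<Rightarrow> nat \<Rightarrow> real) \<Rightarrow> real" where
  "minor_comb n g X = (\<Sum>I\<in>Pow {..<n}. g (card I) * pminor n X I)"

text \<open>
  The word \<open>c\<close> records with which multiplicities the columns of \<open>A\<close> are used, and \<open>B\<close> is the product
  of the averaging matrices split off so far. Initially \<open>c\<close> and \<open>B\<close> are identities and this is an
  ordinary immanant.
\<close>

definition word_imm ::
    "nat \<Rightarrow> (nat \<Rightarrow> real) \<Rightarrow> (nat \<Rightarrow> nat \<Rightarrow> real) \<Rightarrow> (nat \<Rightarrow> nat) \<Rightarrow> (nat \<Rightarrow> nat \<Rightarrow> real) \<Rightarrow> real" where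
  "word_imm n g A c B =
     (\<Sum>w | w permutes {..<n}. (\<Prod>i<n. A i (c (w i))) * minor_comb n g (\<lambda>i j. B i (w j)))"

definition avg_cols :: "nat set \<Rightarrow> (nat \<Rightarrow> nat \<Rightarrow> real) \<Rightarrow> nat \<Rightarrow> nat \<Rightarrow> real" where
  "avg_cols J B = (\<lambda>i j. if j \<in> J then (\<Sum>y\<in>J. B i y) / real (card J) else B i j)"

text \<open>Composing with a transposition shows that the sum is the same for all \<open>x\<close>
  in \<open>J\<close>; summing over \<open>x\<close> gives each value of \<open>f\<close> once per
  permutation.\<close>

lemma sum_permutes_apply:
  fixes f :: "'a \<Rightarrow> real"
  assumes J: "finite J" and x: "x \<in> J"
  shows "(\<Sum>u | u permutes J. f (u x)) = fact (card J) * ((\<Sum>y\<in>J. f y) / real (card J))"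
proof -
  have eq: "(\<Sum>u | u permutes J. f (u x')) = (\<Sum>u | u permutes J. f (u x))" if "x' \<in> J" for x'
    using sum_permutations_compose_right[OF permutes_swap_id[OF that x], of "\<lambda>u. f (u x')"] by simp
  have "real (card J) * (\<Sum>u | u permutes J. f (u x)) = (\<Sum>x'\<in>J. \<Sum>u | u permutes J. f (u x'))"
    by (simp add: eq)
  also have "\<dots> = (\<Sum>u | u permutes J. \<Sum>x'\<in>J. f (u x'))"
    by (rule sum.swap)
  also have "\<dots> = (\<Sum>u | u permutes J. \<Sum>y\<in>J. f y)"
    using sum.permute[of _ J f] by (intro sum.cong[OF refl, of "{u. u permutes J}"]) (simp add: o_def)
  also have "\<dots> = fact (card J) * (\<Sum>y\<in>J. f y)"
    using card_permutations[OF refl J] by simp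
  finally have "real (card J) * (\<Sum>u | u permutes J. f (u x)) = fact (card J) * (\<Sum>y\<in>J. f y)" .
  moreover have "real (card J) \<noteq> 0" using x J by auto
  ultimately show ?thesis by (simp add: nonzero_eq_divide_eq mult.commute)
qed

text \<open>The cases are the number of columns \<open>j\<close> in \<open>I\<close> with
  \<open>w j\<close> in \<open>J\<close>. With two of them both sides vanish: composing
  \<open>u\<close> with a transposition reverses the sign, and the averaged matrix has equal
  columns. With one, linearity in that column applies. With none, \<open>J\<close> enters only
  through the number of permutations.\<close>

lemma pminor_average:
  assumes J: "finite J" and I: "I \<subseteq> {..<n}" and w: "inj w"
  shows "(\<Sum>u | u permutes J. pminor n (\<lambda>i j. B i (u (w j))) I) =
    fact (card J) * pminor n (\<lambda>i j. avg_cols J B i (w j)) I"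
proof -
  let ?M = "\<lambda>C i j. if j \<in> I then C i (w j) else if i = j then 1 else 0 :: real"
  have pm: "pminor n (\<lambda>i j. C i (w j)) I = fdet n (?M C)" for C
    by (rule pminor_cols[OF I])
  note pm = pm[of "\<lambda>i j. B i (u j)" for u] pm[of "avg_cols J B"]
  consider (two) a b where "a \<in> I" "b \<in> I" "a \<noteq> b" "w a \<in> J" "w b \<in> J"
    | (one) a where "a \<in> I" "w a \<in> J" "\<And>b. b \<in> I \<Longrightarrow> b \<noteq> a \<Longrightarrow> w b \<notin> J"
    | (none) "\<And>b. b \<in> I \<Longrightarrow> w b \<notin> J"
    by metis
  then show ?thesis
  proof cases
    case two
    have ab: "a < n" "b < n" using two I by auto
    have "fdet n (?M (avg_cols J B)) = 0"
      using two ab by (intro fdet_eq_cols[of a _ b]) (auto simp: avg_cols_def)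
    moreover have "(\<Sum>u | u permutes J. fdet n (?M (\<lambda>i j. B i (u j)))) = 0"
    proof -
      let ?t = "transpose (w a) (w b)" and ?s = "transpose a b"
      have ws: "?t (w j) = w (?s j)" for j
        using inj_eq[OF w] by (auto simp: transpose_def)
      have neg: "fdet n (?M (\<lambda>i j. B i ((u \<circ> ?t) j))) = - fdet n (?M (\<lambda>i j. B i (u j)))" for u
      proof -
        have "fdet n (?M (\<lambda>i j. B i ((u \<circ> ?t) j))) = fdet n (\<lambda>i j. ?M (\<lambda>i j. B i (u j)) i (?s j))"
          using two by (intro fdet_cong) (auto simp: ws transpose_def inj_eq[OF w])
        also have "\<dots> = of_int (sign ?s) * fdet n (?M (\<lambda>i j. B i (u j)))"
          using ab by (intro fdet_permute_cols permutes_swap_id) auto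
        finally show ?thesis using two by (simp add: sign_swap_id)
      qed
      have "(\<Sum>u | u permutes J. fdet n (?M (\<lambda>i j. B i (u j)))) =
          (\<Sum>u | u permutes J. fdet n (?M (\<lambda>i j. B i ((u \<circ> ?t) j))))"
        by (rule sum_permutations_compose_right[OF permutes_swap_id]) (use two in auto)
      also have "\<dots> = - (\<Sum>u | u permutes J. fdet n (?M (\<lambda>i j. B i (u j))))"
        by (simp only: neg sum_negf)
      finally show ?thesis by simp
    qed
    ultimately show ?thesis
      by (simp only: pm mult_zero_right)
  next
    case one
    let ?R = "?M B"
    have a: "a < n" using one I by auto
    have u: "u (w j) = w j" if "u permutes J" "j \<in> I" "j \<noteq> a" for u j
      using one(3)[of j] that by (auto intro: permutes_not_in)
    have "(\<Sum>u | u permutes J. fdet n (?M (\<lambda>i j. B i (u j)))) =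
        (\<Sum>u | u permutes J. 1 * fdet n (\<lambda>i j. if j = a then B i (u (w a)) else ?R i j))"
    proof (intro sum.cong refl)
      fix v assume "v \<in> {v. v permutes J}"
      then have "v (w j) = w j" if "j \<in> I" "j \<noteq> a" for j using u[of v j] that by simp
      then show "fdet n (?M (\<lambda>i j. B i (v j))) = 1 * fdet n (\<lambda>i j. if j = a then B i (v (w a)) else ?R i j)"
        using one by (auto intro!: fdet_cong)
    qed
    also have "\<dots> = fdet n (\<lambda>i j. if j = a then \<Sum>u | u permutes J. 1 * B i (u (w a)) else ?R i j)"
      by (rule fdet_col_sum[OF a, symmetric])
    \<comment> \<open>The one-element index set \<open>{()}\<close> makes the column sum rule usable
      for pulling a scalar out of a column.\<close>
    also have "\<dots> = fdet n (\<lambda>i j. if j = a then \<Sum>y\<in>{()}. fact (card J) * ((\<Sum>y\<in>J. B i y) / real (card J)) else ?R i j)"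
      using sum_permutes_apply[OF J one(2)] by (intro fdet_cong) auto
    also have "\<dots> = fact (card J) * fdet n (\<lambda>i j. if j = a then (\<Sum>y\<in>J. B i y) / real (card J) else ?R i j)"
      by (subst fdet_col_sum[OF a]) simp
    also have "fdet n (\<lambda>i j. if j = a then (\<Sum>y\<in>J. B i y) / real (card J) else ?R i j) = fdet n (?M (avg_cols J B))"
      using one by (intro fdet_cong) (auto simp: avg_cols_def)
    finally show ?thesis by (simp only: pm)
  next
    case none
    have "fdet n (?M (\<lambda>i j. B i (u j))) = fdet n (?M B)" if "u permutes J" for u
      using none that by (intro fdet_cong) (auto simp: permutes_not_in)
    moreover have "fdet n (?M (avg_cols J B)) = fdet n (?M B)"
      using none by (intro fdet_cong) (auto simp: avg_cols_def)
    ultimately show ?thesis using card_permutations[OF refl J] by (simp add: pm)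
  qed
qed

lemma minor_comb_average:
  assumes J: "finite J" and w: "inj w"
  shows "(\<Sum>u | u permutes J. minor_comb n g (\<lambda>i j. B i (u (w j)))) =
    fact (card J) * minor_comb n g (\<lambda>i j. avg_cols J B i (w j))"
proof -
  have "(\<Sum>u | u permutes J. minor_comb n g (\<lambda>i j. B i (u (w j)))) =
      (\<Sum>I\<in>Pow {..<n}. g (card I) * (\<Sum>u | u permutes J. pminor n (\<lambda>i j. B i (u (w j))) I))"
    unfolding minor_comb_def by (subst sum.swap) (simp add: sum_distrib_left)
  also have "\<dots> = (\<Sum>I\<in>Pow {..<n}. g (card I) * (fact (card J) * pminor n (\<lambda>i j. avg_cols J B i (w j)) I))"
    using pminor_average[OF J _ w] by (intro sum.cong refl) auto
  finally show ?thesis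
    by (simp add: minor_comb_def sum_distrib_left algebra_simps)
qed

text \<open>A minor with two columns from \<open>J\<close> vanishes. With one, it is an average of
  minors in which the index of this column runs through \<open>J\<close>; the word stays increasing
  because \<open>J\<close> is an interval containing no other index of the word.\<close>

lemma TN_stochastic_avg:
  assumes B: "TN_stochastic n B" and J: "J \<subseteq> {..<n}" "J \<noteq> {}"
    and conv: "\<And>x y z. x \<in> J \<Longrightarrow> z \<in> J \<Longrightarrow> x \<le> y \<Longrightarrow> y \<le> z \<Longrightarrow> y \<in> J"
  shows "TN_stochastic n (avg_cols J B)"
proof -
  have fin: "finite J" using J(1) by (rule finite_subset) simp
  have TN: "TN {..<n} {..<n} B" using B by (simp add: TN_stochastic_def)
  have cpos: "0 < card J" using fin J(2) by (simp add: card_gt_0_iff)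
  have "TN {..<n} {..<n} (avg_cols J B)"
  proof (rule TN_I)
    fix k and r c :: "nat \<Rightarrow> nat"
    assume r: "strict_mono_on {..<k} r" "r ` {..<k} \<subseteq> {..<n}" and c: "strict_mono_on {..<k} c" "c ` {..<k} \<subseteq> {..<n}"
    note mr = strict_mono_on_imp_mono_on[OF r(1)] and mc = strict_mono_on_imp_mono_on[OF c(1)]
    consider (two) a b where "a < k" "b < k" "a \<noteq> b" "c a \<in> J" "c b \<in> J"
      | (one) a where "a < k" "c a \<in> J" "\<And>b. b < k \<Longrightarrow> b \<noteq> a \<Longrightarrow> c b \<notin> J"
      | (none) "\<And>b. b < k \<Longrightarrow> c b \<notin> J"
      by metis
    then show "0 \<le> fdet k (\<lambda>i j. avg_cols J B (r i) (c j))"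
    proof cases
      case two
      then have "fdet k (\<lambda>i j. avg_cols J B (r i) (c j)) = 0"
        by (intro fdet_eq_cols[of a _ b]) (auto simp: avg_cols_def)
      then show ?thesis by simp
    next
      case one
      have "fdet k (\<lambda>i j. avg_cols J B (r i) (c j)) =
          fdet k (\<lambda>i j. if j = a then \<Sum>y\<in>J. (1 / real (card J)) * B (r i) y else B (r i) (c j))"
        using one by (intro fdet_cong) (auto simp: avg_cols_def sum_divide_distrib)
      also have "\<dots> = (\<Sum>y\<in>J. (1 / real (card J)) * fdet k (\<lambda>i j. if j = a then B (r i) y else B (r i) (c j)))"
        by (rule fdet_col_sum[OF one(1)])
      also have "0 \<le> \<dots>"
      proof (intro sum_nonneg mult_nonneg_nonneg)
        fix y assume y: "y \<in> J"
        have "mono_on {..<k} (c(a := y))"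
        proof (rule mono_onI)
          fix p q assume pq: "p \<in> {..<k}" "q \<in> {..<k}" "p \<le> q"
          have le: "c p \<le> c q" using mc pq by (rule mono_onD)
          moreover have "y \<le> c q" if "p = a" "q \<noteq> a"
            using conv[OF one(2) y, of "c q"] one(3)[of q] le that pq by force
          moreover have "c p \<le> y" if "p \<noteq> a" "q = a"
            using conv[OF y one(2), of "c p"] one(3)[of p] le that pq by force
          ultimately show "(c(a := y)) p \<le> (c(a := y)) q" by simp
        qed
        moreover have "(c(a := y)) ` {..<k} \<subseteq> {..<n}" using c(2) y J(1) by auto
        ultimately have "0 \<le> fdet k (\<lambda>i j. B (r i) ((c(a := y)) j))"
          using TN_D[OF TN mr _ r(2)] by blast
        also have "fdet k (\<lambda>i j. B (r i) ((c(a := y)) j)) = fdet k (\<lambda>i j. if j = a then B (r i) y else B (r i) (c j))"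
          by (intro fdet_cong) auto
        finally show "0 \<le> fdet k (\<lambda>i j. if j = a then B (r i) y else B (r i) (c j))" .
      qed simp
      finally show ?thesis .
    next
      case none
      then have "fdet k (\<lambda>i j. avg_cols J B (r i) (c j)) = fdet k (\<lambda>i j. B (r i) (c j))"
        by (intro fdet_cong) (auto simp: avg_cols_def)
      then show ?thesis using TN_D[OF TN mr mc r(2) c(2)] by simp
    qed
  qed
  moreover have "(\<Sum>j<n. avg_cols J B i j) = 1" if "i < n" for i
  proof -
    have split: "(\<Sum>j<n. f j) = (\<Sum>j\<in>{..<n} - J. f j) + (\<Sum>j\<in>J. f j)" for f :: "nat \<Rightarrow> real"
      using J(1) by (intro sum.subset_diff) auto
    have "(\<Sum>j<n. avg_cols J B i j) = (\<Sum>j<n. B i j)"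
      unfolding split using cpos by (simp add: avg_cols_def)
    then show ?thesis using B that by (simp add: TN_stochastic_def)
  qed
  ultimately show ?thesis by (simp add: TN_stochastic_def)
qed

text \<open>Replacing \<open>w\<close> by its product with the inverse of \<open>u\<close> moves the
  rearrangement from the word to the columns of \<open>B\<close>.\<close>

lemma word_imm_comp:
  assumes u: "u permutes {..<n}"
  shows "word_imm n g A (c \<circ> u) B = word_imm n g A c (\<lambda>i j. B i (inv_into UNIV u j))"
proof -
  let ?F = "\<lambda>w. (\<Prod>i<n. A i (c (u (w i)))) * minor_comb n g (\<lambda>i j. B i (w j))"
  have "word_imm n g A (c \<circ> u) B = (\<Sum>w | w permutes {..<n}. ?F (inv_into UNIV u \<circ> w))"
    unfolding word_imm_def o_apply
    using setum_permutations_compose_left[OF permutes_inv[OF u], of ?F] by (simp add: o_def)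
  then show ?thesis
    by (simp add: word_imm_def permutes_inverses[OF u])
qed

text \<open>Permutations of \<open>J\<close> fix the word, so by \<open>word_imm_comp\<close> they
  may act on the columns of \<open>B\<close> without changing the value; averaging over them is
  \<open>minor_comb_average\<close>.\<close>

lemma word_imm_average:
  assumes J: "J \<subseteq> {..<n}" and c: "\<And>x y. x \<in> J \<Longrightarrow> y \<in> J \<Longrightarrow> c x = c y"
  shows "word_imm n g A c B = word_imm n g A c (avg_cols J B)"
proof -
  have fin: "finite J" using J by (rule finite_subset) simp
  have inv: "word_imm n g A c B = word_imm n g A c (\<lambda>i j. B i (inv_into UNIV u j))" if u: "u permutes J" for u
  proof -
    have "c \<circ> u = c"
    proof
      fix x show "(c \<circ> u) x = c x"
        using c[of "u x" x] permutes_in_image[OF u, of x] permutes_not_in[OF u, of x] by (cases "x \<in> J") auto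
    qed
    then show ?thesis using word_imm_comp[OF permutes_subset[OF u J], of g A c B] by simp
  qed
  have "fact (card J) * word_imm n g A c B = (\<Sum>u | u permutes J. word_imm n g A c (\<lambda>i j. B i (inv_into UNIV u j)))"
    using card_permutations[OF refl fin] by (simp flip: inv)
  also have "\<dots> = (\<Sum>u | u permutes J. word_imm n g A c (\<lambda>i j. B i (u j)))"
    by (rule sum_permutations_inverse[symmetric])
  also have "\<dots> = (\<Sum>w | w permutes {..<n}. (\<Prod>i<n. A i (c (w i))) *
      (\<Sum>u | u permutes J. minor_comb n g (\<lambda>i j. B i (u (w j)))))"
    unfolding word_imm_def by (subst sum.swap) (simp add: sum_distrib_left)
  also have "\<dots> = (\<Sum>w | w permutes {..<n}. (\<Prod>i<n. A i (c (w i))) *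
      (fact (card J) * minor_comb n g (\<lambda>i j. avg_cols J B i (w j))))"
    by (intro sum.cong refl arg_cong2[of _ _ _ _ "(*)"] minor_comb_average[OF fin]) (auto intro: permutes_inj)
  also have "\<dots> = fact (card J) * word_imm n g A c (avg_cols J B)"
    by (simp add: word_imm_def sum_distrib_left algebra_simps)
  finally show ?thesis by simp
qed

section \<open>Positivity for increasing words and its stability\<close>

text \<open>Multiplying \<open>A\<close> by an elementary factor changes letters of the word and
  averages \<open>B\<close>; quantifying over both makes the condition stable under such
  factors.\<close>

definition word_pos :: "nat \<Rightarrow> (nat \<Rightarrow> real) \<Rightarrow> (nat \<Rightarrow> nat \<Rightarrow> real) \<Rightarrow> bool" where
  "word_pos n g A \<longleftrightarrow> (\<forall>c B. mono_on {..<n} c \<longrightarrow> c ` {..<n} \<subseteq> {..<n} \<longrightarrow> TN_stochastic n B \<longrightarrow>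
     0 \<le> word_imm n g A c B)"

lemma permutes_lessThan: "w permutes {..<n} \<Longrightarrow> i < n \<Longrightarrow> w i < (n::nat)"
  using permutes_in_image by fastforce

lemma word_imm_cong:
  assumes "\<And>i j. i < n \<Longrightarrow> j < n \<Longrightarrow> A i j = A' i j" "c ` {..<n} \<subseteq> {..<n}"
  shows "word_imm n g A c B = word_imm n g A' c B"
  unfolding word_imm_def
  by (intro sum.cong refl arg_cong2[of _ _ _ _ "(*)"] prod.cong assms(1))
    (use assms(2) in \<open>auto simp: permutes_lessThan image_subset_iff\<close>)

lemma word_pos_cong:
  assumes "word_pos n g A" "\<And>i j. i < n \<Longrightarrow> j < n \<Longrightarrow> A i j = A' i j"
  shows "word_pos n g A'"
  using assms unfolding word_pos_def by (metis word_imm_cong[of n A A'])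

lemma permutes_increasing_id:
  assumes w: "w permutes {..<n}" and less: "\<And>i j. i < j \<Longrightarrow> j < n \<Longrightarrow> w i < w j"
  shows "w = (id :: nat \<Rightarrow> nat)"
proof -
  have "i \<le> w i" if "i < n" for i
    using that
  proof (induction i)
    case (Suc i)
    then show ?case using less[of i "Suc i"] by simp
  qed simp
  then show ?thesis using permutes_natset_ge[OF w] by auto
qed

text \<open>A nonzero product forces \<open>c (w i) = i\<close> for all \<open>i\<close>, and
  monotonicity of \<open>c\<close> then makes \<open>w\<close> increasing. Thus only
  \<open>w = id\<close> contributes, and the assumption on \<open>B\<close> remains.\<close>

lemma word_pos_id:
  assumes pos: "\<And>B. TN_stochastic n B \<Longrightarrow> 0 \<le> minor_comb n g B"
  shows "word_pos n g (\<lambda>i j. if i = j then 1 else 0)"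
  unfolding word_pos_def
proof (intro allI impI)
  fix c B assume c: "mono_on {..<n} c" "c ` {..<n} \<subseteq> {..<n}" and B: "TN_stochastic n B"
  show "0 \<le> word_imm n g (\<lambda>i j. if i = j then 1 else 0) c B"
    unfolding word_imm_def
  proof (intro sum_nonneg)
    fix w assume "w \<in> {w. w permutes {..<n}}"
    then have w: "w permutes {..<n}" by simp
    let ?p = "\<Prod>i<n. if i = c (w i) then 1 else 0 :: real"
    show "0 \<le> ?p * minor_comb n g (\<lambda>i j. B i (w j))"
    proof (cases "?p = 0")
      case False
      have cw: "c (w i) = i" if "i < n" for i
      proof (rule ccontr)
        assume "c (w i) \<noteq> i"
        then have "?p = 0" using that by (intro prod_zero) (auto intro!: bexI[of _ i])
        with False show False by simp
      qed
      have less: "w i < w j" if "i < j" "j < n" for i j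
      proof (rule ccontr)
        assume "\<not> w i < w j"
        then have "c (w j) \<le> c (w i)"
          using that w by (intro mono_onD[OF c(1)]) (auto simp: permutes_lessThan)
        then show False using cw[of i] cw[of j] that by simp
      qed
      have "w = id" by (rule permutes_increasing_id[OF w less])
      moreover have "0 \<le> ?p" by (intro prod_nonneg) auto
      ultimately show ?thesis using pos[OF B] by simp
    next
      case True
      then show ?thesis by (simp only: mult_zero_left)
    qed
  qed
qed

lemma word_pos_scale_cols:
  assumes A: "word_pos n g A" and d: "\<And>j. j < n \<Longrightarrow> 0 \<le> d j"
  shows "word_pos n g (\<lambda>i j. d j * A i j)"
  unfolding word_pos_def
proof (intro allI impI)
  fix c B assume c: "mono_on {..<n} c" "c ` {..<n} \<subseteq> {..<n}" and B: "TN_stochastic n B"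
  have "(\<Prod>i<n. d (c (w i))) = (\<Prod>y<n. d (c y))" if "w permutes {..<n}" for w
    using prod.permute[OF that, of "\<lambda>y. d (c y)"] by (simp add: o_def)
  then have "word_imm n g (\<lambda>i j. d j * A i j) c B = (\<Prod>y<n. d (c y)) * word_imm n g A c B"
    unfolding word_imm_def sum_distrib_left by (intro sum.cong refl) (simp add: prod.distrib)
  moreover have "0 \<le> (\<Prod>y<n. d (c y))" using c d by (intro prod_nonneg) auto
  moreover have "0 \<le> word_imm n g A c B" using A c B by (simp add: word_pos_def)
  ultimately show "0 \<le> word_imm n g (\<lambda>i j. d j * A i j) c B" by simp
qed

text \<open>In a block of equal letters, the largest positions can be raised to the next letter
  without destroying monotonicity; their complements serve for lowering to the preceding
  letter.\<close>

lemma upper_subset: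
  fixes J :: "'a::linorder set"
  assumes "finite J" "d \<le> card J"
  obtains E where "E \<subseteq> J" "card E = d" "\<And>x y. x \<in> E \<Longrightarrow> y \<in> J \<Longrightarrow> x \<le> y \<Longrightarrow> y \<in> E"
  using assms(2)
proof (induction d arbitrary: thesis)
  case 0
  show ?case by (rule 0(1)[of "{}"]) auto
next
  case (Suc d)
  obtain E where E: "E \<subseteq> J" "card E = d" "\<And>x y. x \<in> E \<Longrightarrow> y \<in> J \<Longrightarrow> x \<le> y \<Longrightarrow> y \<in> E"
    using Suc by (metis Suc_leD)
  have finE: "finite E" using E(1) assms(1) finite_subset by blast
  have ne: "J - E \<noteq> {}" using E(1,2) Suc.prems(2) by auto
  let ?m = "Max (J - E)"
  have m: "?m \<in> J - E" using ne assms(1) by (intro Max_in) auto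
  have mge: "y \<le> ?m" if "y \<in> J" "y \<notin> E" for y using that assms(1) by (intro Max_ge) auto
  show ?case
  proof (rule Suc.prems(1)[of "insert ?m E"])
    show "card (insert ?m E) = Suc d" using m finE E(2) by simp
    fix x y assume xy: "x \<in> insert ?m E" "y \<in> J" "x \<le> y"
    show "y \<in> insert ?m E"
      using xy E(3)[of x y] mge[of y] by fastforce
  qed (use m E in auto)
qed

lemma permutes_onto_subset:
  assumes "finite J" "E \<subseteq> J" "D \<subseteq> J" "card E = card D"
  obtains u where "u permutes J" "\<And>x. x \<in> J \<Longrightarrow> u x \<in> D \<longleftrightarrow> x \<in> E"
proof -
  have fin: "finite E" "finite D" using assms finite_subset by blast+
  obtain f where f: "bij_betw f E D" using finite_same_card_bij[OF fin assms(4)] by blast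
  have "card (J - E) = card (J - D)" using assms fin by (simp add: card_Diff_subset)
  then obtain h where h: "bij_betw h (J - E) (J - D)"
    using finite_same_card_bij assms(1) by (metis finite_Diff)
  let ?u = "\<lambda>x. if x \<in> E then f x else if x \<in> J then h x else x"
  have "bij_betw ?u E D" using f by (subst bij_betw_cong[of E ?u f]) auto
  moreover have "bij_betw ?u (J - E) (J - D)" using h by (subst bij_betw_cong[of "J - E" ?u h]) auto
  ultimately have "bij_betw ?u (E \<union> (J - E)) (D \<union> (J - D))" by (rule bij_betw_combine) auto
  then have "bij_betw ?u J J" using assms by (simp add: Un_absorb1)
  then have "?u permutes J" by (rule bij_imp_permutes) (use assms in auto)
  moreover have "?u x \<in> D \<longleftrightarrow> x \<in> E" if "x \<in> J" for x
    using that bij_betwE[OF f] bij_betwE[OF h] by auto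
  ultimately show thesis using that by blast
qed

text \<open>On the block \<open>J\<close> of positions with letter \<open>q\<close> the word is
  constant, so \<open>B\<close> may first be averaged over \<open>J\<close>. Expanding the product
  chooses a set \<open>D\<close> of positions whose letter becomes \<open>q'\<close>. The averaged
  matrix is invariant under permutations of \<open>J\<close>, so \<open>D\<close> can be moved to an
  end of the block, where the adjacent letter \<open>q'\<close> leaves the word increasing.\<close>

lemma word_pos_add_col:
  assumes A: "word_pos n g A" and q: "q < n" "q' < n" "q' = Suc q \<or> q = Suc q'" and t: "0 \<le> t"
  shows "word_pos n g (\<lambda>i j. if j = q then A i q + t * A i q' else A i j)" (is "word_pos n g ?A")
  unfolding word_pos_def
proof (intro allI impI)
  fix c B assume c: "mono_on {..<n} c" "c ` {..<n} \<subseteq> {..<n}" and B: "TN_stochastic n B"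
  define J where "J = {x. x < n \<and> c x = q}"
  have J: "J \<subseteq> {..<n}" "finite J" by (auto simp: J_def)
  have cm: "c x \<le> c y" if "x \<le> y" "y < n" for x y using mono_onD[OF c(1), of x y] that by auto
  show "0 \<le> word_imm n g ?A c B"
  proof (cases "J = {}")
    case True
    have "word_imm n g ?A c B = word_imm n g A c B"
      unfolding word_imm_def
      by (intro sum.cong refl arg_cong2[of _ _ _ _ "(*)"] prod.cong)
        (use True in \<open>auto simp: J_def permutes_lessThan\<close>)
    then show ?thesis using A c B by (simp add: word_pos_def)
  next
    case False
    define B' where "B' = avg_cols J B"
    have B': "TN_stochastic n B'"
      unfolding B'_def
    proof (rule TN_stochastic_avg[OF B J(1) False])
      fix x y z assume "x \<in> J" "z \<in> J" "x \<le> y" "y \<le> z"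
      then show "y \<in> J" using cm[of x y] cm[of y z] by (auto simp: J_def)
    qed
    let ?c = "\<lambda>D x. if x \<in> D then q' else c x"
    have expand: "(\<Prod>i<n. ?A i (c (w i))) = (\<Sum>D\<in>Pow J. t ^ card D * (\<Prod>i<n. A i (?c D (w i))))"
      if w: "w permutes {..<n}" for w
    proof -
      let ?v = "inv_into UNIV w"
      \<comment> \<open>Indexing the product by the positions \<open>y = w i\<close> of the word
        makes \<open>J\<close> a fixed set of factors, independent of \<open>w\<close>.\<close>
      have re: "(\<Prod>i<n. h i (w i)) = (\<Prod>y<n. h (?v y) y)" for h :: "nat \<Rightarrow> nat \<Rightarrow> real"
        using prod.permute[OF permutes_inv[OF w], of "\<lambda>i. h i (w i)"]
        by (simp add: o_def permutes_inverses[OF w])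
      have split: "(\<Prod>y<n. f y) = (\<Prod>y\<in>{..<n} - J. f y) * (\<Prod>y\<in>J. f y)" for f :: "nat \<Rightarrow> real"
        using J by (intro prod.subset_diff) auto
      have "(\<Prod>i<n. ?A i (c (w i))) = (\<Prod>y\<in>{..<n} - J. ?A (?v y) (c y)) * (\<Prod>y\<in>J. ?A (?v y) (c y))"
        unfolding re[of "\<lambda>i y. ?A i (c y)"] split ..
      also have "(\<Prod>y\<in>J. ?A (?v y) (c y)) = (\<Prod>y\<in>J. t * A (?v y) q' + A (?v y) (c y))"
        by (intro prod.cong) (auto simp: J_def)
      also have "\<dots> = (\<Sum>D\<in>Pow J. (\<Prod>y\<in>D. t * A (?v y) q') * (\<Prod>y\<in>J - D. A (?v y) (c y)))"
        by (rule prod_add[OF J(2)])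
      also have "\<dots> = (\<Sum>D\<in>Pow J. t ^ card D * (\<Prod>y\<in>J. A (?v y) (?c D y)))"
      proof (intro sum.cong refl)
        fix D assume "D \<in> Pow J"
        then have D: "D \<subseteq> J" "finite D" using J(2) by (auto intro: finite_subset)
        have "(\<Prod>y\<in>J. A (?v y) (?c D y)) = (\<Prod>y\<in>J - D. A (?v y) (?c D y)) * (\<Prod>y\<in>D. A (?v y) (?c D y))"
          using D J by (intro prod.subset_diff) auto
        also have "(\<Prod>y\<in>J - D. A (?v y) (?c D y)) = (\<Prod>y\<in>J - D. A (?v y) (c y))"
          by (intro prod.cong) auto
        also have "(\<Prod>y\<in>D. A (?v y) (?c D y)) = (\<Prod>y\<in>D. A (?v y) q')"
          by (intro prod.cong) auto
        finally show "(\<Prod>y\<in>D. t * A (?v y) q') * (\<Prod>y\<in>J - D. A (?v y) (c y)) =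
            t ^ card D * (\<Prod>y\<in>J. A (?v y) (?c D y))"
          by (simp add: prod.distrib)
      qed
      also have "(\<Prod>y\<in>{..<n} - J. ?A (?v y) (c y)) * (\<Sum>D\<in>Pow J. t ^ card D * (\<Prod>y\<in>J. A (?v y) (?c D y))) =
          (\<Sum>D\<in>Pow J. t ^ card D * (\<Prod>y<n. A (?v y) (?c D y)))"
        unfolding sum_distrib_left
      proof (intro sum.cong refl)
        fix D assume "D \<in> Pow J"
        then have "(\<Prod>y\<in>{..<n} - J. ?A (?v y) (c y)) = (\<Prod>y\<in>{..<n} - J. A (?v y) (?c D y))"
          by (intro prod.cong) (auto simp: J_def)
        then show "(\<Prod>y\<in>{..<n} - J. ?A (?v y) (c y)) * (t ^ card D * (\<Prod>y\<in>J. A (?v y) (?c D y))) =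
            t ^ card D * (\<Prod>y<n. A (?v y) (?c D y))"
          unfolding split[of "\<lambda>y. A (?v y) (?c D y)"] by (simp only: mult.left_commute)
      qed
      finally show ?thesis unfolding re[of "\<lambda>i y. A i (?c D y)" for D] .
    qed
    have "word_imm n g ?A c B = word_imm n g ?A c B'"
      unfolding B'_def by (rule word_imm_average) (auto simp: J_def)
    also have "\<dots> = (\<Sum>D\<in>Pow J. t ^ card D * word_imm n g A (?c D) B')"
    proof -
      have "word_imm n g ?A c B' = (\<Sum>w | w permutes {..<n}. \<Sum>D\<in>Pow J.
          t ^ card D * (\<Prod>i<n. A i (?c D (w i))) * minor_comb n g (\<lambda>i j. B' i (w j)))"
        unfolding word_imm_def using expand by (intro sum.cong refl) (simp add: sum_distrib_right)
      also have "\<dots> = (\<Sum>D\<in>Pow J. \<Sum>w | w permutes {..<n}.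
          t ^ card D * (\<Prod>i<n. A i (?c D (w i))) * minor_comb n g (\<lambda>i j. B' i (w j)))"
        by (rule sum.swap)
      finally show ?thesis by (simp only: word_imm_def sum_distrib_left mult.assoc)
    qed
    also have "0 \<le> \<dots>"
    proof (intro sum_nonneg mult_nonneg_nonneg)
      fix D assume "D \<in> Pow J"
      then have D: "D \<subseteq> J" by simp
      have cD: "card D \<le> card J" by (rule card_mono[OF J(2) D])
      \<comment> \<open>\<open>E\<close> is the upper end of \<open>J\<close> if the letter
        increases, and the lower end, the complement of an upper one, if it decreases.\<close>
      obtain E where E: "E \<subseteq> J" "card E = card D"
        "q' = Suc q \<Longrightarrow> x \<in> E \<Longrightarrow> y \<in> J \<Longrightarrow> x \<le> y \<Longrightarrow> y \<in> E"
        "q = Suc q' \<Longrightarrow> y \<in> E \<Longrightarrow> x \<in> J \<Longrightarrow> x \<le> y \<Longrightarrow> x \<in> E" for x y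
      proof (cases "q' = Suc q")
        case True
        obtain E where "E \<subseteq> J" "card E = card D" "\<And>x y. x \<in> E \<Longrightarrow> y \<in> J \<Longrightarrow> x \<le> y \<Longrightarrow> y \<in> E"
          using upper_subset[OF J(2) cD] by metis
        then show thesis using True by (intro that[of E]) auto
      next
        case False
        obtain E where E: "E \<subseteq> J" "card E = card J - card D" "\<And>x y. x \<in> E \<Longrightarrow> y \<in> J \<Longrightarrow> x \<le> y \<Longrightarrow> y \<in> E"
          using upper_subset[OF J(2), of "card J - card D"] by (metis diff_le_self)
        have "card (J - E) = card D"
          using E(1,2) cD J(2) by (simp add: card_Diff_subset finite_subset)
        then show thesis using False E by (intro that[of "J - E"]) auto
      qed
      obtain u where u: "u permutes J" "\<And>x. x \<in> J \<Longrightarrow> u x \<in> D \<longleftrightarrow> x \<in> E"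
        using permutes_onto_subset[OF J(2) E(1) D E(2)] by blast
      have un: "u permutes {..<n}" by (rule permutes_subset[OF u(1) J(1)])
      have cu: "(?c D \<circ> u) x = (if x \<in> E then q' else c x)" if "x < n" for x
      proof (cases "x \<in> J")
        case True
        then have "u x \<in> J" using permutes_in_image[OF u(1)] by simp
        then show ?thesis using True u(2)[OF True] by (auto simp: J_def)
      next
        case False
        then show ?thesis using D E(1) permutes_not_in[OF u(1) False] by auto
      qed
      have "mono_on {..<n} (?c D \<circ> u)"
      proof (rule mono_onI)
        fix x y assume xy: "x \<in> {..<n}" "y \<in> {..<n}" "x \<le> y"
        have cxy: "c x \<le> c y" using cm xy by simp
        have "(if x \<in> E then q' else c x) \<le> (if y \<in> E then q' else c y)"
        proof (cases "x \<in> E"; cases "y \<in> E")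
          assume xE: "x \<in> E" and yE: "y \<notin> E"
          then have cx: "c x = q" using E(1) by (auto simp: J_def)
          show ?thesis
          proof (cases "y \<in> J")
            case True
            then have "q' \<noteq> Suc q" using E(3)[OF _ xE True] xy(3) yE by auto
            then show ?thesis using q(3) cx cxy xE yE by auto
          next
            case False
            then have "c y \<noteq> q" using xy(2) by (simp add: J_def)
            then show ?thesis using q(3) cx cxy xE yE by auto
          qed
        next
          assume xE: "x \<notin> E" and yE: "y \<in> E"
          then have cy: "c y = q" using E(1) by (auto simp: J_def)
          show ?thesis
          proof (cases "x \<in> J")
            case True
            then have "q \<noteq> Suc q'" using E(4)[OF _ yE True] xy(3) xE by auto
            then show ?thesis using q(3) cy cxy xE yE by auto
          next
            case False
            then have "c x \<noteq> q" using xy(1) by (simp add: J_def)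
            then show ?thesis using q(3) cy cxy xE yE by auto
          qed
        qed (use cxy in auto)
        then show "(?c D \<circ> u) x \<le> (?c D \<circ> u) y" using cu xy by simp
      qed
      moreover have "(?c D \<circ> u) ` {..<n} \<subseteq> {..<n}"
        using cu c(2) q(2) by (auto simp: image_subset_iff)
      ultimately have "0 \<le> word_imm n g A (?c D \<circ> u) B'"
        using A B' by (simp only: word_pos_def)
      also have "word_imm n g A (?c D \<circ> u) B' = word_imm n g A (?c D) (\<lambda>i j. B' i (inv_into UNIV u j))"
        by (rule word_imm_comp[OF un])
      \<comment> \<open>The columns of \<open>B'\<close> with index in \<open>J\<close> coincide, so
        permuting them changes nothing.\<close>
      also have "(\<lambda>i j. B' i (inv_into UNIV u j)) = B'"
      proof (intro ext)
        fix i j show "B' i (inv_into UNIV u j) = B' i j"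
          using permutes_in_image[OF permutes_inv[OF u(1)], of j] permutes_not_in[OF permutes_inv[OF u(1)], of j]
          by (cases "j \<in> J") (auto simp: B'_def avg_cols_def)
      qed
      finally show "0 \<le> word_imm n g A (?c D) B'" .
    qed (use t in simp)
    finally show ?thesis .
  qed
qed

lemma word_pos_limit:
  assumes "\<And>m. word_pos n g (A m)" and lim: "\<And>i j. i < n \<Longrightarrow> j < n \<Longrightarrow> (\<lambda>m. A m i j) \<longlonglongrightarrow> L i j"
  shows "word_pos n g L"
  unfolding word_pos_def
proof (intro allI impI)
  fix c B assume c: "mono_on {..<n} c" "c ` {..<n} \<subseteq> {..<n}" and B: "TN_stochastic n B"
  have "(\<lambda>m. word_imm n g (A m) c B) \<longlonglongrightarrow> word_imm n g L c B"
    unfolding word_imm_def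
    by (intro tendsto_sum tendsto_mult tendsto_prod lim tendsto_const)
      (use c in \<open>auto simp: permutes_lessThan image_subset_iff\<close>)
  moreover have "0 \<le> word_imm n g (A m) c B" for m
    using assms(1) c B by (simp add: word_pos_def)
  ultimately show "0 \<le> word_imm n g L c B"
    using LIMSEQ_le_const by blast
qed

subsection \<open>Factorization of totally nonnegative matrices\<close>

text \<open>The left factor \<open>X\<close> is arbitrary, so that a row operation on
  \<open>A\<close> can be carried out as a column operation on \<open>X\<close>.\<close>

definition word_pos_factor :: "nat \<Rightarrow> (nat \<Rightarrow> real) \<Rightarrow> (nat \<Rightarrow> nat \<Rightarrow> real) \<Rightarrow> bool" where
  "word_pos_factor n g A \<longleftrightarrow> (\<forall>X. word_pos n g X \<longrightarrow> word_pos n g (\<lambda>i j. \<Sum>l<n. X i l * A l j))"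

lemma word_pos_factorD:
  "word_pos_factor n g A \<Longrightarrow> word_pos n g X \<Longrightarrow> word_pos n g (\<lambda>i j. \<Sum>l<n. X i l * A l j)"
  by (simp add: word_pos_factor_def)

lemma word_pos_factor_cong:
  assumes "word_pos_factor n g A" "\<And>i j. i < n \<Longrightarrow> j < n \<Longrightarrow> A i j = A' i j"
  shows "word_pos_factor n g A'"
  unfolding word_pos_factor_def
proof (intro allI impI)
  fix X assume "word_pos n g X"
  from word_pos_factorD[OF assms(1) this] show "word_pos n g (\<lambda>i j. \<Sum>l<n. X i l * A' l j)"
    by (rule word_pos_cong) (simp add: assms(2))
qed

lemma word_pos_factor_id: "word_pos_factor n g (\<lambda>i j. if i = j then 1 else 0)"
  unfolding word_pos_factor_def
proof (intro allI impI)
  fix X assume "word_pos n g X"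
  then show "word_pos n g (\<lambda>i j. \<Sum>l<n. X i l * (if l = j then 1 else 0))"
    by (rule word_pos_cong) (simp add: if_distrib cong: if_cong)
qed

lemma word_pos_factor_add_col:
  assumes A: "word_pos_factor n g A" and q: "q < n" "q' < n" "q' = Suc q \<or> q = Suc q'" and t: "0 \<le> t"
  shows "word_pos_factor n g (\<lambda>i j. if j = q then A i q + t * A i q' else A i j)"
  unfolding word_pos_factor_def
proof (intro allI impI)
  fix X assume "word_pos n g X"
  from word_pos_add_col[OF word_pos_factorD[OF A this] q t]
  show "word_pos n g (\<lambda>i j. \<Sum>l<n. X i l * (if j = q then A l q + t * A l q' else A l j))"
    by (rule word_pos_cong) (auto simp: sum_distrib_left sum.distrib algebra_simps)
qed

lemma word_pos_factor_add_row:
  assumes A: "word_pos_factor n g A" and q: "q < n" "q' < n" "q' = Suc q \<or> q = Suc q'" and t: "0 \<le> t"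
  shows "word_pos_factor n g (\<lambda>i j. if i = q then A q j + t * A q' j else A i j)"
  unfolding word_pos_factor_def
proof (intro allI impI)
  fix X assume X: "word_pos n g X"
  \<comment> \<open>Adding a multiple of row \<open>q'\<close> of \<open>A\<close> to row
    \<open>q\<close> amounts to adding that multiple of column \<open>q\<close> of \<open>X\<close>
    to column \<open>q'\<close>: the roles are exchanged.\<close>
  have "q = Suc q' \<or> q' = Suc q" using q(3) by auto
  from word_pos_factorD[OF A word_pos_add_col[OF X q(2,1) this t]]
  show "word_pos n g (\<lambda>i j. \<Sum>l<n. X i l * (if l = q then A q j + t * A q' j else A l j))"
  proof (rule word_pos_cong)
    fix i j
    have "(\<Sum>l<n. (if l = q' then X i q' + t * X i q else X i l) * A l j) =
        (\<Sum>l<n. X i l * A l j + (if l = q' then t * X i q * A q' j else 0))"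
      by (intro sum.cong refl) (simp add: algebra_simps)
    also have "\<dots> = (\<Sum>l<n. X i l * A l j) + t * X i q * A q' j"
      using q(2) by (simp add: sum.distrib)
    also have "\<dots> = (\<Sum>l<n. X i l * A l j + (if l = q then t * X i q * A q' j else 0))"
      using q(1) by (simp add: sum.distrib)
    also have "\<dots> = (\<Sum>l<n. X i l * (if l = q then A q j + t * A q' j else A l j))"
      by (intro sum.cong refl) (simp add: algebra_simps)
    finally show "(\<Sum>l<n. (if l = q' then X i q' + t * X i q else X i l) * A l j) =
        (\<Sum>l<n. X i l * (if l = q then A q j + t * A q' j else A l j))" .
  qed
qed

lemma word_pos_factor_scale_cols:
  assumes A: "word_pos_factor n g A" and d: "\<And>j. j < n \<Longrightarrow> 0 \<le> d j"
  shows "word_pos_factor n g (\<lambda>i j. d j * A i j)"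
  unfolding word_pos_factor_def
proof (intro allI impI)
  fix X assume "word_pos n g X"
  from word_pos_scale_cols[OF word_pos_factorD[OF A this] d]
  show "word_pos n g (\<lambda>i j. \<Sum>l<n. X i l * (d j * A l j))"
    by (rule word_pos_cong) (auto simp: sum_distrib_left algebra_simps)
qed

lemma word_pos_factor_scale_rows:
  assumes A: "word_pos_factor n g A" and d: "\<And>j. j < n \<Longrightarrow> 0 \<le> d j"
  shows "word_pos_factor n g (\<lambda>i j. d i * A i j)"
  unfolding word_pos_factor_def
proof (intro allI impI)
  fix X assume "word_pos n g X"
  from word_pos_factorD[OF A word_pos_scale_cols[OF this d]]
  show "word_pos n g (\<lambda>i j. \<Sum>l<n. X i l * (d l * A l j))"
    by (rule word_pos_cong) (auto simp: sum_distrib_left algebra_simps)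
qed

lemma word_pos_factor_limit:
  assumes "\<And>m. word_pos_factor n g (A m)" and lim: "\<And>i j. i < n \<Longrightarrow> j < n \<Longrightarrow> (\<lambda>m. A m i j) \<longlonglongrightarrow> L i j"
  shows "word_pos_factor n g L"
  unfolding word_pos_factor_def
proof (intro allI impI)
  fix X assume X: "word_pos n g X"
  show "word_pos n g (\<lambda>i j. \<Sum>l<n. X i l * L l j)"
    by (rule word_pos_limit[of n g "\<lambda>m i j. \<Sum>l<n. X i l * A m l j"])
      (auto intro!: tendsto_intros lim word_pos_factorD[OF assms(1) X])
qed

definition embed :: "nat \<Rightarrow> (nat \<Rightarrow> nat \<Rightarrow> real) \<Rightarrow> nat \<Rightarrow> nat \<Rightarrow> real" where
  "embed p S = (\<lambda>i j. if i < p \<or> j < p then if i = j then 1 else 0 else S i j)"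

text \<open>
  Eliminating bottom-up, a zero above a nonzero entry forces the whole row above to vanish, and
  that row may be replaced by a copy of the row below before it is scaled back to zero.
\<close>

lemma TN_row_elimination:
  assumes add: "\<And>S q t. \<lbrakk>R S; p < q; q < n; 0 \<le> t\<rbrakk> \<Longrightarrow>
      R (\<lambda>i j. if i = q then S q j + t * S (q - 1) j else S i j)"
    and zero: "\<And>S q. \<lbrakk>R S; p < q; q < n\<rbrakk> \<Longrightarrow> R (\<lambda>i j. if i = q then 0 else S i j)"
    and cong: "\<And>S S'. R S \<Longrightarrow> (\<And>i j. p \<le> i \<Longrightarrow> i < n \<Longrightarrow> p \<le> j \<Longrightarrow> j < n \<Longrightarrow> S i j = S' i j) \<Longrightarrow> R S'"
    and base: "\<And>S. \<lbrakk>TN {p..<n} {p..<n} S; 0 < S p p; \<And>s. p < s \<Longrightarrow> s < n \<Longrightarrow> S s p = 0\<rbrakk> \<Longrightarrow> R S"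
    and S: "TN {p..<n} {p..<n} S" "0 < S p p" and p: "p < n"
  shows "R S"
proof -
  \<comment> \<open>Here \<open>i\<close> is the last row in which column \<open>p\<close> may still
    be nonzero.\<close>
  have "R S" if "p \<le> i" "i < n" "TN {p..<n} {p..<n} S" "0 < S p p" "\<And>s. i < s \<Longrightarrow> s < n \<Longrightarrow> S s p = 0" for i S
    using that
  proof (induction i arbitrary: S rule: dec_induct)
    case base
    then show ?case using assms(4) by blast
  next
    case (step x)
    let ?y = "Suc x"
    note S = step.prems(2-)
    have x: "p \<le> x" "?y < n" using step by auto
    have adj: "s \<le> x \<or> ?y \<le> s" for s by auto
    show ?case
    proof (cases "S ?y p = 0")
      case True
      have "S s p = 0" if "x < s" "s < n" for s using S(3)[of s] True that by (cases "s = ?y") auto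
      then show ?thesis using step.IH[OF _ S(1,2)] x by auto
    next
      case y0: False
      have ypos: "0 < S ?y p" using TN_nonneg[OF S(1), of ?y p] y0 x by auto
      show ?thesis
      proof (cases "S x p = 0")
        case False
        then have xpos: "0 < S x p" using TN_nonneg[OF S(1), of x p] x by auto
        let ?t = "S ?y p / S x p"
        define S' where "S' = (\<lambda>i j. if i = ?y then S ?y j - ?t * S x j else S i j)"
        have TN': "TN {p..<n} {p..<n} S'"
          unfolding S'_def
          by (rule TN_neville[OF S(1) _ _ _ adj _ _ _ xpos]) (use x S(3) in auto)
        have "R S'"
        proof (rule step.IH[OF _ TN'])
          show "0 < S' p p" using S(2) x by (simp add: S'_def)
          show "S' s p = 0" if "x < s" "s < n" for s
            using that S(3)[of s] xpos by (auto simp: S'_def)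
        qed (use x in auto)
        from add[OF this, of ?y ?t] have "R (\<lambda>i j. if i = ?y then S' ?y j + ?t * S' (?y - 1) j else S' i j)"
          using x xpos ypos by auto
        then show ?thesis by (rule cong) (auto simp: S'_def)
      next
        case x0: True
        then have px: "p < x" using S(2) x by (cases "p = x") auto
        have row0: "S x j = 0" if "p \<le> j" "j < n" for j
        proof -
          have "S ?y p * S x j \<le> S x p * S ?y j"
            by (rule TN_minor2[OF S(1)]) (use x that in auto)
          then have "S x j \<le> 0" using x0 ypos by (simp add: mult_le_0_iff)
          moreover have "0 \<le> S x j" by (rule TN_nonneg[OF S(1)]) (use x that in auto)
          ultimately show ?thesis by simp
        qed
        define C where "C = (\<lambda>i j. S (if i = x then ?y else i) j)"
        have TNC: "TN {p..<n} {p..<n} C"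
          unfolding C_def by (rule TN_reindex[OF S(1), of _ _ _ "\<lambda>j. j"]) (use x in \<open>auto simp: mono_on_def\<close>)
        \<comment> \<open>Rows \<open>x\<close> and \<open>?y\<close> of \<open>C\<close> agree, so
          row \<open>?y\<close> of \<open>S'\<close> is zero. Adding row \<open>x\<close> back
          restores it, and erasing row \<open>x\<close> gives \<open>S\<close> again.\<close>
        define S' where "S' = (\<lambda>i j. if i = ?y then C ?y j - C ?y p / C x p * C x j else C i j)"
        have TN': "TN {p..<n} {p..<n} S'"
          unfolding S'_def
          by (rule TN_neville[OF TNC _ _ _ adj]) (use x S(3) ypos in \<open>auto simp: C_def\<close>)
        have "R S'"
        proof (rule step.IH[OF _ TN'])
          show "0 < S' p p" using S(2) px by (simp add: S'_def C_def)
          show "S' s p = 0" if "x < s" "s < n" for s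
            using that S(3)[of s] ypos by (auto simp: S'_def C_def)
        qed (use x in auto)
        from add[OF this, of ?y 1] have "R (\<lambda>i j. if i = ?y then S' ?y j + 1 * S' (?y - 1) j else S' i j)"
          using x by auto
        from zero[OF this px] have "R (\<lambda>i j. if i = x then 0 else
            if i = ?y then S' ?y j + 1 * S' (?y - 1) j else S' i j)"
          using x by auto
        then show ?thesis by (rule cong) (use row0 ypos in \<open>auto simp: S'_def C_def\<close>)
      qed
    qed
  qed
  from this[of "n - 1" S] S p show ?thesis by auto
qed

text \<open>The entry \<open>(p, p)\<close> can only be the first entry of a minor, since both words
  increase and start at \<open>p\<close> or later. Raising it by \<open>e\<close> adds
  \<open>e\<close> times the minor without the first row and column.\<close>

lemma TN_add_first_corner:
  assumes TN: "TN {p..<n} {p..<n} S" and e: "0 \<le> e"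
  shows "TN {p..<n} {p..<n} (\<lambda>i j. if i = p \<and> j = p then S p p + e else S i j)" (is "TN _ _ ?S")
proof (rule TN_I)
  fix k and r c :: "nat \<Rightarrow> nat"
  assume r: "strict_mono_on {..<k} r" "r ` {..<k} \<subseteq> {p..<n}" and c: "strict_mono_on {..<k} c" "c ` {..<k} \<subseteq> {p..<n}"
  note mr = strict_mono_on_imp_mono_on[OF r(1)] and mc = strict_mono_on_imp_mono_on[OF c(1)]
  have nn: "0 \<le> fdet k (\<lambda>i j. S (r i) (c j))" by (rule TN_D[OF TN mr mc r(2) c(2)])
  have gt: "p < f i" if "strict_mono_on {..<k} f" "f ` {..<k} \<subseteq> {p..<n}" "0 < i" "i < k" for f i
  proof -
    have "f 0 < f i" using strict_mono_onD[OF that(1), of 0 i] that by auto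
    moreover have "f 0 \<in> {p..<n}" using that by (intro subsetD[OF that(2)] imageI) auto
    ultimately show ?thesis by simp
  qed
  show "0 \<le> fdet k (\<lambda>i j. ?S (r i) (c j))"
  proof (cases "0 < k \<and> r 0 = p \<and> c 0 = p")
    case False
    have "fdet k (\<lambda>i j. ?S (r i) (c j)) = fdet k (\<lambda>i j. S (r i) (c j))"
    proof (rule fdet_cong)
      fix i j assume ij: "i < k" "j < k"
      have "\<not> (r i = p \<and> c j = p)"
        using gt[OF r, of i] gt[OF c, of j] ij False by (cases "i = 0"; cases "j = 0") auto
      then show "?S (r i) (c j) = S (r i) (c j)" by auto
    qed
    with nn show ?thesis by simp
  next
    case True
    then obtain k' where k: "k = Suc k'" by (cases k) auto
    have rp: "r i = p \<longleftrightarrow> i = 0" if "i < k" for i using gt[OF r, of i] True that by (cases "i = 0") auto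
    have cp: "c i = p \<longleftrightarrow> i = 0" if "i < k" for i using gt[OF c, of i] True that by (cases "i = 0") auto
    have "fdet k (\<lambda>i j. ?S (r i) (c j)) =
        fdet k (\<lambda>i j. if j = 0 then S (r i) p + e * (if i = 0 then 1 else 0) else S (r i) (c j))"
    proof (rule fdet_cong)
      fix i j assume "i < k" "j < k"
      then show "?S (r i) (c j) = (if j = 0 then S (r i) p + e * (if i = 0 then 1 else 0) else S (r i) (c j))"
        using rp[of i] cp[of j] True by (cases "i = 0"; cases "j = 0") simp_all
    qed
    also have "\<dots> = fdet k (\<lambda>i j. if j = 0 then S (r i) p else S (r i) (c j)) +
        e * fdet k (\<lambda>i j. if j = 0 then if i = 0 then 1 else 0 else S (r i) (c j))"
      using True by (intro fdet_col_add) simp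
    also have "fdet k (\<lambda>i j. if j = 0 then S (r i) p else S (r i) (c j)) = fdet k (\<lambda>i j. S (r i) (c j))"
      using True by (intro fdet_cong) auto
    also have "fdet k (\<lambda>i j. if j = 0 then if i = 0 then 1 else 0 else S (r i) (c j)) =
        fdet k' (\<lambda>i j. S (r (Suc i)) (c (Suc j)))"
      unfolding k by (subst fdet_col_0_single) auto
    finally have eq: "fdet k (\<lambda>i j. ?S (r i) (c j)) =
      fdet k (\<lambda>i j. S (r i) (c j)) + e * fdet k' (\<lambda>i j. S (r (Suc i)) (c (Suc j)))" .
    have "0 \<le> fdet k' (\<lambda>i j. S (r (Suc i)) (c (Suc j)))"
      by (rule TN_D[OF TN]) (use mr mc r(2) c(2) k in \<open>auto simp: mono_on_def image_subset_iff\<close>)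
    then show ?thesis unfolding eq using nn e by simp
  qed
qed

text \<open>Downward induction on \<open>p\<close>, with the identity at \<open>p = n\<close>. Row
  operations clear column \<open>p\<close>, row operations on the transpose clear row
  \<open>p\<close>, and the remaining diagonal entry is a row scaling of the case
  \<open>Suc p\<close>. A zero pivot is reached as a limit of positive ones.\<close>

lemma TN_word_pos_factor:
  assumes "p \<le> n" "TN {p..<n} {p..<n} S"
  shows "word_pos_factor n g (embed p S)"
  using assms
proof (induction p arbitrary: S rule: inc_induct)
  case base
  show ?case
    by (rule word_pos_factor_cong[OF word_pos_factor_id]) (auto simp: embed_def)
next
  case (step p)
  have p: "p < n" using step by simp
  let ?R = "\<lambda>S. word_pos_factor n g (embed p S)"
  have diagonal: "?R S" if S: "TN {p..<n} {p..<n} S" "0 < S p p"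
    "\<And>s. p < s \<Longrightarrow> s < n \<Longrightarrow> S s p = 0" "\<And>s. p < s \<Longrightarrow> s < n \<Longrightarrow> S p s = 0" for S
  proof -
    have "word_pos_factor n g (embed (Suc p) S)"
      by (intro step.IH TN_mono[OF S(1)]) auto
    then have "word_pos_factor n g (\<lambda>i j. (if i = p then S p p else 1) * embed (Suc p) S i j)"
      by (rule word_pos_factor_scale_rows) (use S(2) in auto)
    then show ?thesis
      by (rule word_pos_factor_cong) (use S(3,4) in \<open>auto simp: embed_def less_Suc_eq\<close>)
  qed
  have row0: "?R S" if S: "TN {p..<n} {p..<n} S" "0 < S p p" "\<And>s. p < s \<Longrightarrow> s < n \<Longrightarrow> S s p = 0" for S
  proof -
    \<comment> \<open>\<open>?T\<close> describes the transpose. Its premise records that column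
      \<open>p\<close> of the original is clear; operations on the rows \<open>q > p\<close> of the
      transpose preserve this.\<close>
    let ?T = "\<lambda>S. (\<forall>s. p < s \<longrightarrow> s < n \<longrightarrow> S p s = 0) \<longrightarrow> ?R (\<lambda>i j. S j i)"
    have "?T (\<lambda>i j. S j i)"
    proof (rule TN_row_elimination[where R = ?T and p = p and n = n])
      fix S q t assume *: "?T S" "p < q" "q < n" "0 \<le> (t :: real)"
      let ?S = "\<lambda>i j. if i = q then S q j + t * S (q - 1) j else S i j"
      show "?T ?S"
      proof
        assume "\<forall>s. p < s \<longrightarrow> s < n \<longrightarrow> ?S p s = 0"
        then have "?R (\<lambda>i j. S j i)" using * by auto
        then have "word_pos_factor n g (\<lambda>i j. if j = q then embed p (\<lambda>i j. S j i) i q + t * embed p (\<lambda>i j. S j i) i (q - 1)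
            else embed p (\<lambda>i j. S j i) i j)"
          by (rule word_pos_factor_add_col) (use * in auto)
        then show "?R (\<lambda>i j. ?S j i)"
          by (rule word_pos_factor_cong) (use * in \<open>auto simp: embed_def\<close>)
      qed
    next
      fix S q assume *: "?T S" "p < q" "q < n"
      let ?S = "\<lambda>i j. if i = q then 0 else S i j"
      show "?T ?S"
      proof
        assume "\<forall>s. p < s \<longrightarrow> s < n \<longrightarrow> ?S p s = 0"
        then have "?R (\<lambda>i j. S j i)" using * by auto
        then have "word_pos_factor n g (\<lambda>i j. (if j = q then 0 else 1) * embed p (\<lambda>i j. S j i) i j)"
          by (rule word_pos_factor_scale_cols) auto
        then show "?R (\<lambda>i j. ?S j i)"
          by (rule word_pos_factor_cong) (use * in \<open>auto simp: embed_def\<close>)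
      qed
    next
      fix S S' assume *: "?T S" "\<And>i j. p \<le> i \<Longrightarrow> i < n \<Longrightarrow> p \<le> j \<Longrightarrow> j < n \<Longrightarrow> S i j = S' i j"
      show "?T S'"
      proof
        assume "\<forall>s. p < s \<longrightarrow> s < n \<longrightarrow> S' p s = 0"
        then have "?R (\<lambda>i j. S j i)" using * p by auto
        then show "?R (\<lambda>i j. S' j i)"
          by (rule word_pos_factor_cong) (use * in \<open>auto simp: embed_def\<close>)
      qed
    next
      fix S assume *: "TN {p..<n} {p..<n} S" "0 < S p p" "\<And>s. p < s \<Longrightarrow> s < n \<Longrightarrow> S s p = 0"
      show "?T S"
      proof
        assume z: "\<forall>s. p < s \<longrightarrow> s < n \<longrightarrow> S p s = 0"
        show "?R (\<lambda>i j. S j i)"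
          by (rule diagonal[OF TN_transpose[OF *(1)]]) (use *(2,3) z in simp_all)
      qed
    next
      show "TN {p..<n} {p..<n} (\<lambda>i j. S j i)" by (rule TN_transpose[OF S(1)])
    qed (use S(2) p in simp_all)
    then show ?thesis using S(3) by auto
  qed
  have pos: "?R S" if S: "TN {p..<n} {p..<n} S" "0 < S p p" for S
  proof (rule TN_row_elimination[where R = ?R and p = p and n = n])
    fix S q t assume *: "?R S" "p < q" "q < n" "0 \<le> (t :: real)"
    then have "word_pos_factor n g (\<lambda>i j. if i = q then embed p S q j + t * embed p S (q - 1) j else embed p S i j)"
      by (intro word_pos_factor_add_row) auto
    then show "?R (\<lambda>i j. if i = q then S q j + t * S (q - 1) j else S i j)"
      by (rule word_pos_factor_cong) (use * in \<open>auto simp: embed_def\<close>)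
  next
    fix S q assume *: "?R S" "p < q" "q < n"
    then have "word_pos_factor n g (\<lambda>i j. (if i = q then 0 else 1) * embed p S i j)"
      by (intro word_pos_factor_scale_rows) auto
    then show "?R (\<lambda>i j. if i = q then 0 else S i j)"
      by (rule word_pos_factor_cong) (use * in \<open>auto simp: embed_def\<close>)
  next
    fix S S' assume *: "?R S" "\<And>i j. p \<le> i \<Longrightarrow> i < n \<Longrightarrow> p \<le> j \<Longrightarrow> j < n \<Longrightarrow> S i j = S' i j"
    show "?R S'"
      by (rule word_pos_factor_cong[OF *(1)]) (use *(2) in \<open>auto simp: embed_def\<close>)
  qed (use S p row0 in auto)
  \<comment> \<open>The pivot may be zero; raising it by \<open>1 / real (Suc m)\<close> keeps total
    nonnegativity and makes it positive.\<close>
  let ?S = "\<lambda>m i j. if i = p \<and> j = p then S p p + 1 / real (Suc m) else S i j"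
  have Spp: "0 \<le> S p p" using TN_nonneg[OF step.prems, of p p] p by simp
  have "?R (?S m)" for m
    using Spp by (intro pos TN_add_first_corner step.prems) (auto intro: add_nonneg_pos)
  then show ?case
  proof (rule word_pos_factor_limit)
    fix i j
    have "(\<lambda>m. S p p + 1 / real (Suc m)) \<longlonglongrightarrow> S p p + 0"
      by (intro tendsto_add tendsto_const LIMSEQ_Suc[OF lim_1_over_n])
    then show "(\<lambda>m. embed p (?S m) i j) \<longlonglongrightarrow> embed p S i j"
      by (cases "i = p \<and> j = p") (auto simp: embed_def)
  qed
qed

theorem TN_imp_word_pos:
  assumes "TN {..<n} {..<n} A" and "\<And>B. TN_stochastic n B \<Longrightarrow> 0 \<le> minor_comb n g B"
  shows "word_pos n g A"
proof -
  have "word_pos_factor n g (embed 0 A)"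
    using assms(1) by (intro TN_word_pos_factor) (auto simp: lessThan_atLeast0)
  from word_pos_factorD[OF this word_pos_id[OF assms(2)]] show ?thesis
    by (rule word_pos_cong) (auto simp: embed_def if_distrib[of "\<lambda>x. x * _"] cong: if_cong)
qed

subsection \<open>Traces on left ideals of the group algebra\<close>

lemma sum_fun_apply: "(\<Sum>a\<in>S. f a) x = (\<Sum>a\<in>S. f a x)"
  by (induction S rule: infinite_finite_induct) auto

text \<open>The right-hand side is the trace of \<open>L \<circ> pr\<close> on all functions
  supported in \<open>S\<close>, in the basis of point functions. Expanding the chosen basis
  \<open>B\<close> of \<open>V\<close> in point functions and summing over \<open>B\<close> first
  gives a value independent of the choice made in \<open>trace_on\<close>.\<close>

lemma trace_on_projection:
  fixes pr L :: "('a \<Rightarrow> real) \<Rightarrow> 'a \<Rightarrow> real"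
  assumes S: "finite S"
    and pr: "Vector_Spaces.linear fscale fscale pr" and L: "Vector_Spaces.linear fscale fscale L"
    and V: "V = pr ` {f. \<forall>x. x \<notin> S \<longrightarrow> f x = 0}" "\<And>f. f \<in> V \<Longrightarrow> pr f = f"
      "\<And>f x. f \<in> V \<Longrightarrow> x \<notin> S \<Longrightarrow> f x = 0" "\<And>f. f \<in> V \<Longrightarrow> L f \<in> V"
  shows "trace_on V L = (\<Sum>u\<in>S. L (pr (\<lambda>x. if x = u then 1 else 0)) u)"
proof -
  let ?W = "{f :: 'a \<Rightarrow> real. \<forall>x. x \<notin> S \<longrightarrow> f x = 0}"
  let ?d = "\<lambda>u x. if x = u then 1 else 0 :: real"
  interpret pr: Vector_Spaces.linear fscale fscale pr by (rule pr)
  interpret L: Vector_Spaces.linear fscale fscale L by (rule L)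
  have expand: "f = (\<Sum>u\<in>S. fscale (f u) (?d u))" if "f \<in> ?W" for f
  proof
    fix x
    have "(\<Sum>u\<in>S. f u * ?d u x) = (\<Sum>u\<in>S. if u = x then f x else 0)"
      by (intro sum.cong) auto
    then show "f x = (\<Sum>u\<in>S. fscale (f u) (?d u)) x"
      using S that by (simp add: sum_fun_apply fscale_def)
  qed
  have dW: "?d u \<in> ?W" if "u \<in> S" for u using that by auto
  have "fun_vs.subspace ?W"
    by (auto simp: fun_vs.subspace_def fscale_def)
  then have sub: "fun_vs.subspace V"
    unfolding V(1) by (rule pr.subspace_image)
  have exB: "\<exists>B. fun_vs.independent B \<and> fun_vs.span B = V"
  proof -
    obtain B where B: "B \<subseteq> V" "fun_vs.independent B" "V \<subseteq> fun_vs.span B"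
      using fun_vs.maximal_independent_subset by blast
    then show ?thesis using fun_vs.span_minimal[OF B(1) sub] by blast
  qed
  define B where "B = (SOME B. fun_vs.independent B \<and> fun_vs.span B = V)"
  have B: "fun_vs.independent B" "fun_vs.span B = V"
    using someI_ex[OF exB] unfolding B_def by blast+
  have BV: "B \<subseteq> V" using B(2) fun_vs.span_superset by blast
  have VW: "V \<subseteq> ?W" using V(3) by blast
  have "V \<subseteq> fun_vs.span (?d ` S)"
  proof
    fix f assume "f \<in> V"
    then have "f = (\<Sum>u\<in>S. fscale (f u) (?d u))" using VW expand by blast
    also have "\<dots> \<in> fun_vs.span (?d ` S)"
      by (intro fun_vs.span_sum fun_vs.span_scale fun_vs.span_base) auto
    finally show "f \<in> fun_vs.span (?d ` S)" .
  qed
  with BV have "B \<subseteq> fun_vs.span (?d ` S)" by (rule subset_trans)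
  then have finB: "finite B"
    using fun_vs.independent_span_bound[OF finite_imageI[OF S] B(1)] by blast
  have vV: "L (pr (?d u)) \<in> V" if "u \<in> S" for u
  proof -
    have "pr (?d u) \<in> V" unfolding V(1) using dW[OF that] by (rule imageI)
    then show ?thesis by (rule V(4))
  qed
  have rep: "fun_vs.representation B (L b) b = (\<Sum>u\<in>S. b u * fun_vs.representation B (L (pr (?d u))) b)"
    if "b \<in> B" for b
  proof -
    have bV: "b \<in> V" using that BV by blast
    have "L b = L (pr (\<Sum>u\<in>S. fscale (b u) (?d u)))"
      using expand[of b] V(2)[OF bV] bV VW by auto
    also have "\<dots> = (\<Sum>u\<in>S. fscale (b u) (L (pr (?d u))))"
      by (simp add: pr.sum pr.scale L.sum L.scale)
    finally have "fun_vs.representation B (L b) = fun_vs.representation B (\<Sum>u\<in>S. fscale (b u) (L (pr (?d u))))"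
      by simp
    also have "\<dots> = (\<lambda>c. \<Sum>u\<in>S. fun_vs.representation B (fscale (b u) (L (pr (?d u)))) c)"
      using vV B by (intro fun_vs.representation_sum) (auto intro: fun_vs.span_scale)
    finally have "fun_vs.representation B (L b) b =
        (\<Sum>u\<in>S. fun_vs.representation B (fscale (b u) (L (pr (?d u)))) b)" by simp
    also have "\<dots> = (\<Sum>u\<in>S. b u * fun_vs.representation B (L (pr (?d u))) b)"
      using vV B by (intro sum.cong refl) (simp add: fun_vs.representation_scale)
    finally show ?thesis .
  qed
  have "trace_on V L = (\<Sum>b\<in>B. fun_vs.representation B (L b) b)"
    by (simp add: trace_on_def B_def Let_def)
  also have "\<dots> = (\<Sum>b\<in>B. \<Sum>u\<in>S. b u * fun_vs.representation B (L (pr (?d u))) b)"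
    using rep by simp
  also have "\<dots> = (\<Sum>u\<in>S. \<Sum>b\<in>B. b u * fun_vs.representation B (L (pr (?d u))) b)"
    by (rule sum.swap)
  also have "\<dots> = (\<Sum>u\<in>S. L (pr (?d u)) u)"
  proof (intro sum.cong refl)
    fix u assume u: "u \<in> S"
    have "(\<Sum>b\<in>B. fscale (fun_vs.representation B (L (pr (?d u))) b) b) = L (pr (?d u))"
      using vV[OF u] B finB by (intro fun_vs.sum_representation_eq) auto
    then have "(\<Sum>b\<in>B. fscale (fun_vs.representation B (L (pr (?d u))) b) b) u = L (pr (?d u)) u"
      by simp
    then show "(\<Sum>b\<in>B. b u * fun_vs.representation B (L (pr (?d u))) b) = L (pr (?d u)) u"
      by (simp add: sum_fun_apply fscale_def mult.commute)
  qed
  finally show ?thesis .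
qed

abbreviation pinv :: "('a \<Rightarrow> 'a) \<Rightarrow> 'a \<Rightarrow> 'a" where
  "pinv u \<equiv> inv_into UNIV u"

lemma permutes_inv_comp: "p permutes S \<Longrightarrow> pinv p \<circ> p = id" "p permutes S \<Longrightarrow> p \<circ> pinv p = id"
  by (rule permutes_inv_o; assumption)+

lemma permutes_comp_iff:
  assumes "p permutes S"
  shows "u \<circ> p permutes S \<longleftrightarrow> u permutes S"
proof -
  have "(u \<circ> p) \<circ> pinv p = u"
    using permutes_inverses[OF assms] by (auto simp: fun_eq_iff)
  then show ?thesis
    using permutes_compose[OF assms] permutes_compose[OF permutes_inv[OF assms]] by metis
qed

lemma ga_mult_eq:
  "w permutes {0..<n} \<Longrightarrow> ga_mult n f g w = (\<Sum>u | u permutes {0..<n}. f u * g (pinv u \<circ> w))"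
  by (simp add: ga_mult_def)

lemma ga_mult_assoc: "ga_mult n (ga_mult n f g) h = ga_mult n f (ga_mult n g h)"
proof
  fix w
  let ?S = "{u. u permutes {0..<n}}"
  show "ga_mult n (ga_mult n f g) h w = ga_mult n f (ga_mult n g h) w"
  proof (cases "w permutes {0..<n}")
    case True
    have "ga_mult n (ga_mult n f g) h w = (\<Sum>u\<in>?S. \<Sum>v\<in>?S. f v * g (pinv v \<circ> u) * h (pinv u \<circ> w))"
      unfolding ga_mult_eq[OF True] by (intro sum.cong refl) (simp add: ga_mult_eq sum_distrib_right)
    also have "\<dots> = (\<Sum>v\<in>?S. \<Sum>u\<in>?S. f v * g (pinv v \<circ> u) * h (pinv u \<circ> w))"
      by (rule sum.swap)
    also have "\<dots> = (\<Sum>v\<in>?S. f v * ga_mult n g h (pinv v \<circ> w))"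
    proof (intro sum.cong refl)
      fix v assume "v \<in> ?S"
      then have v: "v permutes {0..<n}" by simp
      have vw: "pinv v \<circ> w permutes {0..<n}" by (rule permutes_compose[OF True permutes_inv[OF v]])
      have "(\<Sum>u\<in>?S. f v * g (pinv v \<circ> u) * h (pinv u \<circ> w)) =
          (\<Sum>u\<in>?S. f v * g (pinv v \<circ> (v \<circ> u)) * h (pinv (v \<circ> u) \<circ> w))"
        by (rule setum_permutations_compose_left[OF v])
      also have "\<dots> = (\<Sum>u\<in>?S. f v * (g u * h (pinv u \<circ> (pinv v \<circ> w))))"
      proof (intro sum.cong refl)
        fix u assume "u \<in> ?S"
        then have u: "u permutes {0..<n}" by simp
        have "pinv (v \<circ> u) = pinv u \<circ> pinv v"
          using permutes_bij[OF u] permutes_bij[OF v] by (intro o_inv_distrib)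
        moreover have "pinv v \<circ> (v \<circ> u) = u"
          using permutes_inv_comp(1)[OF v] by (simp flip: o_assoc add: o_assoc)
        ultimately show "f v * g (pinv v \<circ> (v \<circ> u)) * h (pinv (v \<circ> u) \<circ> w) =
            f v * (g u * h (pinv u \<circ> (pinv v \<circ> w)))"
          by (simp add: o_assoc)
      qed
      finally show "(\<Sum>u\<in>?S. f v * g (pinv v \<circ> u) * h (pinv u \<circ> w)) = f v * ga_mult n g h (pinv v \<circ> w)"
        by (simp add: ga_mult_eq[OF vw] sum_distrib_left)
    qed
    finally show ?thesis by (simp add: ga_mult_eq[OF True])
  qed (simp add: ga_mult_def)
qed

lemma linear_ga_mult_left: "Vector_Spaces.linear fscale fscale (\<lambda>f. ga_mult n f g)"
  by unfold_locales
    (auto simp: ga_mult_def fscale_def fun_eq_iff sum.distrib sum_distrib_left algebra_simps)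

lemma linear_ga_mult_right: "Vector_Spaces.linear fscale fscale (\<lambda>g. ga_mult n f g)"
  by unfold_locales
    (auto simp: ga_mult_def fscale_def fun_eq_iff sum.distrib sum_distrib_left algebra_simps)

lemma ga_mult_scale_right: "ga_mult n f (\<lambda>w. a * g w) = ga_mult n (\<lambda>w. a * f w) g"
  by (auto simp: ga_mult_def fun_eq_iff mult_ac)

lemma ga_basis_mult:
  assumes "u permutes {0..<n}" "x permutes {0..<n}"
  shows "ga_mult n (ga_basis u) g x = g (pinv u \<circ> x)"
proof -
  have "ga_mult n (ga_basis u) g x =
      (\<Sum>v | v permutes {0..<n}. if v = u then g (pinv u \<circ> x) else 0)"
    unfolding ga_mult_eq[OF assms(2)] by (intro sum.cong) (auto simp: ga_basis_def)
  then show ?thesis using assms(1) by (simp add: finite_permutations)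
qed

text \<open>Right multiplication by \<open>c / a\<close> is a projection onto the Specht module.
  Composed with left multiplication by \<open>w\<close>, its trace sums the coefficients of
  \<open>u\<close> in the product of \<open>w\<close>, \<open>u\<close> and \<open>c / a\<close>,
  which are values of \<open>c / a\<close> at conjugates of the inverse of \<open>w\<close>.\<close>

theorem irr_char_quasi_idempotent:
  fixes sh :: "nat list"
  defines "n \<equiv> sum_list sh" and "c \<equiv> young_symmetrizer sh"
  assumes idem: "ga_mult n c c = (\<lambda>w. a * c w)" and a: "a \<noteq> 0" and w: "w permutes {0..<n}"
  shows "irr_char sh w = (\<Sum>u | u permutes {0..<n}. c (pinv u \<circ> (pinv w \<circ> u))) / a"
proof -
  let ?S = "{u. u permutes {0..<n}}"
  let ?W = "{f :: (nat \<Rightarrow> nat) \<Rightarrow> real. \<forall>x. x \<notin> ?S \<longrightarrow> f x = 0}"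
  let ?c = "\<lambda>w. c w / a"
  let ?pr = "\<lambda>f. ga_mult n f ?c"
  let ?L = "ga_mult n (ga_basis w)"
  have cc: "ga_mult n f c = ga_mult n (\<lambda>w. a * f w) ?c" for f
    using ga_mult_scale_right[of n f a ?c] a by simp
  have V: "specht_module sh = ?pr ` ?W"
  proof -
    have "specht_module sh = (\<lambda>f. ga_mult n f c) ` ?W"
      by (simp add: specht_module_def group_algebra_def n_def c_def)
    also have "\<dots> = ?pr ` ?W"
    proof (intro equalityI subsetI)
      fix h assume "h \<in> (\<lambda>f. ga_mult n f c) ` ?W"
      then obtain f where "f \<in> ?W" "h = ga_mult n f c" by blast
      then show "h \<in> ?pr ` ?W"
        unfolding cc by (intro image_eqI[of _ _ "\<lambda>w. a * f w"]) auto
    next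
      fix h assume "h \<in> ?pr ` ?W"
      then obtain f where f: "f \<in> ?W" "h = ga_mult n f ?c" by blast
      then have "h = ga_mult n (\<lambda>w. f w / a) c" unfolding cc using a by simp
      with f(1) show "h \<in> (\<lambda>f. ga_mult n f c) ` ?W"
        by (intro image_eqI[of _ _ "\<lambda>w. f w / a"]) auto
    qed
    finally show ?thesis .
  qed
  have cidem: "ga_mult n ?c ?c = ?c"
  proof -
    have "ga_mult n ?c ?c = ga_mult n (\<lambda>w. (1 / a) * (1 / a * c w)) c"
      using ga_mult_scale_right[of n ?c "1 / a" c] by simp
    also have "\<dots> = fscale (1 / a * (1 / a)) (ga_mult n c c)"
      by (simp add: ga_mult_def fscale_def fun_eq_iff sum_distrib_left sum_divide_distrib mult_ac)
    also have "\<dots> = ?c" unfolding idem using a by (auto simp: fscale_def)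
    finally show ?thesis .
  qed
  have out: "ga_mult n f g x = 0" if "x \<notin> ?S" for f g x using that by (simp add: ga_mult_def)
  have "irr_char sh w = trace_on (specht_module sh) ?L"
    by (simp add: irr_char_def n_def)
  also have "\<dots> = (\<Sum>u\<in>?S. ?L (?pr (\<lambda>x. if x = u then 1 else 0)) u)"
  proof (rule trace_on_projection[OF _ linear_ga_mult_left linear_ga_mult_right V])
    show "finite ?S" by (simp add: finite_permutations)
  next
    fix f assume "f \<in> specht_module sh"
    then obtain h where "h \<in> ?W" "f = ?pr h" unfolding V by blast
    then show "?pr f = f" by (simp add: ga_mult_assoc cidem)
  next
    fix f x assume "f \<in> specht_module sh" "x \<notin> ?S"
    then show "f x = 0" unfolding V using out by auto
  next
    fix f assume "f \<in> specht_module sh"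
    then obtain h where "h \<in> ?W" "f = ?pr h" unfolding V by blast
    then have "?L f = ?pr (?L h)" by (simp add: ga_mult_assoc)
    then show "?L f \<in> specht_module sh" unfolding V using out by blast
  qed
  also have "\<dots> = (\<Sum>u\<in>?S. c (pinv u \<circ> (pinv w \<circ> u)) / a)"
  proof (intro sum.cong refl)
    fix u assume "u \<in> ?S"
    then have u: "u permutes {0..<n}" by simp
    have wu: "pinv w \<circ> u permutes {0..<n}" by (rule permutes_compose[OF u permutes_inv[OF w]])
    have "(\<lambda>x. if x = u then 1 else 0) = ga_basis u" by (simp add: ga_basis_def)
    then show "?L (?pr (\<lambda>x. if x = u then 1 else 0)) u = c (pinv u \<circ> (pinv w \<circ> u)) / a"
      by (simp add: ga_basis_mult[OF w u] ga_basis_mult[OF u wu])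
  qed
  finally show ?thesis by (simp add: sum_divide_distrib)
qed

subsection \<open>The Young symmetrizer of a hook\<close>

lemma tableau_row_ones: "y < m \<Longrightarrow> tableau_row (replicate m 1) y = y"
proof (induction m arbitrary: y)
  case (Suc m)
  then show ?case by (cases y) auto
qed simp

lemma tableau_col_ones: "y < m \<Longrightarrow> tableau_col (replicate m 1) y = 0"
proof (induction m arbitrary: y)
  case (Suc m)
  then show ?case by (cases y) auto
qed simp

lemma permutes_disjoint_commute:
  assumes "p permutes A" "q permutes B" "A \<inter> B = {}"
  shows "p \<circ> q = q \<circ> p"
proof
  fix x
  consider "x \<in> A" | "x \<in> B" | "x \<notin> A" "x \<notin> B" by blast
  then show "(p \<circ> q) x = (q \<circ> p) x"
  proof cases
    case 1
    then have "p x \<in> A" using permutes_in_image[OF assms(1)] by simp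
    then have "q x = x" "q (p x) = p x" using 1 assms(3) permutes_not_in[OF assms(2)] by blast+
    then show ?thesis by simp
  next
    case 2
    then have "q x \<in> B" using permutes_in_image[OF assms(2)] by simp
    then have "p x = x" "p (q x) = q x" using 2 assms(3) permutes_not_in[OF assms(1)] by blast+
    then show ?thesis by simp
  next
    case 3
    then show ?thesis using permutes_not_in[OF assms(1)] permutes_not_in[OF assms(2)] by simp
  qed
qed

lemma sign_comp:
  "p permutes A \<Longrightarrow> q permutes B \<Longrightarrow> finite A \<Longrightarrow> finite B \<Longrightarrow> sign (p \<circ> q) = sign p * sign q"
  by (intro sign_compose permutes_imp_permutation)

lemma sign_inv: "p permutes A \<Longrightarrow> finite A \<Longrightarrow> sign (pinv p) = sign p"
  by (intro sign_inverse permutes_imp_permutation)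

lemma permutes_o_inv: "p permutes A \<Longrightarrow> q permutes B \<Longrightarrow> pinv (p \<circ> q) = pinv q \<circ> pinv p"
  by (intro o_inv_distrib permutes_bij)

lemma permutes_inv_o_o:
  "p permutes S \<Longrightarrow> pinv p \<circ> (p \<circ> u) = u" "p permutes S \<Longrightarrow> p \<circ> (pinv p \<circ> u) = u"
  by (auto simp: fun_eq_iff permutes_inverses)

locale hook_shape =
  fixes n k :: nat
  assumes k: "0 < k" "k \<le> n"
begin

abbreviation Row :: "nat set" where "Row \<equiv> {0..<k}"
abbreviation Col :: "nat set" where "Col \<equiv> insert 0 {k..<n}"
abbreviation ysym :: "(nat \<Rightarrow> nat) \<Rightarrow> real" where "ysym \<equiv> young_symmetrizer (hook n k)"

lemma sum_list_hook: "sum_list (hook n k) = n"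
  using k by (simp add: hook_def sum_list_replicate)

lemma Row_Col: "Row \<subseteq> {0..<n}" "Col \<subseteq> {0..<n}" "Row \<inter> Col = {0}"
  using k by auto

lemma tableau_row_hook: "x < n \<Longrightarrow> tableau_row (hook n k) x = (if x < k then 0 else Suc (x - k))"
  using tableau_row_ones[of "x - k" "n - k"] by (simp add: hook_def)

lemma tableau_col_hook: "x < n \<Longrightarrow> tableau_col (hook n k) x = (if x < k then x else 0)"
  using tableau_col_ones[of "x - k" "n - k"] by (simp add: hook_def)

text \<open>Every row of the hook except the first is a single letter and hence fixed; the columns
  behave in the same way in \<open>column_group_hook\<close>.\<close>

lemma row_group_hook: "row_group (hook n k) = {p. p permutes Row}"
proof (intro equalityI subsetI)
  fix p assume "p \<in> row_group (hook n k)"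
  then have p: "p permutes {0..<n}" "\<And>x. x < n \<Longrightarrow> tableau_row (hook n k) (p x) = tableau_row (hook n k) x"
    by (auto simp: row_group_def sum_list_hook)
  have "p permutes Row"
  proof (rule permutes_superset[OF p(1)])
    fix x assume "x \<in> {0..<n} - Row"
    then have x: "x < n" "k \<le> x" by auto
    moreover have "p x < n" using permutes_in_image[OF p(1), of x] x by simp
    ultimately show "p x = x" using p(2)[of x] by (auto simp: tableau_row_hook split: if_splits)
  qed
  then show "p \<in> {p. p permutes Row}" by simp
next
  fix p assume "p \<in> {p. p permutes Row}"
  then have p: "p permutes Row" by simp
  have pn: "p permutes {0..<n}" by (rule permutes_subset[OF p Row_Col(1)])
  have "tableau_row (hook n k) (p x) = tableau_row (hook n k) x" if "x < n" for x
  proof (cases "x < k")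
    case True
    then have "p x < k" using permutes_in_image[OF p, of x] by simp
    with True k show ?thesis by (simp add: tableau_row_hook)
  qed (simp add: permutes_not_in[OF p])
  with pn show "p \<in> row_group (hook n k)" by (simp add: row_group_def sum_list_hook)
qed

lemma column_group_hook: "column_group (hook n k) = {q. q permutes Col}"
proof (intro equalityI subsetI)
  fix q assume "q \<in> column_group (hook n k)"
  then have q: "q permutes {0..<n}" "\<And>x. x < n \<Longrightarrow> tableau_col (hook n k) (q x) = tableau_col (hook n k) x"
    by (auto simp: column_group_def sum_list_hook)
  have "q permutes Col"
  proof (rule permutes_superset[OF q(1)])
    fix x assume "x \<in> {0..<n} - Col"
    then have x: "x < n" "0 < x" "x < k" by auto
    moreover have "q x < n" using permutes_in_image[OF q(1), of x] x by simp
    ultimately show "q x = x" using q(2)[of x] by (auto simp: tableau_col_hook split: if_splits)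
  qed
  then show "q \<in> {q. q permutes Col}" by simp
next
  fix q assume "q \<in> {q. q permutes Col}"
  then have q: "q permutes Col" by simp
  have qn: "q permutes {0..<n}" by (rule permutes_subset[OF q Row_Col(2)])
  have z: "tableau_col (hook n k) x = 0" if "x \<in> Col" for x
    using that k by (auto simp: tableau_col_hook)
  have "tableau_col (hook n k) (q x) = tableau_col (hook n k) x" if "x < n" for x
    using z[of x] z[of "q x"] permutes_in_image[OF q, of x] permutes_not_in[OF q, of x]
    by (cases "x \<in> Col") auto
  with qn show "q \<in> column_group (hook n k)" by (simp add: column_group_def sum_list_hook)
qed

lemma fin_RC: "finite Row" "finite Col" by auto

lemma Row_perm: "p permutes Row \<Longrightarrow> p permutes {0..<n}"
  by (rule permutes_subset[OF _ Row_Col(1)])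

lemma Col_perm: "q permutes Col \<Longrightarrow> q permutes {0..<n}"
  by (rule permutes_subset[OF _ Row_Col(2)])

lemma ysym_eq:
  assumes w: "w permutes {0..<n}"
  shows "ysym w = (\<Sum>p | p permutes Row. if pinv p \<circ> w permutes Col then of_int (sign (pinv p \<circ> w)) else 0)"
proof -
  have "ysym w = (\<Sum>p | p permutes {0..<n}. if p \<in> {p. p permutes Row}
      then if pinv p \<circ> w permutes Col then of_int (sign (pinv p \<circ> w)) else 0 else 0)"
    unfolding young_symmetrizer_def sum_list_hook ga_mult_eq[OF w] row_group_hook column_group_hook
    by (intro sum.cong) auto
  also have "\<dots> = (\<Sum>p\<in>{p. p permutes {0..<n}} \<inter> {p. p permutes Row}.
      if pinv p \<circ> w permutes Col then of_int (sign (pinv p \<circ> w)) else 0)"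
    by (rule sum.inter_restrict[symmetric]) (simp add: finite_permutations)
  also have "{p. p permutes {0..<n}} \<inter> {p. p permutes Row} = {p. p permutes Row}"
    using Row_perm by auto
  finally show ?thesis .
qed

lemma ysym_outside: "\<not> w permutes {0..<n} \<Longrightarrow> ysym w = 0"
  by (simp add: young_symmetrizer_def ga_mult_def sum_list_hook)

lemma ysym_left:
  assumes p: "p permutes Row" and w: "w permutes {0..<n}"
  shows "ysym (p \<circ> w) = ysym w"
proof -
  have pw: "p \<circ> w permutes {0..<n}" by (rule permutes_compose[OF w Row_perm[OF p]])
  let ?s = "\<lambda>v. if v permutes Col then of_int (sign v) else 0 :: real"
  have "ysym (p \<circ> w) = (\<Sum>p' | p' permutes Row. ?s (pinv p' \<circ> (p \<circ> w)))"
    by (rule ysym_eq[OF pw])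
  also have "\<dots> = (\<Sum>p' | p' permutes Row. ?s (pinv (p \<circ> p') \<circ> (p \<circ> w)))"
    by (rule setum_permutations_compose_left[OF p])
  also have "\<dots> = (\<Sum>p' | p' permutes Row. ?s (pinv p' \<circ> w))"
  proof (intro sum.cong refl)
    fix p' assume "p' \<in> {p'. p' permutes Row}"
    then have "pinv (p \<circ> p') \<circ> (p \<circ> w) = pinv p' \<circ> w"
      using p by (simp add: permutes_o_inv comp_assoc permutes_inv_o_o)
    then show "?s (pinv (p \<circ> p') \<circ> (p \<circ> w)) = ?s (pinv p' \<circ> w)" by simp
  qed
  finally show ?thesis by (simp add: ysym_eq[OF w])
qed

lemma ysym_right:
  assumes q: "q permutes Col" and w: "w permutes {0..<n}"
  shows "ysym (w \<circ> q) = of_int (sign q) * ysym w"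
proof -
  have wq: "w \<circ> q permutes {0..<n}" by (rule permutes_compose[OF Col_perm[OF q] w])
  show ?thesis
    unfolding ysym_eq[OF w] ysym_eq[OF wq] sum_distrib_left
  proof (intro sum.cong refl)
    fix p assume "p \<in> {p. p permutes Row}"
    have "(pinv p \<circ> w) \<circ> q permutes Col \<longleftrightarrow> pinv p \<circ> w permutes Col"
      by (rule permutes_comp_iff[OF q])
    moreover have "sign ((pinv p \<circ> w) \<circ> q) = sign (pinv p \<circ> w) * sign q" if "pinv p \<circ> w permutes Col"
      using that q fin_RC by (intro sign_comp)
    ultimately show "(if pinv p \<circ> (w \<circ> q) permutes Col then of_int (sign (pinv p \<circ> (w \<circ> q))) else 0) =
        of_int (sign q) * (if pinv p \<circ> w permutes Col then of_int (sign (pinv p \<circ> w)) else 0 :: real)"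
      by (simp add: o_assoc)
  qed
qed

lemma Row_Col_id: "p permutes Row \<Longrightarrow> p permutes Col \<Longrightarrow> p = id"
proof -
  assume p: "p permutes Row" "p permutes Col"
  have "p permutes {0}"
    by (rule permutes_superset[OF p(1)]) (use permutes_not_in[OF p(2)] Row_Col(3) in auto)
  then show "p = id" by simp
qed

lemma ysym_id: "ysym id = 1"
proof -
  have "ysym id = (\<Sum>p | p permutes Row. if p = id then 1 else 0)"
    unfolding ysym_eq[OF permutes_id]
  proof (intro sum.cong refl)
    fix p assume "p \<in> {p. p permutes Row}"
    then have p: "p permutes Row" by simp
    have "pinv p permutes Col \<longleftrightarrow> p = id"
    proof
      assume "pinv p permutes Col"
      then have "pinv p = id" using Row_Col_id permutes_inv[OF p] by blast
      then show "p = id" using permutes_inv_comp(2)[OF p] by simp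
    qed (simp add: permutes_id inv_id)
    then show "(if pinv p \<circ> id permutes Col then of_int (sign (pinv p \<circ> id)) else 0) = (if p = id then 1 else 0 :: real)"
      by (simp add: inv_id)
  qed
  also have "\<dots> = 1" by (simp add: finite_permutations)
  finally show ?thesis .
qed

lemma ysym_prod: "p permutes Row \<Longrightarrow> q permutes Col \<Longrightarrow> ysym (p \<circ> q) = of_int (sign q)"
  using ysym_left[OF _ Col_perm, of p q] ysym_right[of q id] ysym_id permutes_id by simp

lemma ysym_nonzero:
  assumes w: "w permutes {0..<n}" and nz: "ysym w \<noteq> 0"
  obtains p q where "p permutes Row" "q permutes Col" "w = p \<circ> q"
proof -
  obtain p where p: "p permutes Row" "pinv p \<circ> w permutes Col"
    using nz unfolding ysym_eq[OF w] by (auto elim!: sum.not_neutral_contains_not_neutral split: if_splits)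
  moreover have "w = p \<circ> (pinv p \<circ> w)" by (rule permutes_inv_o_o(2)[OF p(1), symmetric])
  ultimately show thesis using that by blast
qed

lemma ysym_sum:
  "(\<Sum>u | u permutes {0..<n}. ysym u * f u) =
    (\<Sum>p | p permutes Row. \<Sum>q | q permutes Col. of_int (sign q) * f (p \<circ> q))"
proof -
  let ?S = "{u. u permutes {0..<n}}"
  let ?s = "\<lambda>v. if v permutes Col then of_int (sign v) else 0 :: real"
  have "(\<Sum>u\<in>?S. ysym u * f u) = (\<Sum>u\<in>?S. \<Sum>p | p permutes Row. ?s (pinv p \<circ> u) * f u)"
    by (intro sum.cong refl) (simp add: ysym_eq sum_distrib_right)
  also have "\<dots> = (\<Sum>p | p permutes Row. \<Sum>u\<in>?S. ?s (pinv p \<circ> u) * f u)"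
    by (rule sum.swap)
  also have "\<dots> = (\<Sum>p | p permutes Row. \<Sum>q | q permutes Col. of_int (sign q) * f (p \<circ> q))"
  proof (rule sum.cong[OF refl])
    fix p assume "p \<in> {p. p permutes Row}"
    then have p: "p permutes Row" by simp
    have "(\<Sum>u\<in>?S. ?s (pinv p \<circ> u) * f u) = (\<Sum>u\<in>?S. ?s (pinv p \<circ> (p \<circ> u)) * f (p \<circ> u))"
      by (rule setum_permutations_compose_left[OF Row_perm[OF p]])
    also have "\<dots> = (\<Sum>u\<in>?S. if u \<in> {u. u permutes Col} then of_int (sign u) * f (p \<circ> u) else 0)"
      using p by (intro sum.cong refl) (simp add: permutes_inv_o_o)
    also have "\<dots> = (\<Sum>u\<in>?S \<inter> {u. u permutes Col}. of_int (sign u) * f (p \<circ> u))"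
      by (rule sum.inter_restrict[symmetric]) (simp add: finite_permutations)
    also have "?S \<inter> {u. u permutes Col} = {u. u permutes Col}" using Col_perm by auto
    finally show "(\<Sum>u\<in>?S. ?s (pinv p \<circ> u) * f u) = (\<Sum>q | q permutes Col. of_int (sign q) * f (p \<circ> q))" .
  qed
  finally show ?thesis .
qed

text \<open>\<open>Col\<close> has one letter more than the complement of \<open>Row\<close>, so
  some \<open>y\<close> in \<open>Col\<close> is mapped into \<open>Row\<close>, and by
  \<open>one\<close> it is unique. The permutation \<open>q\<close> copies \<open>w\<close> on
  \<open>Col\<close> except that \<open>y\<close> goes to the corner letter 0; then \<open>w\<close>
  composed with the inverse of \<open>q\<close> fixes all letters outside
  \<open>Row\<close>.\<close>

lemma prod_decomposition:
  assumes w: "w permutes {0..<n}"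
    and one: "\<And>x y. x \<in> Col \<Longrightarrow> y \<in> Col \<Longrightarrow> w x \<in> Row \<Longrightarrow> w y \<in> Row \<Longrightarrow> x = y"
  obtains p q where "p permutes Row" "q permutes Col" "w = p \<circ> q"
proof -
  have win: "w x < n" if "x \<in> Col" for x
    using permutes_in_image[OF w, of x] that k by auto
  have "\<exists>y\<in>Col. w y \<in> Row"
  proof (rule ccontr)
    assume "\<not> (\<exists>y\<in>Col. w y \<in> Row)"
    then have "w ` Col \<subseteq> {k..<n}" using win by (auto simp: not_less)
    then have "card (w ` Col) \<le> n - k" using card_mono[of "{k..<n}" "w ` Col"] by simp
    moreover have "card (w ` Col) = card Col"
      by (rule card_image[OF inj_on_subset[OF permutes_inj[OF w] subset_UNIV]])
    moreover have "card Col = Suc (n - k)" using k by simp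
    ultimately show False by simp
  qed
  then obtain y where y: "y \<in> Col" "w y \<in> Row" by blast
  define q where "q = (\<lambda>x. if x = y then 0 else if x \<in> Col then w x else x)"
  have wx: "k \<le> w x" if "x \<in> Col" "x \<noteq> y" for x
    using one[OF that(1) y(1) _ y(2)] that by (auto simp: not_less[symmetric])
  have q: "q permutes Col"
  proof (rule inj_imp_permutes)
    show "inj_on q Col"
    proof (rule inj_onI)
      fix a b assume ab: "a \<in> Col" "b \<in> Col" "q a = q b"
      show "a = b"
        using ab wx[of a] wx[of b] k inj_eq[OF permutes_inj[OF w]]
        by (cases "a = y"; cases "b = y") (simp_all add: q_def del: insert_iff)
    qed
    show "q x \<in> Col" if "x \<in> Col" for x using that wx[of x] win[of x] by (auto simp: q_def)
  qed (use y in \<open>auto simp: q_def\<close>)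
  let ?p = "w \<circ> pinv q"
  have pn: "?p permutes {0..<n}" by (rule permutes_compose[OF permutes_inv[OF Col_perm[OF q]] w])
  have "?p permutes Row"
  proof (rule permutes_superset[OF pn])
    fix z assume "z \<in> {0..<n} - Row"
    then have z: "z \<in> Col" "z \<noteq> 0" using k(1) by auto
    have x: "pinv q z \<in> Col" by (rule iffD2[OF permutes_in_image[OF permutes_inv[OF q]] z(1)])
    have qx: "q (pinv q z) = z" by (rule permutes_inverses(1)[OF q])
    then have "pinv q z \<noteq> y" using z(2) by (auto simp: q_def)
    then have "w (pinv q z) = q (pinv q z)" using x by (simp add: q_def del: insert_iff)
    then show "?p z = z" using qx by simp
  qed
  moreover have "w = ?p \<circ> q"
    using permutes_inv_comp(1)[OF q] by (simp add: comp_assoc)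
  ultimately show thesis using that q by blast
qed

text \<open>Von Neumann's lemma for the hook.\<close>

lemma row_col_invariant:
  assumes left: "\<And>p w. p permutes Row \<Longrightarrow> w permutes {0..<n} \<Longrightarrow> x (p \<circ> w) = x w"
    and right: "\<And>q w. q permutes Col \<Longrightarrow> w permutes {0..<n} \<Longrightarrow> x (w \<circ> q) = of_int (sign q) * x w"
    and w: "w permutes {0..<n}"
  shows "x w = x id * ysym w"
proof (cases "\<exists>p q. p permutes Row \<and> q permutes Col \<and> w = p \<circ> q")
  case True
  then obtain p q where pq: "p permutes Row" "q permutes Col" "w = p \<circ> q" by blast
  have "x w = of_int (sign q) * x id"
    using left[OF pq(1) Col_perm[OF pq(2)]] right[OF pq(2) permutes_id] pq(3) by simp
  then show ?thesis using ysym_prod[OF pq(1,2)] pq(3) by simp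
next
  case False
  \<comment> \<open>Two letters of \<open>Col\<close> land in \<open>Row\<close>. Their
    transposition can be written on either side of \<open>w\<close>; it acts trivially from the left
    and by -1 from the right, so \<open>x w\<close> is zero.\<close>
  then obtain a b where ab: "a \<in> Col" "b \<in> Col" "w a \<in> Row" "w b \<in> Row" "a \<noteq> b"
    using prod_decomposition[OF w] by metis
  have t: "transpose a b permutes Col" "transpose (w a) (w b) permutes Row"
    by (rule permutes_swap_id[OF ab(1,2)], rule permutes_swap_id[OF ab(3,4)])
  have "transpose (w a) (w b) \<circ> w = w \<circ> transpose a b"
    using inj_eq[OF permutes_inj[OF w]] by (auto simp: fun_eq_iff transpose_def)
  then have "x w = - x w"
    using left[OF t(2) w] right[OF t(1) w] ab(5) by (simp add: sign_swap_id)
  moreover have "ysym w = 0"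
    using ysym_nonzero[OF w] False by blast
  ultimately show ?thesis by simp
qed

text \<open>The product of the hook lengths of the shape: \<open>n\<close> at the corner,
  \<open>k - 1, ..., 1\<close> along the arm and \<open>n - k, ..., 1\<close> along the leg.\<close>

abbreviation hook_prod :: nat where "hook_prod \<equiv> n * fact (k - 1) * fact (n - k)"

text \<open>If \<open>p\<close> or \<open>q\<close> fixes the corner letter 0, they move disjoint
  sets of letters and commute. Otherwise \<open>q \<circ> p = p' \<circ> q'\<close> is impossible:
  the letter that \<open>p\<close> sends to 0 lies outside \<open>Col\<close> and is fixed by
  \<open>q'\<close>, so \<open>q 0\<close> lies in both \<open>Row\<close> and \<open>Col\<close>
  and is 0.\<close>

lemma ysym_swap_prod:
  assumes p: "p permutes Row" and q: "q permutes Col"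
  shows "of_int (sign q) * ysym (q \<circ> p) = (if p 0 = 0 \<or> q 0 = 0 then 1 else 0)"
proof (cases "p 0 = 0 \<or> q 0 = 0")
  case True
  have "q \<circ> p = p \<circ> q"
  proof (cases "p 0 = 0")
    case True
    have "p permutes Row - {0}" by (rule permutes_superset[OF p]) (use True in auto)
    then show ?thesis using q Row_Col(3) by (intro permutes_disjoint_commute) auto
  next
    case False
    have "q permutes Col - {0}" by (rule permutes_superset[OF q]) (use True False in auto)
    then show ?thesis using p Row_Col(3) by (intro permutes_disjoint_commute) auto
  qed
  then have "ysym (q \<circ> p) = of_int (sign q)" by (simp add: ysym_prod[OF p q])
  then show ?thesis using True by (simp flip: of_int_mult)
next
  case False
  have qp: "q \<circ> p permutes {0..<n}" by (rule permutes_compose[OF Row_perm[OF p] Col_perm[OF q]])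
  have "ysym (q \<circ> p) = 0"
  proof (rule ccontr)
    assume "ysym (q \<circ> p) \<noteq> 0"
    then obtain p' q' where pq: "p' permutes Row" "q' permutes Col" "q \<circ> p = p' \<circ> q'"
      using ysym_nonzero[OF qp] by blast
    let ?x = "pinv p 0"
    have px: "p ?x = 0" by (rule permutes_inverses(1)[OF p])
    have xR: "?x \<in> Row" using permutes_in_image[OF permutes_inv[OF p], of 0] k by simp
    have "?x \<noteq> 0"
    proof
      assume "?x = 0"
      with px have "p 0 = 0" by simp
      with False show False by simp
    qed
    then have "?x \<notin> Col" using xR by auto
    then have "q' ?x = ?x" by (rule permutes_not_in[OF pq(2)])
    then have "q 0 = p' ?x" using fun_cong[OF pq(3), of ?x] px by simp
    moreover have "p' ?x \<in> Row" using permutes_in_image[OF pq(1)] xR by blast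
    moreover have "q 0 \<in> Col" using permutes_in_image[OF q, of 0] by simp
    ultimately show False using False by auto
  qed
  then show ?thesis using False by simp
qed

text \<open>The square inherits the invariance under both groups, so by
  \<open>row_col_invariant\<close> it is a multiple of \<open>ysym\<close>. The scalar is its value
  at \<open>id\<close>, which by \<open>ysym_swap_prod\<close> counts the pairs
  \<open>(p, q)\<close> with \<open>p 0 = 0\<close> or \<open>q 0 = 0\<close>:
  \<open>(k - 1)! (n - k + 1)! + (k - 1) (k - 1)! (n - k)!\<close>.\<close>

lemma ysym_idempotent: "ga_mult n ysym ysym = (\<lambda>w. real hook_prod * ysym w)"
proof
  fix w
  let ?x = "ga_mult n ysym ysym"
  let ?P = "{p. p permutes Row}" and ?Q = "{q. q permutes Col}"
  have x: "?x w = (\<Sum>p\<in>?P. \<Sum>q\<in>?Q. of_int (sign q) * ysym (pinv (p \<circ> q) \<circ> w))" if "w permutes {0..<n}" for w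
    unfolding ga_mult_eq[OF that] ysym_sum ..
  have "?x id = (\<Sum>p\<in>?P. \<Sum>q\<in>?Q. of_int (sign (pinv q)) * ysym (pinv q \<circ> pinv p))"
    unfolding x[OF permutes_id]
    by (intro sum.cong refl) (auto simp: permutes_o_inv sign_inv)
  also have "\<dots> = (\<Sum>p\<in>?P. \<Sum>q\<in>?Q. of_int (sign q) * ysym (q \<circ> pinv p))"
    by (intro sum.cong refl sum_permutations_inverse[symmetric])
  also have "\<dots> = (\<Sum>p\<in>?P. \<Sum>q\<in>?Q. of_int (sign q) * ysym (q \<circ> p))"
    by (rule sum_permutations_inverse[symmetric])
  also have "\<dots> = (\<Sum>p\<in>?P. \<Sum>q\<in>?Q. if p 0 = 0 \<or> q 0 = 0 then 1 else 0)"
    by (intro sum.cong refl) (auto simp: ysym_swap_prod)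
  also have "\<dots> = (\<Sum>p\<in>?P. if p 0 = 0 then real (card ?Q) else real (card {q \<in> ?Q. q 0 = 0}))"
    by (intro sum.cong refl) (auto simp: finite_permutations sum.If_cases Int_def)
  also have "\<dots> = real (card {p \<in> ?P. p 0 = 0}) * real (card ?Q) +
      real (card (?P - {p \<in> ?P. p 0 = 0})) * real (card {q \<in> ?Q. q 0 = 0})"
  proof -
    have "?P \<inter> {p. p 0 = 0} = {p \<in> ?P. p 0 = 0}" "?P \<inter> - {p. p 0 = 0} = ?P - {p \<in> ?P. p 0 = 0}" by auto
    then show ?thesis by (simp add: sum.If_cases finite_permutations)
  qed
  also have "\<dots> = real hook_prod"
  proof -
    have P0: "{p \<in> ?P. p 0 = 0} = {p. p permutes {Suc 0..<k}}"
    proof (intro equalityI subsetI)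
      fix p assume "p \<in> {p \<in> ?P. p 0 = 0}"
      then have "p permutes {Suc 0..<k}"
        by (auto intro!: permutes_superset[of p Row] simp: Suc_le_eq)
      then show "p \<in> {p. p permutes {Suc 0..<k}}" by simp
    next
      fix p assume "p \<in> {p. p permutes {Suc 0..<k}}"
      then have p: "p permutes {Suc 0..<k}" by simp
      then have "p permutes Row" by (rule permutes_subset) auto
      with permutes_not_in[OF p, of 0] show "p \<in> {p \<in> ?P. p 0 = 0}" by simp
    qed
    have Q0: "{q \<in> ?Q. q 0 = 0} = {q. q permutes {k..<n}}"
    proof (intro equalityI subsetI)
      fix q assume "q \<in> {q \<in> ?Q. q 0 = 0}"
      then have "q permutes {k..<n}"
        by (auto intro!: permutes_superset[of q Col])
      then show "q \<in> {q. q permutes {k..<n}}" by simp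
    next
      fix q assume "q \<in> {q. q permutes {k..<n}}"
      then have q: "q permutes {k..<n}" by simp
      then have "q permutes Col" by (rule permutes_subset) auto
      with permutes_not_in[OF q, of 0] k show "q \<in> {q \<in> ?Q. q 0 = 0}" by simp
    qed
    have cP: "card ?P = fact k" by (rule card_permutations) auto
    have cQ: "card ?Q = fact (Suc (n - k))" using k by (intro card_permutations) auto
    have cP0: "card {p \<in> ?P. p 0 = 0} = fact (k - 1)" unfolding P0 by (rule card_permutations) auto
    have cQ0: "card {q \<in> ?Q. q 0 = 0} = fact (n - k)" unfolding Q0 by (rule card_permutations) auto
    have fk: "(fact k :: nat) = k * fact (k - 1)" using k by (simp add: fact_reduce)
    have "card (?P - {p \<in> ?P. p 0 = 0}) = (k - 1) * fact (k - 1)"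
      using cP cP0 fk by (subst card_Diff_subset) (auto simp: finite_permutations diff_mult_distrib)
    then have "real (card {p \<in> ?P. p 0 = 0}) * real (card ?Q) +
        real (card (?P - {p \<in> ?P. p 0 = 0})) * real (card {q \<in> ?Q. q 0 = 0}) =
        real (fact (k - 1) * fact (Suc (n - k)) + (k - 1) * fact (k - 1) * fact (n - k))"
      unfolding cQ cP0 cQ0 by (simp only: of_nat_add of_nat_mult)
    also have "fact (k - 1) * fact (Suc (n - k)) + (k - 1) * fact (k - 1) * fact (n - k) =
        (Suc (n - k) + (k - 1)) * (fact (k - 1) * (fact (n - k) :: nat))"
      by (simp add: algebra_simps)
    also have "Suc (n - k) + (k - 1) = n" using k by simp
    finally show ?thesis by (simp add: mult.assoc)
  qed
  finally have id: "?x id = real hook_prod" .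
  show "?x w = real hook_prod * ysym w"
  proof (cases "w permutes {0..<n}")
    case True
    have "?x w = ?x id * ysym w"
    proof (rule row_col_invariant[OF _ _ True])
      fix p w assume p: "p permutes Row" and w: "w permutes {0..<n}"
      have pw: "p \<circ> w permutes {0..<n}" by (rule permutes_compose[OF w Row_perm[OF p]])
      have "?x (p \<circ> w) = (\<Sum>u | u permutes {0..<n}. ysym (p \<circ> u) * ysym (pinv (p \<circ> u) \<circ> (p \<circ> w)))"
        unfolding ga_mult_eq[OF pw] by (rule setum_permutations_compose_left[OF Row_perm[OF p]])
      also have "\<dots> = ?x w"
        unfolding ga_mult_eq[OF w]
        by (intro sum.cong refl)
          (auto simp: ysym_left[OF p] permutes_o_inv[OF p] comp_assoc permutes_inv_o_o[OF p])
      finally show "?x (p \<circ> w) = ?x w" .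
    next
      fix q w assume q: "q permutes Col" and w: "w permutes {0..<n}"
      have wq: "w \<circ> q permutes {0..<n}" by (rule permutes_compose[OF Col_perm[OF q] w])
      show "?x (w \<circ> q) = of_int (sign q) * ?x w"
        unfolding ga_mult_eq[OF w] ga_mult_eq[OF wq] sum_distrib_left
      proof (intro sum.cong refl)
        fix u assume "u \<in> {u. u permutes {0..<n}}"
        then have "pinv u \<circ> w permutes {0..<n}"
          using w by (intro permutes_compose permutes_inv) auto
        from ysym_right[OF q this]
        show "ysym u * ysym (pinv u \<circ> (w \<circ> q)) = of_int (sign q) * (ysym u * ysym (pinv u \<circ> w))"
          by (simp add: o_assoc)
      qed
    qed
    then show ?thesis using id by simp
  qed (simp add: ysym_outside ga_mult_def)
qed

section \<open>The character and degree of a hook as sums over conjugates\<close>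

definition conj_sum :: "(nat \<Rightarrow> nat) \<Rightarrow> real" where
  "conj_sum w = (\<Sum>u | u permutes {0..<n}. ysym (pinv u \<circ> (pinv w \<circ> u)))"

lemma irr_char_hook:
  assumes "w permutes {0..<n}"
  shows "irr_char (hook n k) w = conj_sum w / real hook_prod"
  using irr_char_quasi_idempotent[of "hook n k" "real hook_prod" w] ysym_idempotent assms k
  by (simp add: sum_list_hook conj_sum_def)

lemma conj_sum_id: "conj_sum id = fact n"
proof -
  have "conj_sum id = (\<Sum>u | u permutes {0..<n}. 1)"
    unfolding conj_sum_def by (intro sum.cong refl) (simp add: inv_id permutes_inv_comp ysym_id)
  then show ?thesis by (simp add: card_permutations)
qed

lemma hook_prod_choose: "real hook_prod * real ((n - 1) choose (k - 1)) = fact n"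
proof -
  have "fact (k - 1) * fact (n - 1 - (k - 1)) * ((n - 1) choose (k - 1)) = (fact (n - 1) :: nat)"
    using k by (intro binomial_fact_lemma) auto
  moreover have "n - 1 - (k - 1) = n - k" using k by simp
  moreover have "fact n = n * (fact (n - 1) :: nat)" using k by (simp add: fact_reduce)
  ultimately have "hook_prod * ((n - 1) choose (k - 1)) = fact n"
    by (simp add: mult.assoc)
  then show ?thesis by (metis of_nat_fact of_nat_mult)
qed

lemma irr_char_hook_id: "irr_char (hook n k) id = real ((n - 1) choose (k - 1))"
  unfolding irr_char_hook[OF permutes_id] conj_sum_id hook_prod_choose[symmetric] using k by simp

text \<open>The indicator pulls the sum over conjugates inside, so that the character becomes a
  signed sum of a class function over both groups. In this form different hooks can be
  compared.\<close>

lemma conj_sum_eq: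
  assumes w: "w permutes {0..<n}"
  shows "conj_sum w = (\<Sum>p | p permutes Row. \<Sum>q | q permutes Col. of_int (sign q) *
    (\<Sum>u | u permutes {0..<n}. if p \<circ> q = pinv u \<circ> (pinv w \<circ> u) then 1 else 0))"
proof -
  let ?S = "{u. u permutes {0..<n}}"
  have "conj_sum w = (\<Sum>u\<in>?S. \<Sum>x\<in>?S. ysym x * (if x = pinv u \<circ> (pinv w \<circ> u) then 1 else 0))"
    unfolding conj_sum_def
  proof (intro sum.cong refl)
    fix u assume "u \<in> ?S"
    then have m: "pinv u \<circ> (pinv w \<circ> u) \<in> ?S"
      using w by (auto intro!: permutes_compose permutes_inv)
    have "(\<Sum>x\<in>?S. ysym x * (if x = pinv u \<circ> (pinv w \<circ> u) then 1 else 0)) =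
        (\<Sum>x\<in>?S. if x = pinv u \<circ> (pinv w \<circ> u) then ysym x else 0)"
      by (intro sum.cong) auto
    then show "ysym (pinv u \<circ> (pinv w \<circ> u)) =
        (\<Sum>x\<in>?S. ysym x * (if x = pinv u \<circ> (pinv w \<circ> u) then 1 else 0))"
      using m by (simp add: finite_permutations sum.delta)
  qed
  also have "\<dots> = (\<Sum>x\<in>?S. ysym x * (\<Sum>u\<in>?S. if x = pinv u \<circ> (pinv w \<circ> u) then 1 else 0))"
    by (subst sum.swap) (simp add: sum_distrib_left)
  finally show ?thesis unfolding ysym_sum .
qed

end

subsection \<open>Hook characters\<close>

text \<open>If \<open>A\<close> and \<open>B\<close> partition the letters, this pairs a class
  function \<open>f\<close>, up to the factor |A|! |B|!, with the character induced from trivial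
  times sign. The recursion \<open>two_sum_hook\<close> reflects Pieri's rule: this induced
  character is the sum of two neighbouring hook characters.\<close>

definition two_sum :: "((nat \<Rightarrow> nat) \<Rightarrow> real) \<Rightarrow> nat set \<Rightarrow> nat set \<Rightarrow> real" where
  "two_sum f A B = (\<Sum>p | p permutes A. \<Sum>q | q permutes B. of_int (sign q) * f (p \<circ> q))"

lemma permutes_conj:
  assumes h: "bij h" and p: "p permutes A"
  shows "h \<circ> p \<circ> pinv h permutes h ` A"
proof -
  have "bij (h \<circ> p \<circ> pinv h)"
    using h permutes_bij[OF p] by (intro bij_comp bij_imp_bij_inv)
  then have "\<forall>y. \<exists>!x. (h \<circ> p \<circ> pinv h) x = y" by (simp add: bij_iff)
  moreover have "(h \<circ> p \<circ> pinv h) x = x" if "x \<notin> h ` A" for x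
  proof -
    have hx: "h (pinv h x) = x" using h by (simp add: bij_is_surj surj_f_inv_f)
    then have "pinv h x \<notin> A" using that by (metis imageI)
    then show ?thesis using hx permutes_not_in[OF p] by simp
  qed
  ultimately show ?thesis by (simp add: permutes_def)
qed

lemma conj_inverse:
  assumes "bij h"
  shows "pinv h \<circ> (h \<circ> p \<circ> pinv h) \<circ> h = p" "h \<circ> (pinv h \<circ> p \<circ> h) \<circ> pinv h = p"
  using assms by (auto simp: fun_eq_iff bij_is_inj bij_is_surj surj_f_inv_f)

lemma sum_permutes_conj:
  assumes h: "bij h"
  shows "(\<Sum>p | p permutes h ` A. F p) = (\<Sum>p | p permutes A. F (h \<circ> p \<circ> pinv h))"
proof (rule sum.reindex_bij_witness[where i = "\<lambda>p. h \<circ> p \<circ> pinv h" and j = "\<lambda>p. pinv h \<circ> p \<circ> h"])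
  fix p assume "p \<in> {p. p permutes h ` A}"
  then have "pinv h \<circ> p \<circ> pinv (pinv h) permutes pinv h ` (h ` A)"
    using h by (intro permutes_conj bij_imp_bij_inv) auto
  moreover have "pinv h ` (h ` A) = A" using h by (simp add: image_comp bij_is_inj)
  ultimately show "pinv h \<circ> p \<circ> h \<in> {p. p permutes A}"
    using h by (simp add: inv_inv_eq)
qed (use h permutes_conj in \<open>auto simp: conj_inverse\<close>)

lemma sign_conj:
  assumes "h permutes U" "q permutes B" "finite U" "finite B"
  shows "sign (h \<circ> q \<circ> pinv h) = sign q"
proof -
  have "permutation h" "permutation q" using assms permutes_imp_permutation by blast+
  then show ?thesis
    by (simp add: sign_compose permutation_compose permutation_inverse sign_inverse)
qed

lemma two_sum_conj:
  assumes h: "h permutes U" "finite U" and B: "finite B"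
  shows "two_sum f (h ` A) (h ` B) = two_sum (\<lambda>x. f (h \<circ> x \<circ> pinv h)) A B"
proof -
  have bh: "bij h" by (rule permutes_bij[OF h(1)])
  have "(h \<circ> p \<circ> pinv h) \<circ> (h \<circ> q \<circ> pinv h) = h \<circ> (p \<circ> q) \<circ> pinv h" for p q
    using bh by (auto simp: fun_eq_iff bij_is_inj)
  then show ?thesis
    unfolding two_sum_def sum_permutes_conj[OF bh]
    using sign_conj[OF h(1) _ h(2) B] by simp
qed

definition class_fun :: "nat \<Rightarrow> ((nat \<Rightarrow> nat) \<Rightarrow> real) \<Rightarrow> bool" where
  "class_fun n f \<longleftrightarrow> (\<forall>h x. h permutes {0..<n} \<longrightarrow> f (h \<circ> x \<circ> pinv h) = f x)"

lemma class_fun_commute: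
  assumes "class_fun n f" "x permutes {0..<n}"
  shows "f (x \<circ> y) = f (y \<circ> x)"
proof -
  have "x \<circ> (y \<circ> x) \<circ> pinv x = x \<circ> y"
    using permutes_inverses[OF assms(2)] by (auto simp: fun_eq_iff)
  then show ?thesis using assms unfolding class_fun_def by metis
qed

lemma two_sum_class_conj:
  assumes f: "class_fun n f" and h: "h permutes {0..<n}" and B: "finite B"
  shows "two_sum f (h ` A) (h ` B) = two_sum f A B"
proof -
  have "f (h \<circ> x \<circ> pinv h) = f x" for x using f h by (simp add: class_fun_def)
  then show ?thesis by (simp add: two_sum_conj[OF h _ B])
qed

lemma comp_transpose:
  assumes "inj h"
  shows "h \<circ> transpose a b = transpose (h a) (h b) \<circ> h"
  using inj_eq[OF assms] by (auto simp: fun_eq_iff transpose_def)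

text \<open>
  Splitting off the corner letter from the column group, respectively from the row group, gives
  \<open>X - (n - k) Y\<close> and \<open>X + k Y\<close>, where \<open>X\<close> is the sum on the right and \<open>Y\<close> is the same sum with a
  transposition of a row letter and a column letter inserted.
\<close>

theorem two_sum_hook:
  assumes f: "class_fun n f" and k: "0 < k" "k < n"
  shows "real k * two_sum f {0..<k} (insert 0 {k..<n}) +
      real (n - k) * two_sum f {0..<Suc k} (insert 0 {Suc k..<n}) =
    real n * two_sum f {0..<k} {k..<n}"
proof -
  let ?A = "{0..<k}" and ?B = "{k..<n}"
  have sub: "?A \<subseteq> {0..<n}" "?B \<subseteq> {0..<n}" using k by auto
  have Ap: "p permutes {0..<n}" if "p permutes ?A" for p by (rule permutes_subset[OF that sub(1)])
  have Bp: "q permutes {0..<n}" if "q permutes ?B" for q by (rule permutes_subset[OF that sub(2)])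
  define X where "X = two_sum f ?A ?B"
  define Y where "Y a b = two_sum (\<lambda>x. f (transpose a b \<circ> x)) ?A ?B" for a b
  have Yconj: "Y (h a) (h b) = Y a b" if h: "h permutes {0..<n}" "h ` ?A = ?A" "h ` ?B = ?B" for h a b
  proof -
    have bh: "bij h" by (rule permutes_bij[OF h(1)])
    have eq: "f (transpose (h a) (h b) \<circ> (h \<circ> x \<circ> pinv h)) = f (transpose a b \<circ> x)" for x
    proof -
      have "transpose (h a) (h b) \<circ> (h \<circ> x \<circ> pinv h) = h \<circ> (transpose a b \<circ> x) \<circ> pinv h"
        using comp_transpose[OF bij_is_inj[OF bh], of a b] by (simp add: o_assoc)
      then show ?thesis using f h(1) by (simp add: class_fun_def)
    qed
    have "Y (h a) (h b) = two_sum (\<lambda>x. f (transpose (h a) (h b) \<circ> x)) (h ` ?A) (h ` ?B)"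
      by (simp add: Y_def h)
    also have "\<dots> = Y a b"
      by (simp only: two_sum_conj[OF h(1) finite_atLeastLessThan finite_atLeastLessThan] eq Y_def)
    finally show ?thesis .
  qed
  \<comment> \<open>Conjugation by transpositions inside \<open>?A\<close> and inside
    \<open>?B\<close> moves \<open>(0, k)\<close> to \<open>(a, b)\<close>.\<close>
  have Y: "Y a b = Y 0 k" if ab: "a \<in> ?A" "b \<in> ?B" for a b
  proof -
    let ?h = "transpose 0 a" and ?g = "transpose k b"
    have h: "?h permutes ?A" using ab k by (intro permutes_swap_id) auto
    have g: "?g permutes ?B" using ab k by (intro permutes_swap_id) auto
    have hB: "?h ` ?B = ?B" and gA: "?g ` ?A = ?A"
      using permutes_not_in[OF h] permutes_not_in[OF g] by force+
    have "Y (?h 0) (?h k) = Y 0 k"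
      by (rule Yconj[OF Ap[OF h] permutes_image[OF h] hB])
    moreover have "Y (?g a) (?g k) = Y a k"
      by (rule Yconj[OF Bp[OF g] gA permutes_image[OF g]])
    moreover have "?h k = k" "?g a = a"
      using permutes_not_in[OF h, of k] permutes_not_in[OF g, of a] ab by auto
    ultimately show ?thesis by simp
  qed
  have 1: "two_sum f ?A (insert 0 ?B) = X - real (n - k) * Y 0 k"
  proof -
    let ?T = "\<lambda>b. \<Sum>p | p permutes ?A. \<Sum>q | q permutes ?B.
        of_int (sign (transpose 0 b \<circ> q)) * f (p \<circ> (transpose 0 b \<circ> q))"
    have "two_sum f ?A (insert 0 ?B) = (\<Sum>p | p permutes ?A. \<Sum>b\<in>insert 0 ?B. \<Sum>q | q permutes ?B.
        of_int (sign (transpose 0 b \<circ> q)) * f (p \<circ> (transpose 0 b \<circ> q)))"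
      unfolding two_sum_def using k by (subst sum_over_permutations_insert) auto
    also have "\<dots> = (\<Sum>b\<in>insert 0 ?B. ?T b)"
      by (rule sum.swap)
    also have "\<dots> = X + (\<Sum>b\<in>?B. ?T b)"
      using k by (subst sum.insert) (auto simp: X_def two_sum_def)
    also have "(\<Sum>b\<in>?B. ?T b) = (\<Sum>b\<in>?B. - Y 0 k)"
    proof (rule sum.cong[OF refl])
      fix b assume b: "b \<in> ?B"
      have "of_int (sign (transpose 0 b \<circ> q)) * f (p \<circ> (transpose 0 b \<circ> q)) =
          - (of_int (sign q) * f (transpose 0 b \<circ> (p \<circ> q)))" if p: "p permutes ?A" and q: "q permutes ?B" for p q
      proof -
        have "f (p \<circ> (transpose 0 b \<circ> q)) = f ((transpose 0 b \<circ> q) \<circ> p)"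
          by (rule class_fun_commute[OF f Ap[OF p]])
        also have "(transpose 0 b \<circ> q) \<circ> p = transpose 0 b \<circ> (p \<circ> q)"
          using permutes_disjoint_commute[OF p q] by (simp add: comp_assoc)
        finally have 1: "f (p \<circ> (transpose 0 b \<circ> q)) = f (transpose 0 b \<circ> (p \<circ> q))" .
        have "sign (transpose 0 b \<circ> q) = sign (transpose 0 b) * sign q"
          using b k by (intro sign_comp[OF permutes_swap_id[of 0 "{0..<n}"] q]) auto
        then show ?thesis unfolding 1 using b k by (simp add: sign_swap_id)
      qed
      then have "?T b = - Y 0 b"
        by (simp add: Y_def two_sum_def sum_negf)
      then show "?T b = - Y 0 k"
        using Y[of 0 b] b k by simp
    qed
    finally show ?thesis by simp
  qed
  have 2: "two_sum f {0..<Suc k} (insert 0 {Suc k..<n}) = X + real k * Y 0 k"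
  proof -
    \<comment> \<open>Exchanging 0 and \<open>k\<close> makes \<open>k\<close> the common letter of
      the two groups, so that it can be split off from the row group.\<close>
    let ?h = "transpose 0 k"
    have h: "?h permutes {0..<n}" using k by (intro permutes_swap_id) auto
    have hk: "?h permutes {0..<Suc k}" by (intro permutes_swap_id) auto
    have "?h ` ?B = insert 0 {Suc k..<n}"
    proof -
      have "?B = insert k {Suc k..<n}" using k by auto
      moreover have "?h ` {Suc k..<n} = {Suc k..<n}"
        using permutes_not_in[OF hk] by force
      ultimately show ?thesis by simp
    qed
    then have "two_sum f {0..<Suc k} (insert 0 {Suc k..<n}) = two_sum f (?h ` {0..<Suc k}) (?h ` ?B)"
      by (simp only: permutes_image[OF hk])
    also have "\<dots> = two_sum f {0..<Suc k} ?B"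
      by (rule two_sum_class_conj[OF f h]) simp
    also have "\<dots> = two_sum f (insert k ?A) ?B"
      by (intro arg_cong2[of _ _ _ _ "two_sum f"]) auto
    also have "\<dots> = (\<Sum>b\<in>insert k ?A. \<Sum>p | p permutes ?A. \<Sum>q | q permutes ?B.
        of_int (sign q) * f ((transpose k b \<circ> p) \<circ> q))"
      unfolding two_sum_def by (subst sum_over_permutations_insert) auto
    also have "\<dots> = X + (\<Sum>b\<in>?A. Y b k)"
      by (subst sum.insert) (auto simp: X_def Y_def two_sum_def comp_assoc transpose_commute[of k])
    also have "(\<Sum>b\<in>?A. Y b k) = (\<Sum>b\<in>?A. Y 0 k)"
      using k by (intro sum.cong refl Y) auto
    also have "\<dots> = real k * Y 0 k" by simp
    finally show ?thesis .
  qed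
  show ?thesis
    unfolding 1 2 X_def[symmetric] using k by (simp add: algebra_simps of_nat_diff)
qed

section \<open>Principal minors of permutation matrices\<close>

text \<open>For a permutation \<open>x\<close> and a set \<open>I\<close> of letters, this is the
  sign of \<open>x\<close> restricted to \<open>I\<close> if \<open>x\<close> preserves
  \<open>I\<close>, and 0 otherwise, since the factorization of \<open>x\<close> is unique.\<close>

definition split_sign :: "nat \<Rightarrow> (nat \<Rightarrow> nat) \<Rightarrow> nat set \<Rightarrow> real" where
  "split_sign n x I = two_sum (\<lambda>y. if y = x then 1 else 0) ({0..<n} - I) I"

lemma split_sign_inv:
  assumes x: "x permutes {0..<n}" and I: "I \<subseteq> {0..<n}"
  shows "split_sign n (pinv x) I = split_sign n x I"
proof -
  let ?A = "{0..<n} - I"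
  have fin: "finite I" using I by (rule finite_subset) simp
  have "split_sign n (pinv x) I = (\<Sum>p | p permutes ?A. \<Sum>q | q permutes I.
      of_int (sign (pinv q)) * (if pinv p \<circ> pinv q = pinv x then 1 else 0))"
    unfolding split_sign_def two_sum_def
    by (subst sum_permutations_inverse, rule sum.cong[OF refl], rule sum_permutations_inverse)
  also have "\<dots> = split_sign n x I"
    unfolding split_sign_def two_sum_def
  proof (rule sum.cong[OF refl], rule sum.cong[OF refl])
    fix p q assume "p \<in> {p. p permutes ?A}" "q \<in> {q. q permutes I}"
    then have p: "p permutes ?A" and q: "q permutes I" by auto
    have "pinv p \<circ> pinv q = pinv (q \<circ> p)" by (rule permutes_o_inv[OF q p, symmetric])
    also have "q \<circ> p = p \<circ> q" by (rule permutes_disjoint_commute[OF q p]) auto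
    finally have "pinv p \<circ> pinv q = pinv x \<longleftrightarrow> pinv (p \<circ> q) = pinv x" by (simp only:)
    also have "\<dots> \<longleftrightarrow> p \<circ> q = x"
      using permutes_bij[OF p] permutes_bij[OF q] permutes_bij[OF x] by (metis bij_comp inv_inv_eq)
    finally show "of_int (sign (pinv q)) * (if pinv p \<circ> pinv q = pinv x then 1 else 0) =
        (of_int (sign q) * (if p \<circ> q = x then 1 else 0) :: real)"
      using sign_inv[OF q fin] by simp
  qed
  finally show ?thesis .
qed

text \<open>Each column of the padded matrix is a unit vector, so only a \<open>p\<close> that
  agrees with \<open>w\<close> on \<open>I\<close> and fixes the other letters contributes. Such a
  permutation exists exactly if \<open>w\<close> preserves \<open>I\<close>.\<close>

lemma pminor_permutation:
  assumes w: "w permutes {0..<n}" and I: "I \<subseteq> {0..<n}"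
  shows "pminor n (\<lambda>i j. if i = w j then 1 else 0) I = split_sign n w I"
proof -
  let ?U = "{0..<n}"
  have fin: "finite I" using I by (rule finite_subset) simp
  have ind: "(\<Prod>j\<in>?U. if P j then 1 else 0) = (if \<forall>j\<in>?U. P j then 1 else 0 :: real)" for P
    by (induction n) (auto simp: less_Suc_eq)
  have "pminor n (\<lambda>i j. if i = w j then 1 else 0) I =
      (\<Sum>p | p permutes ?U. of_int (sign p) * (\<Prod>j\<in>?U. if p j = (if j \<in> I then w j else j) then 1 else 0))"
    unfolding lessThan_atLeast0[symmetric] using I
    by (subst pminor_cols) (auto simp: lessThan_atLeast0 fdet_cols intro!: sum.cong prod.cong)
  also have "\<dots> = (\<Sum>p | p permutes ?U. if p \<in> {p. p permutes I \<and> (\<forall>j\<in>I. p j = w j)} then of_int (sign p) else 0)"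
  proof (rule sum.cong[OF refl])
    fix p assume "p \<in> {p. p permutes ?U}"
    then have p: "p permutes ?U" by simp
    have "(\<forall>j\<in>?U. p j = (if j \<in> I then w j else j)) \<longleftrightarrow> p permutes I \<and> (\<forall>j\<in>I. p j = w j)"
      using I permutes_superset[OF p, of I] permutes_not_in[of p I] by (auto simp: subset_iff)
    then show "of_int (sign p) * (\<Prod>j\<in>?U. if p j = (if j \<in> I then w j else j) then 1 else 0) =
        (if p \<in> {p. p permutes I \<and> (\<forall>j\<in>I. p j = w j)} then of_int (sign p) else 0 :: real)"
      unfolding ind by simp
  qed
  also have "\<dots> = (\<Sum>p\<in>{p. p permutes ?U} \<inter> {p. p permutes I \<and> (\<forall>j\<in>I. p j = w j)}. of_int (sign p))"
    by (rule sum.inter_restrict[symmetric]) (simp add: finite_permutations)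
  also have "{p. p permutes ?U} \<inter> {p. p permutes I \<and> (\<forall>j\<in>I. p j = w j)} =
      {p. p permutes I} \<inter> {p. \<forall>j\<in>I. p j = w j}"
    using permutes_subset[OF _ I] by auto
  also have "(\<Sum>p\<in>{p. p permutes I} \<inter> {p. \<forall>j\<in>I. p j = w j}. of_int (sign p)) =
      (\<Sum>q | q permutes I. if q \<in> {p. \<forall>j\<in>I. p j = w j} then of_int (sign q) else 0 :: real)"
    by (rule sum.inter_restrict) (simp add: finite_permutations fin)
  also have "\<dots> = (\<Sum>q | q permutes I. \<Sum>p | p permutes ?U - I.
      of_int (sign q) * (if p \<circ> q = w then 1 else 0))"
  proof (rule sum.cong[OF refl])
    fix q assume "q \<in> {q. q permutes I}"
    then have q: "q permutes I" by simp
    have qU: "q permutes ?U" by (rule permutes_subset[OF q I])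
    \<comment> \<open>The complementary factor is determined by \<open>q\<close>; it permutes the
      complement of \<open>I\<close> exactly if \<open>q\<close> agrees with \<open>w\<close> on
      \<open>I\<close>.\<close>
    have pq: "p \<circ> q = w \<longleftrightarrow> p = w \<circ> pinv q" for p
    proof
      assume "p \<circ> q = w"
      then show "p = w \<circ> pinv q" using permutes_inv_comp(2)[OF q] by (auto simp: comp_assoc)
    next
      assume "p = w \<circ> pinv q"
      then show "p \<circ> q = w" using permutes_inv_comp(1)[OF q] by (simp add: comp_assoc)
    qed
    have "w \<circ> pinv q permutes ?U - I \<longleftrightarrow> (\<forall>j\<in>I. q j = w j)"
    proof
      assume "w \<circ> pinv q permutes ?U - I"
      then have fixed: "w (pinv q i) = i" if "i \<in> I" for i
        using permutes_not_in[of "w \<circ> pinv q" "?U - I" i] that by simp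
      show "\<forall>j\<in>I. q j = w j"
      proof
        fix j assume "j \<in> I"
        then have "q j \<in> I" using permutes_in_image[OF q] by simp
        then show "q j = w j" using fixed[of "q j"] permutes_inverses(2)[OF q] by simp
      qed
    next
      assume eq: "\<forall>j\<in>I. q j = w j"
      have wq: "w \<circ> pinv q permutes ?U" by (rule permutes_compose[OF permutes_inv[OF qU] w])
      show "w \<circ> pinv q permutes ?U - I"
      proof (rule permutes_superset[OF wq])
        fix x assume "x \<in> ?U - (?U - I)"
        then have "pinv q x \<in> I" using permutes_in_image[OF permutes_inv[OF q]] by simp
        then have "w (pinv q x) = q (pinv q x)" using eq by simp
        then show "(w \<circ> pinv q) x = x" using permutes_inverses(1)[OF q] by simp
      qed
    qed
    then show "(if q \<in> {p. \<forall>j\<in>I. p j = w j} then of_int (sign q) else 0) =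
        (\<Sum>p | p permutes ?U - I. of_int (sign q) * (if p \<circ> q = w then 1 else 0) :: real)"
      unfolding pq sum_distrib_left[symmetric] by (simp add: finite_permutations sum.delta)
  qed
  also have "\<dots> = split_sign n w I"
    unfolding split_sign_def two_sum_def by (rule sum.swap)
  finally show ?thesis .
qed

text \<open>The sum over \<open>u\<close> is the same for every set of the size of \<open>B\<close>,
  by composing with a permutation that maps \<open>B\<close> to that set. Summing over all these
  sets first, each \<open>u\<close> merely permutes them.\<close>

lemma sum_permutes_image:
  fixes F :: "nat set \<Rightarrow> real"
  assumes B: "B \<subseteq> {0..<n}"
  shows "real (n choose card B) * (\<Sum>u | u permutes {0..<n}. F (u ` B)) =
    fact n * (\<Sum>I | I \<subseteq> {0..<n} \<and> card I = card B. F I)"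
proof -
  let ?U = "{0..<n}" and ?S = "{I. I \<subseteq> {0..<n} \<and> card I = card B}"
  have finB: "finite B" using B by (rule finite_subset) simp
  have same: "(\<Sum>u | u permutes ?U. F (u ` I)) = (\<Sum>u | u permutes ?U. F (u ` B))" if I: "I \<in> ?S" for I
  proof -
    obtain h where h: "h permutes ?U" "\<And>x. x \<in> ?U \<Longrightarrow> h x \<in> I \<longleftrightarrow> x \<in> B"
      using permutes_onto_subset[of ?U B I] B I by auto
    have "h ` B = I"
    proof (rule card_subset_eq)
      show "finite I" using I finite_subset by blast
      show "h ` B \<subseteq> I" using h(2) B by blast
      show "card (h ` B) = card I"
        using I card_image[OF inj_on_subset[OF permutes_inj[OF h(1)] subset_UNIV]] by auto
    qed
    then show ?thesis
      using sum_permutations_compose_right[OF h(1), of "\<lambda>u. F (u ` B)"]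
      by (simp only: image_comp[symmetric])
  qed
  have perm: "(\<Sum>I\<in>?S. F (u ` I)) = (\<Sum>I\<in>?S. F I)" if u: "u permutes ?U" for u
  proof (rule sum.reindex_bij_witness[where i = "\<lambda>I. pinv u ` I" and j = "\<lambda>I. u ` I"])
    have img: "v ` I \<in> ?S" if "v permutes ?U" "I \<in> ?S" for v I
      using that permutes_image[OF that(1)]
        card_image[OF inj_on_subset[OF permutes_inj[OF that(1)] subset_UNIV], of I] by auto
    show "pinv u ` I \<in> ?S" if "I \<in> ?S" for I by (rule img[OF permutes_inv[OF u] that])
    show "u ` I \<in> ?S" if "I \<in> ?S" for I by (rule img[OF u that])
  qed (auto simp: image_comp permutes_inv_comp[OF u])
  have cS: "card ?S = n choose card B" using n_subsets[of ?U "card B"] by simp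
  have "real (n choose card B) * (\<Sum>u | u permutes ?U. F (u ` B)) = (\<Sum>I\<in>?S. \<Sum>u | u permutes ?U. F (u ` I))"
    using same cS by simp
  also have "\<dots> = (\<Sum>u | u permutes ?U. \<Sum>I\<in>?S. F (u ` I))" by (rule sum.swap)
  also have "\<dots> = fact n * (\<Sum>I\<in>?S. F I)"
    using perm by (simp add: card_permutations)
  finally show ?thesis .
qed

text \<open>Up to a positive factor, the indicator of the conjugacy class of the inverse of
  \<open>w\<close>.\<close>

definition conj_ind :: "nat \<Rightarrow> (nat \<Rightarrow> nat) \<Rightarrow> (nat \<Rightarrow> nat) \<Rightarrow> real" where
  "conj_ind n w x = (\<Sum>u | u permutes {0..<n}. if x = pinv u \<circ> (pinv w \<circ> u) then 1 else 0)"

lemma class_fun_conj_ind: "class_fun n (conj_ind n w)"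
  unfolding class_fun_def
proof (intro allI impI)
  fix h x :: "nat \<Rightarrow> nat" assume h: "h permutes {0..<n}"
  have "conj_ind n w (h \<circ> x \<circ> pinv h) = (\<Sum>u | u permutes {0..<n}.
      if h \<circ> x \<circ> pinv h = pinv (u \<circ> pinv h) \<circ> (pinv w \<circ> (u \<circ> pinv h)) then 1 else 0)"
    unfolding conj_ind_def by (rule sum_permutations_compose_right[OF permutes_inv[OF h]])
  also have "\<dots> = conj_ind n w x"
    unfolding conj_ind_def
  proof (rule sum.cong[OF refl])
    fix u assume "u \<in> {u. u permutes {0..<n}}"
    then have u: "u permutes {0..<n}" by simp
    have bh: "bij h" by (rule permutes_bij[OF h])
    have "pinv (u \<circ> pinv h) \<circ> (pinv w \<circ> (u \<circ> pinv h)) = h \<circ> (pinv u \<circ> (pinv w \<circ> u)) \<circ> pinv h"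
      using permutes_o_inv[OF u permutes_inv[OF h]] bh by (simp add: inv_inv_eq o_assoc)
    moreover have "h \<circ> x \<circ> pinv h = h \<circ> y \<circ> pinv h \<longleftrightarrow> x = y" for y
      using conj_inverse(1)[OF bh] by metis
    ultimately show "(if h \<circ> x \<circ> pinv h = pinv (u \<circ> pinv h) \<circ> (pinv w \<circ> (u \<circ> pinv h)) then 1 else 0) =
        (if x = pinv u \<circ> (pinv w \<circ> u) then 1 else 0 :: real)" by simp
  qed
  finally show "conj_ind n w (h \<circ> x \<circ> pinv h) = conj_ind n w x" .
qed

text \<open>Conjugation by \<open>u\<close> is shifted from \<open>w\<close> to the two blocks,
  which become the image of \<open>{k..<n}\<close> and its complement. As \<open>u\<close> varies,
  every set of \<open>n - k\<close> letters is such an image equally often.\<close>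

lemma two_sum_conj_ind:
  assumes w: "w permutes {0..<n}" and k: "k \<le> n"
  shows "real (n choose k) * two_sum (conj_ind n w) {0..<k} {k..<n} =
    fact n * esum n (\<lambda>i j. if i = w j then 1 else 0) (n - k)"
proof -
  let ?U = "{0..<n}" and ?A = "{0..<k}" and ?B = "{k..<n}"
  have "two_sum (conj_ind n w) ?A ?B =
      (\<Sum>p | p permutes ?A. \<Sum>u | u permutes ?U. \<Sum>q | q permutes ?B.
        of_int (sign q) * (if p \<circ> q = pinv u \<circ> (pinv w \<circ> u) then 1 else 0))"
    unfolding two_sum_def conj_ind_def sum_distrib_left by (rule sum.cong[OF refl]) (rule sum.swap)
  also have "\<dots> = (\<Sum>u | u permutes ?U. two_sum (\<lambda>x. if x = pinv u \<circ> (pinv w \<circ> u) then 1 else 0) ?A ?B)"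
    unfolding two_sum_def by (rule sum.swap)
  also have "\<dots> = (\<Sum>u | u permutes ?U. split_sign n w (u ` ?B))"
  proof (rule sum.cong[OF refl])
    fix u assume "u \<in> {u. u permutes ?U}"
    then have u: "u permutes ?U" by simp
    have bu: "bij u" by (rule permutes_bij[OF u])
    have "x = pinv u \<circ> (pinv w \<circ> u) \<longleftrightarrow> u \<circ> x \<circ> pinv u = pinv w" for x
    proof
      assume "x = pinv u \<circ> (pinv w \<circ> u)"
      then have "x = pinv u \<circ> pinv w \<circ> u" by (simp only: comp_assoc)
      then show "u \<circ> x \<circ> pinv u = pinv w" by (simp only: conj_inverse(2)[OF bu])
    next
      assume eq: "u \<circ> x \<circ> pinv u = pinv w"
      have "pinv u \<circ> (u \<circ> x \<circ> pinv u) \<circ> u = x" by (rule conj_inverse(1)[OF bu])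
      then show "x = pinv u \<circ> (pinv w \<circ> u)" unfolding eq by (simp only: comp_assoc)
    qed
    then have "two_sum (\<lambda>x. if x = pinv u \<circ> (pinv w \<circ> u) then 1 else 0) ?A ?B =
        two_sum (\<lambda>x. if u \<circ> x \<circ> pinv u = pinv w then 1 else 0) ?A ?B" by simp
    also have "\<dots> = two_sum (\<lambda>x. if x = pinv w then 1 else 0) (u ` ?A) (u ` ?B)"
      by (rule two_sum_conj[OF u, symmetric]) auto
    also have "u ` ?A = ?U - u ` ?B"
    proof -
      have "?A = ?U - ?B" using k by auto
      then show ?thesis
        using image_set_diff[OF permutes_inj[OF u], of ?U ?B] permutes_image[OF u] by simp
    qed
    also have "two_sum (\<lambda>x. if x = pinv w then 1 else 0) (?U - u ` ?B) (u ` ?B) = split_sign n (pinv w) (u ` ?B)"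
      by (simp add: split_sign_def)
    also have "\<dots> = split_sign n w (u ` ?B)"
      using permutes_image[OF u] k by (intro split_sign_inv[OF w]) auto
    finally show "two_sum (\<lambda>x. if x = pinv u \<circ> (pinv w \<circ> u) then 1 else 0) ?A ?B = split_sign n w (u ` ?B)" .
  qed
  finally have "two_sum (conj_ind n w) ?A ?B = (\<Sum>u | u permutes ?U. split_sign n w (u ` ?B))" .
  moreover have "real (n choose card ?B) * (\<Sum>u | u permutes ?U. split_sign n w (u ` ?B)) =
      fact n * (\<Sum>I | I \<subseteq> ?U \<and> card I = card ?B. split_sign n w I)"
    using k by (intro sum_permutes_image) auto
  moreover have "(\<Sum>I | I \<subseteq> ?U \<and> card I = card ?B. split_sign n w I) =
      esum n (\<lambda>i j. if i = w j then 1 else 0) (n - k)"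
    unfolding esum_def by (intro sum.cong) (auto simp: pminor_permutation[OF w] lessThan_atLeast0)
  moreover have "n choose card ?B = n choose k" using binomial_symmetric[OF k] by simp
  ultimately show ?thesis by simp
qed

lemma (in hook_shape) conj_sum_two_sum:
  "w permutes {0..<n} \<Longrightarrow> conj_sum w = two_sum (conj_ind n w) {0..<k} (insert 0 {k..<n})"
  by (simp add: conj_sum_eq two_sum_def conj_ind_def)

text \<open>Downward induction on \<open>k\<close>: \<open>two_sum_hook\<close> relates the hook
  sums for \<open>k\<close> and \<open>Suc k\<close> to the sum over disjoint blocks, which is an
  \<open>esum\<close>. This is the recursion \<open>alt_esum_Suc\<close> once \<open>c1\<close> and
  \<open>c2\<close> match the binomial coefficients.\<close>

lemma two_sum_alt_esum:
  assumes w: "w permutes {0..<n}" and k: "0 < k" "k \<le> n"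
  shows "real ((n - 1) choose (k - 1)) * two_sum (conj_ind n w) {0..<k} (insert 0 {k..<n}) =
    fact n * alt_esum n (\<lambda>i j. if i = w j then 1 else 0) (n - k)"
  using k(2) k(1)
proof (induction k rule: inc_induct)
  case base
  have "two_sum (conj_ind n w) {0..<n} (insert 0 {n..<n}) = two_sum (conj_ind n w) {0..<n} {n..<n}"
    by (simp add: two_sum_def)
  then show ?case
    using two_sum_conj_ind[OF w, of n] by simp
next
  case (step k)
  let ?W = "\<lambda>i j. if i = w j then 1 else 0 :: real"
  let ?N = "\<lambda>k. two_sum (conj_ind n w) {0..<k} (insert 0 {k..<n})"
  obtain m where n: "n = Suc m" using step.hyps by (cases n) auto
  obtain l where l: "k = Suc l" using step.prems by (cases k) auto
  have lm: "l < m" using step.hyps n l by simp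
  define c where "c = real (m choose l)"
  have c: "c \<noteq> 0" using lm by (simp add: c_def)
  have c1: "real k * real (m choose Suc l) = real (n - k) * c"
    by (simp only: n l c_def of_nat_mult[symmetric] Suc_times_choose_Suc diff_Suc_Suc)
  have c2: "real k * real (n choose k) = real n * c"
    by (simp only: n l c_def of_nat_mult[symmetric] binomial_absorption diff_Suc_1)
  have rel: "real k * ?N k + real (n - k) * ?N (Suc k) = real n * two_sum (conj_ind n w) {0..<k} {k..<n}"
    using step by (intro two_sum_hook class_fun_conj_ind) auto
  have E: "real (n choose k) * two_sum (conj_ind n w) {0..<k} {k..<n} = fact n * esum n ?W (n - k)"
    using step by (intro two_sum_conj_ind[OF w]) auto
  have IH: "real (m choose Suc l) * ?N (Suc k) = fact n * alt_esum n ?W (n - Suc k)"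
    using step unfolding n l by simp
  have nk: "n - k = Suc (n - Suc k)" using step.hyps by simp
  have alt: "alt_esum n ?W (n - k) = esum n ?W (n - k) - alt_esum n ?W (n - Suc k)"
    unfolding nk by (rule alt_esum_Suc)
  have "real k * (c * ?N k) = c * (real n * two_sum (conj_ind n w) {0..<k} {k..<n}) - c * (real (n - k) * ?N (Suc k))"
    unfolding rel[symmetric] by (simp add: algebra_simps)
  also have "c * (real n * two_sum (conj_ind n w) {0..<k} {k..<n}) =
      real k * (real (n choose k) * two_sum (conj_ind n w) {0..<k} {k..<n})"
    using c2 by (metis mult.assoc mult.commute)
  also have "c * (real (n - k) * ?N (Suc k)) = real k * (real (m choose Suc l) * ?N (Suc k))"
    using c1 by (metis mult.assoc mult.commute)
  also have "real k * (real (n choose k) * two_sum (conj_ind n w) {0..<k} {k..<n}) -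
      real k * (real (m choose Suc l) * ?N (Suc k)) = real k * (fact n * alt_esum n ?W (n - k))"
    unfolding E IH alt by (simp add: algebra_simps)
  finally have "c * ?N k = fact n * alt_esum n ?W (n - k)"
    using step.prems by simp
  then show ?case by (simp add: c_def n l)
qed

theorem irr_char_hook_alt_esum:
  assumes w: "w permutes {0..<n}" and k: "0 < k" "k \<le> n"
  shows "irr_char (hook n k) w = alt_esum n (\<lambda>i j. if i = w j then 1 else 0) (n - k)"
proof -
  interpret hook_shape n k by unfold_locales (use k in auto)
  have nz: "real hook_prod \<noteq> 0" "real ((n - 1) choose (k - 1)) \<noteq> 0" using k by auto
  have "real ((n - 1) choose (k - 1)) * (real hook_prod * irr_char (hook n k) w) =
      real ((n - 1) choose (k - 1)) * conj_sum w"
    using nz by (simp only: irr_char_hook[OF w]) simp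
  also have "\<dots> = real hook_prod * real ((n - 1) choose (k - 1)) * alt_esum n (\<lambda>i j. if i = w j then 1 else 0) (n - k)"
    unfolding conj_sum_two_sum[OF w] two_sum_alt_esum[OF w k] hook_prod_choose ..
  finally show ?thesis using nz by (simp only: mult_ac mult_cancel_left) simp
qed

subsection \<open>Hook immanants\<close>

text \<open>A strictly increasing word is recovered from its image by \<open>pick\<close>, so its
  minors are determinants of submatrices.\<close>

lemma totally_nonnegative_TN:
  assumes A: "A \<in> carrier_mat n n" "totally_nonnegative A"
  shows "TN {..<n} {..<n} (\<lambda>i j. A $$ (i, j))"
proof (rule TN_I)
  fix k and r c :: "nat \<Rightarrow> nat"
  assume r: "strict_mono_on {..<k} r" "r ` {..<k} \<subseteq> {..<n}" and c: "strict_mono_on {..<k} c" "c ` {..<k} \<subseteq> {..<n}"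
  have card: "card {i. i < n \<and> i \<in> f ` {..<k}} = k" "card (f ` {..<k}) = k"
    if "strict_mono_on {..<k} f" "f ` {..<k} \<subseteq> {..<n}" for f
  proof -
    have "{i. i < n \<and> i \<in> f ` {..<k}} = f ` {..<k}" using that(2) by auto
    moreover have "card (f ` {..<k}) = k"
      using card_image[OF strict_mono_on_imp_inj_on[OF that(1)]] by simp
    ultimately show "card {i. i < n \<and> i \<in> f ` {..<k}} = k" "card (f ` {..<k}) = k" by simp_all
  qed
  have pick: "pick (f ` {..<k}) i = f i" if f: "strict_mono_on {..<k} f" and i: "i < k" for f i
  proof -
    have "{a \<in> f ` {..<k}. a < f i} = f ` {..<i}"
      using strict_mono_on_less[OF f] i by fastforce
    moreover have "card (f ` {..<i}) = i"
      using card_image[OF inj_on_subset[OF strict_mono_on_imp_inj_on[OF f]], of "{..<i}"] i by simp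
    ultimately show ?thesis
      using pick_card_in_set[of "f i" "f ` {..<k}"] i by simp
  qed
  have "submatrix A (r ` {..<k}) (c ` {..<k}) = mat k k (\<lambda>(i, j). A $$ (r i, c j))"
    unfolding submatrix_def using A(1) card(1)[OF r] card(1)[OF c]
    by (intro eq_matI) (auto simp: pick[OF r(1)] pick[OF c(1)])
  moreover have "0 \<le> det (submatrix A (r ` {..<k}) (c ` {..<k}))"
    using A r(2) c(2) card(2)[OF r] card(2)[OF c]
    unfolding totally_nonnegative_def by (auto simp: lessThan_atLeast0)
  ultimately show "0 \<le> fdet k (\<lambda>i j. A $$ (r i, c j))" by (simp add: fdet_def)
qed

text \<open>Only an increasing permutation, hence the identity, can contribute to a minor.\<close>

lemma TN_stochastic_id: "TN_stochastic n (\<lambda>i j. if i = j then 1 else 0)"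
proof -
  have "TN {..<n} {..<n} (\<lambda>i j. if i = j then 1 else 0)"
  proof (rule TN_I)
    fix k and r c :: "nat \<Rightarrow> nat"
    assume r: "strict_mono_on {..<k} r" and c: "strict_mono_on {..<k} c"
    show "0 \<le> fdet k (\<lambda>i j. if r i = c j then 1 else 0)"
      unfolding fdet_rows
    proof (intro sum_nonneg)
      fix p assume "p \<in> {p. p permutes {..<k}}"
      then have p: "p permutes {..<k}" by simp
      let ?m = "\<Prod>i<k. if r i = c (p i) then 1 else 0 :: real"
      show "0 \<le> of_int (sign p) * ?m"
      proof (cases "\<forall>i<k. r i = c (p i)")
        case True
        have "p i < p j" if "i < j" "j < k" for i j
        proof -
          have "r i < r j" using strict_mono_onD[OF r, of i j] that by auto
          then have "c (p i) < c (p j)" using True that by auto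
          then show ?thesis
            using strict_mono_on_less[OF c] permutes_lessThan[OF p] that by auto
        qed
        then have "p = id" by (rule permutes_increasing_id[OF p])
        then show ?thesis by (auto intro: prod_nonneg)
      next
        case False
        then obtain i where "i < k" "r i \<noteq> c (p i)" by blast
        then have "?m = 0" by (intro prod_zero) (auto intro!: bexI[of _ i])
        then show ?thesis by (simp only: mult_zero_right)
      qed
    qed
  qed
  then show ?thesis by (simp add: TN_stochastic_def)
qed

lemma minor_comb_esum: "minor_comb n g X = (\<Sum>m\<le>n. g m * esum n X m)"
proof -
  have "minor_comb n g X = (\<Sum>m\<le>n. \<Sum>I\<in>{I \<in> Pow {..<n}. card I = m}. g (card I) * pminor n X I)"
    unfolding minor_comb_def
    by (rule sum.group[symmetric]) (auto simp: card_mono[of "{..<n}", simplified])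
  also have "\<dots> = (\<Sum>m\<le>n. g m * esum n X m)"
    unfolding esum_def sum_distrib_left by (intro sum.cong) auto
  finally show ?thesis .
qed

definition alt_coeff :: "nat \<Rightarrow> nat \<Rightarrow> real" where
  "alt_coeff m i = (if i \<le> m then (-1) ^ (m - i) else 0)"

lemma alt_esum_minor_comb:
  assumes "m \<le> n"
  shows "minor_comb n (alt_coeff m) X = alt_esum n X m"
proof -
  have "minor_comb n (alt_coeff m) X = (\<Sum>i\<le>n. if i \<in> {..m} then (-1) ^ (m - i) * esum n X i else 0)"
    unfolding minor_comb_esum by (intro sum.cong) (auto simp: alt_coeff_def)
  also have "\<dots> = (\<Sum>i\<in>{..n} \<inter> {..m}. (-1) ^ (m - i) * esum n X i)"
    by (rule sum.inter_restrict[symmetric]) simp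
  also have "{..n} \<inter> {..m} = {..m}" using assms by auto
  finally show ?thesis by (simp add: alt_esum_def)
qed

text \<open>The initial word and matrix are identities, so the argument of \<open>minor_comb\<close>
  is the permutation matrix of \<open>w\<close>, at which the alternating sums are the hook
  characters.\<close>

theorem hook_immanant_ineq:
  assumes A: "TN {..<n} {..<n} a" and k: "2 \<le> k" "k \<le> n"
  shows "0 \<le> (\<Sum>w | w permutes {0..<n}. (irr_char (hook n k) w / irr_char (hook n k) id -
    irr_char (hook n (k - 1)) w / irr_char (hook n (k - 1)) id) * (\<Prod>i = 0..<n. a i (w i)))"
proof -
  obtain N where n: "n = Suc N" using k by (cases n) auto
  define m where "m = n - k"
  have m: "m < N" "n - (k - 1) = Suc m" "n - k = m" using k n by (auto simp: m_def)
  define x where "x = real (N choose m)"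
  define y where "y = real (N choose Suc m)"
  let ?g = "\<lambda>i. alt_coeff m i / x - alt_coeff (Suc m) i / y"
  let ?d = "\<lambda>i j :: nat. if i = j then 1 else 0 :: real"
  have g: "minor_comb n ?g X = alt_esum n X m / x - alt_esum n X (Suc m) / y" for X
  proof -
    have "minor_comb n ?g X = minor_comb n (alt_coeff m) X / x - minor_comb n (alt_coeff (Suc m)) X / y"
      unfolding minor_comb_esum sum_divide_distrib sum_subtractf[symmetric]
      by (intro sum.cong) (auto simp: algebra_simps)
    then show ?thesis using m(1) n by (simp add: alt_esum_minor_comb)
  qed
  have "0 \<le> minor_comb n ?g B" if "TN_stochastic n B" for B
    unfolding g unfolding n x_def y_def
    using normalized_alt_esum_antimono[of N B m] that m(1) n by simp
  then have "word_pos n ?g a" by (rule TN_imp_word_pos[OF A])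
  then have "0 \<le> word_imm n ?g a (\<lambda>i. i) ?d"
    using TN_stochastic_id unfolding word_pos_def by (auto simp: mono_on_def)
  also have "word_imm n ?g a (\<lambda>i. i) ?d = (\<Sum>w | w permutes {0..<n}. (irr_char (hook n k) w / irr_char (hook n k) id -
    irr_char (hook n (k - 1)) w / irr_char (hook n (k - 1)) id) * (\<Prod>i = 0..<n. a i (w i)))"
    unfolding word_imm_def lessThan_atLeast0
  proof (rule sum.cong[OF refl])
    fix w assume "w \<in> {w. w permutes {0..<n}}"
    then have w: "w permutes {0..<n}" by simp
    have k': "0 < k" "0 < k - 1" "k - 1 \<le> n" using k by auto
    interpret h: hook_shape n k by unfold_locales (use k in auto)
    interpret h': hook_shape n "k - 1" by unfold_locales (use k' in auto)
    \<comment> \<open>Characters are indexed by the row length \<open>k\<close>, minors by the leg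
      length \<open>m = n - k\<close>; symmetry of the binomial coefficients reconciles the
      normalizations.\<close>
    have "(n - 1) choose (k - 1) = N choose m"
      using binomial_symmetric[of m N] m k n by (simp add: m_def)
    then have 1: "irr_char (hook n k) id = x" using h.irr_char_hook_id by (simp add: x_def)
    have "(n - 1) choose (k - 1 - 1) = N choose Suc m"
    proof -
      have "k - 1 - 1 = N - Suc m" using m k n by (simp add: m_def)
      then show ?thesis using binomial_symmetric[of "Suc m" N] m(1) n by simp
    qed
    then have 2: "irr_char (hook n (k - 1)) id = y" using h'.irr_char_hook_id by (simp add: y_def)
    show "(\<Prod>i = 0..<n. a i (w i)) * minor_comb n ?g (\<lambda>i j. ?d i (w j)) =
        (irr_char (hook n k) w / irr_char (hook n k) id -
        irr_char (hook n (k - 1)) w / irr_char (hook n (k - 1)) id) * (\<Prod>i = 0..<n. a i (w i))"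
      unfolding g 1 2 irr_char_hook_alt_esum[OF w k'(1) k(2)] irr_char_hook_alt_esum[OF w k'(2,3)] m
      by (simp only: mult.commute)
  qed
  finally show ?thesis .
qed

lemma irr_char_trivial: "0 < n \<Longrightarrow> w permutes {0..<n} \<Longrightarrow> irr_char [n] w = 1"
  using irr_char_hook_alt_esum[of w n n] by (simp add: hook_def)

text \<open>For \<open>k = 1\<close> the row group is trivial and the column group is everything, so
  the sum runs over the conjugates of the inverse of \<open>w\<close>, all of which have the sign of
  \<open>w\<close>.\<close>

lemma irr_char_sign:
  assumes n: "0 < n" and w: "w permutes {0..<n}"
  shows "irr_char (replicate n 1) w = of_int (sign w)"
proof -
  let ?U = "{0..<n}"
  have h: "hook n 1 = replicate n 1" using n by (cases n) (auto simp: hook_def)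
  have U: "insert 0 {1..<n} = ?U" using n by auto
  have "fact n * irr_char (replicate n 1) w = two_sum (conj_ind n w) {0..<1} (insert 0 {1..<n})"
    using two_sum_alt_esum[OF w, of 1] irr_char_hook_alt_esum[OF w, of 1] n unfolding h by simp
  also have "\<dots> = (\<Sum>q | q permutes ?U. of_int (sign q) * conj_ind n w q)"
    unfolding two_sum_def U by simp
  also have "\<dots> = (\<Sum>q | q permutes ?U. \<Sum>u | u permutes ?U.
      if q = pinv u \<circ> (pinv w \<circ> u) then of_int (sign q) else 0)"
    unfolding conj_ind_def sum_distrib_left by (intro sum.cong) auto
  also have "\<dots> = (\<Sum>u | u permutes ?U. \<Sum>q | q permutes ?U.
      if q = pinv u \<circ> (pinv w \<circ> u) then of_int (sign q) else 0)"
    by (rule sum.swap)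
  also have "\<dots> = (\<Sum>u | u permutes ?U. of_int (sign w))"
  proof (rule sum.cong[OF refl])
    fix u assume "u \<in> {u. u permutes ?U}"
    then have u: "u permutes ?U" by simp
    have wu: "pinv w \<circ> u permutes ?U" by (rule permutes_compose[OF u permutes_inv[OF w]])
    have q: "pinv u \<circ> (pinv w \<circ> u) permutes ?U" by (rule permutes_compose[OF wu permutes_inv[OF u]])
    have "sign (pinv u \<circ> (pinv w \<circ> u)) = sign (pinv u) * (sign (pinv w) * sign u)"
      by (simp only: sign_comp[OF permutes_inv[OF u] wu finite_atLeastLessThan finite_atLeastLessThan]
          sign_comp[OF permutes_inv[OF w] u finite_atLeastLessThan finite_atLeastLessThan])
    also have "\<dots> = sign w"
      by (simp add: sign_inv[OF u] sign_inv[OF w])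
    finally show "(\<Sum>q | q permutes ?U. if q = pinv u \<circ> (pinv w \<circ> u) then of_int (sign q) else 0) =
        (of_int (sign w) :: real)"
      using q by (simp add: finite_permutations sum.delta)
  qed
  also have "\<dots> = fact n * of_int (sign w)" by (simp add: card_permutations)
  finally show ?thesis by simp
qed

section \<open>Evaluation of polynomials in the matrix entries\<close>

definition monom_eval :: "real mat \<Rightarrow> ((nat \<times> nat) \<Rightarrow>\<^sub>0 nat) \<Rightarrow> real" where
  "monom_eval A m = (\<Prod>v\<in>Poly_Mapping.keys m. (A $$ v) ^ Poly_Mapping.lookup m v)"

text \<open>Monomials may cancel in a sum; evaluating over a common finite superset of the keys
  makes additivity immediate.\<close>

lemma peval_superset:
  assumes "finite K" "Poly_Mapping.keys f \<subseteq> K"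
  shows "peval f A = (\<Sum>m\<in>K. Poly_Mapping.lookup f m * monom_eval A m)"
  unfolding peval_def monom_eval_def
  using assms by (intro sum.mono_neutral_left) (auto simp: in_keys_iff)

lemma peval_add: "peval (f + g) A = peval f A + peval g A"
proof -
  let ?K = "Poly_Mapping.keys f \<union> Poly_Mapping.keys g"
  have "Poly_Mapping.keys (f + g) \<subseteq> ?K" by (rule keys_add)
  then show ?thesis
    by (simp add: peval_superset[of ?K] lookup_add algebra_simps sum.distrib)
qed

lemma peval_sum: "finite S \<Longrightarrow> peval (\<Sum>s\<in>S. f s) A = (\<Sum>s\<in>S. peval (f s) A)"
proof (induction S rule: finite_induct)
  case empty
  show ?case by (simp add: peval_def)
qed (simp add: peval_add)

lemma peval_single: "peval (Poly_Mapping.single m c) A = c * monom_eval A m"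
  by (subst peval_superset[of "{m}"]) auto

definition perm_monom :: "nat \<Rightarrow> (nat \<Rightarrow> nat) \<Rightarrow> (nat \<times> nat) \<Rightarrow>\<^sub>0 nat" where
  "perm_monom n w = (\<Sum>i = 0..<n. Poly_Mapping.single (i, w i) 1)"

lemma lookup_perm_monom:
  "Poly_Mapping.lookup (perm_monom n w) v = (if v \<in> (\<lambda>i. (i, w i)) ` {0..<n} then 1 else 0)"
proof -
  have "Poly_Mapping.lookup (perm_monom n w) v = (\<Sum>i = 0..<n. if i = fst v then if w i = snd v then 1 else 0 else 0)"
    unfolding perm_monom_def lookup_sum by (intro sum.cong) (auto simp: lookup_single when_def prod_eq_iff)
  then show ?thesis by (auto simp: image_iff prod_eq_iff)
qed

lemma keys_perm_monom: "Poly_Mapping.keys (perm_monom n w) = (\<lambda>i. (i, w i)) ` {0..<n}"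
  by (auto simp: in_keys_iff lookup_perm_monom split: if_splits)

lemma monom_eval_perm_monom: "monom_eval A (perm_monom n w) = (\<Prod>i = 0..<n. A $$ (i, w i))"
proof -
  have "monom_eval A (perm_monom n w) = (\<Prod>v\<in>(\<lambda>i. (i, w i)) ` {0..<n}. A $$ v)"
    unfolding monom_eval_def keys_perm_monom by (intro prod.cong) (auto simp: lookup_perm_monom)
  also have "\<dots> = (\<Prod>i = 0..<n. A $$ (i, w i))"
    by (subst prod.reindex) (auto simp: inj_on_def)
  finally show ?thesis .
qed

lemma prod_pvar: "(\<Prod>i = 0..<n. pvar (i, w i)) = Poly_Mapping.single (perm_monom n w) 1"
proof -
  have "(\<Prod>i\<in>S. pvar (i, w i)) = Poly_Mapping.single (\<Sum>i\<in>S. Poly_Mapping.single (i, w i) 1) 1"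
    if "finite S" for S
    using that by (induction S rule: finite_induct) (simp_all add: pvar_def mult_single)
  then show ?thesis by (simp add: perm_monom_def)
qed

lemma scaled_immanant_poly:
  "pconst a * immanant_poly n \<theta> = (\<Sum>w | w permutes {0..<n}. Poly_Mapping.single (perm_monom n w) (a * \<theta> w))"
proof -
  have "(\<Prod>i = 0..<n. generic_matrix n $$ (i, w i)) = Poly_Mapping.single (perm_monom n w) 1"
    if "w permutes {0..<n}" for w
  proof -
    have "(\<Prod>i = 0..<n. generic_matrix n $$ (i, w i)) = (\<Prod>i = 0..<n. pvar (i, w i))"
      using permutes_in_image[OF that] by (intro prod.cong) (auto simp: generic_matrix_def)
    then show ?thesis by (simp only: prod_pvar)
  qed
  moreover have "dim_row (generic_matrix n) = n" by (simp add: generic_matrix_def)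
  ultimately show ?thesis
    unfolding immanant_poly_def immanant_def sum_distrib_left
    by (intro sum.cong) (simp_all add: pconst_def mult_single)
qed

lemma immanant_poly_difference:
  "pconst a * immanant_poly n \<theta> - pconst b * immanant_poly n \<theta>' =
    (\<Sum>w | w permutes {0..<n}. Poly_Mapping.single (perm_monom n w) (a * \<theta> w - b * \<theta>' w))"
  by (simp add: scaled_immanant_poly single_diff sum_subtractf)

lemma pvars_perm_poly:
  "pvars (\<Sum>w | w permutes {0..<n}. Poly_Mapping.single (perm_monom n w) (f w)) \<subseteq> {0..<n} \<times> {0..<n}"
proof
  fix v assume "v \<in> pvars (\<Sum>w | w permutes {0..<n}. Poly_Mapping.single (perm_monom n w) (f w))"
  then obtain m where m: "v \<in> Poly_Mapping.keys m"
    "m \<in> Poly_Mapping.keys (\<Sum>w | w permutes {0..<n}. Poly_Mapping.single (perm_monom n w) (f w))"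
    by (auto simp: pvars_def)
  then obtain w where w: "w permutes {0..<n}" "m \<in> Poly_Mapping.keys (Poly_Mapping.single (perm_monom n w) (f w))"
    using subsetD[OF keys_sum m(2)] by blast
  then have "m = perm_monom n w" by (auto split: if_splits)
  then have "v \<in> (\<lambda>i. (i, w i)) ` {0..<n}"
    using m(1) by (simp only: keys_perm_monom)
  then obtain i where i: "v = (i, w i)" "i \<in> {0..<n}" by (rule imageE)
  then show "v \<in> {0..<n} \<times> {0..<n}"
    by (simp only: mem_Times_iff fst_conv snd_conv permutes_in_image[OF w(1)])
qed

lemma peval_perm_poly:
  "peval (\<Sum>w | w permutes {0..<n}. Poly_Mapping.single (perm_monom n w) (f w)) A =
    (\<Sum>w | w permutes {0..<n}. f w * (\<Prod>i = 0..<n. A $$ (i, w i)))"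
  by (simp add: peval_sum finite_permutations peval_single monom_eval_perm_monom)

theorem theorem5p1:
  fixes n :: nat
  assumes "n \<ge> 1"
  shows
    "(\<forall>A \<in> carrier_mat n n. totally_nonnegative A \<longrightarrow>
        permanent A = immanant (irr_char [n]) A / irr_char [n] id \<and>
        (\<forall>k \<in> {2..n}.
           immanant (irr_char (hook n k)) A / irr_char (hook n k) id
           \<ge> immanant (irr_char (hook n (k - 1))) A / irr_char (hook n (k - 1)) id) \<and>
        immanant (irr_char (replicate n 1)) A / irr_char (replicate n 1) id = det A) \<and>
     (\<forall>k \<in> {2..n}.
        pconst (1 / irr_char (hook n k) id) * immanant_poly n (irr_char (hook n k))
        - pconst (1 / irr_char (hook n (k - 1)) id) * immanant_poly n (irr_char (hook n (k - 1)))
        = pconst (1 / real ((n - 1) choose (k - 1))) * immanant_poly n (irr_char (hook n k))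
        - pconst (1 / real ((n - 1) choose (k - 2))) * immanant_poly n (irr_char (hook n (k - 1))) \<and>
        totally_nonnegative_poly n
          (pconst (1 / irr_char (hook n k) id) * immanant_poly n (irr_char (hook n k))
           - pconst (1 / irr_char (hook n (k - 1)) id) * immanant_poly n (irr_char (hook n (k - 1)))))"
proof (intro conjI ballI impI)
  fix A :: "real mat" assume A: "A \<in> carrier_mat n n"
  have n: "0 < n" using assms by simp
  have dim: "dim_row A = n" using A by simp
  have "immanant (irr_char [n]) A = permanent A"
    unfolding immanant_def permanent_def dim
    by (intro sum.cong refl) (auto simp: irr_char_trivial[OF n])
  then show "permanent A = immanant (irr_char [n]) A / irr_char [n] id"
    by (simp add: irr_char_trivial[OF n permutes_id])
  have "immanant (irr_char (replicate n 1)) A = det A"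
    unfolding immanant_def dim det_def'[OF A]
    by (intro sum.cong refl) (auto simp: irr_char_sign[OF n, simplified])
  then show "immanant (irr_char (replicate n 1)) A / irr_char (replicate n 1) id = det A"
    using irr_char_sign[OF n permutes_id] by simp
next
  fix A :: "real mat" and k
  assume A: "A \<in> carrier_mat n n" "totally_nonnegative A" and k: "k \<in> {2..n}"
  have "0 \<le> (\<Sum>w | w permutes {0..<n}. (irr_char (hook n k) w / irr_char (hook n k) id -
      irr_char (hook n (k - 1)) w / irr_char (hook n (k - 1)) id) * (\<Prod>i = 0..<n. A $$ (i, w i)))"
    using k by (intro hook_immanant_ineq totally_nonnegative_TN[OF A]) auto
  also have "\<dots> = immanant (irr_char (hook n k)) A / irr_char (hook n k) id -
      immanant (irr_char (hook n (k - 1))) A / irr_char (hook n (k - 1)) id"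
    using A(1) unfolding immanant_def
    by (simp add: left_diff_distrib sum_subtractf sum_divide_distrib)
  finally show "immanant (irr_char (hook n (k - 1))) A / irr_char (hook n (k - 1)) id \<le>
      immanant (irr_char (hook n k)) A / irr_char (hook n k) id" by simp
next
  fix k assume k: "k \<in> {2..n}"
  interpret h: hook_shape n k by unfold_locales (use k in auto)
  interpret h': hook_shape n "k - 1" by unfold_locales (use k in auto)
  have "k - 1 - 1 = k - 2" by simp
  then show "pconst (1 / irr_char (hook n k) id) * immanant_poly n (irr_char (hook n k))
      - pconst (1 / irr_char (hook n (k - 1)) id) * immanant_poly n (irr_char (hook n (k - 1)))
      = pconst (1 / real ((n - 1) choose (k - 1))) * immanant_poly n (irr_char (hook n k))
      - pconst (1 / real ((n - 1) choose (k - 2))) * immanant_poly n (irr_char (hook n (k - 1)))"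
    by (simp only: h.irr_char_hook_id h'.irr_char_hook_id)
next
  fix k assume k: "k \<in> {2..n}"
  show "totally_nonnegative_poly n
      (pconst (1 / irr_char (hook n k) id) * immanant_poly n (irr_char (hook n k))
       - pconst (1 / irr_char (hook n (k - 1)) id) * immanant_poly n (irr_char (hook n (k - 1))))"
    unfolding totally_nonnegative_poly_def immanant_poly_difference peval_perm_poly
    using hook_immanant_ineq[OF totally_nonnegative_TN] k pvars_perm_poly by simp
qed

end
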